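(* Let $\Lambda=kQ/I$ be a bound quiver algebra and let $A$ be a set of arrows of $Q$. Then $\Lambda/\langle A+I\rangle$ is an arrow removal algebra of $\Lambda$ (in the sense of Green, Psaroudakis and Solberg) if and only if $A$ is pre-removable in $\Lambda$ and the ideal $\langle A+I\rangle$ is projective as a $\Lambda$-bimodule.
   Context: A bound quiver algebra $\Lambda=kQ/I$ consists of a field $k$, a finite quiver $Q$ and an admissible ideal $I$ of the path algebra $kQ$ (every path occurring in an element of $I$ has length at least $2$, and $I$ contains all paths of length $N$ for some $N>1$). Paths are composed from left to right, $s(\cdot)$ and $t(\cdot)$ denote source and target, $e_v$ is the trivial path at $v$, and $\langle A+I\rangle$ is the ideal of $\Lambda$ generated by the cosets of the arrows in $A$. $\Lambda$-bimodules are modules over $\Lambda\otimes_k\Lambda^{\mathrm{op}}$. $\Lambda/\langle A+I\rangle$ is an arrow removal of $\Lambda$ in the sense of Green-Psaroudakis-Solberg if (i) there is a generating set for $I$ avoiding all arrows in $A$ (no path occurring with non-zero coefficient in an element of the set is divided by an arrow of $A$), and (ii) $e_{t(\alpha_1)}\Lambda e_{s(\alpha_2)}=0$ for all $\alpha_1,\alpha_2\in A$. Every $z\in kQ$ is uniquely $z=z_A+z_{\mathrm{not}A}$, where $z_A$ is a linear combination of paths passing through at least one arrow of $A$ and $z_{\mathrm{not}A}$ one of paths avoiding all arrows of $A$; $A$ is pre-removable in $\Lambda$ if $z_A,z_{\mathrm{not}A}\in I$ for every $z\in I$. *)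

theory Defs
  imports "HOL-Algebra.QuotRing" "HOL-Algebra.Module" "Graph_Theory.Arc_Walk"
begin

section \<open>Modules over a not necessarily commutative ring\<close>

text \<open>The locale \<open>module\<close> of the library requires a commutative ring of scalars.\<close>

locale left_module = R?: ring R + M?: abelian_group M for R (structure) and M (structure) +
  assumes smult_closed:
      "\<lbrakk>a \<in> carrier R; x \<in> carrier M\<rbrakk> \<Longrightarrow> a \<odot>\<^bsub>M\<^esub> x \<in> carrier M"
    and smult_l_distr:
      "\<lbrakk>a \<in> carrier R; b \<in> carrier R; x \<in> carrier M\<rbrakk>
        \<Longrightarrow> (a \<oplus> b) \<odot>\<^bsub>M\<^esub> x = a \<odot>\<^bsub>M\<^esub> x \<oplus>\<^bsub>M\<^esub> b \<odot>\<^bsub>M\<^esub> x"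
    and smult_r_distr:
      "\<lbrakk>a \<in> carrier R; x \<in> carrier M; y \<in> carrier M\<rbrakk>
        \<Longrightarrow> a \<odot>\<^bsub>M\<^esub> (x \<oplus>\<^bsub>M\<^esub> y) = a \<odot>\<^bsub>M\<^esub> x \<oplus>\<^bsub>M\<^esub> a \<odot>\<^bsub>M\<^esub> y"
    and smult_assoc:
      "\<lbrakk>a \<in> carrier R; b \<in> carrier R; x \<in> carrier M\<rbrakk>
        \<Longrightarrow> (a \<otimes> b) \<odot>\<^bsub>M\<^esub> x = a \<odot>\<^bsub>M\<^esub> (b \<odot>\<^bsub>M\<^esub> x)"
    and smult_one: "x \<in> carrier M \<Longrightarrow> \<one> \<odot>\<^bsub>M\<^esub> x = x"

definition lmod_hom ::
  "('r, 'c) ring_scheme \<Rightarrow> ('r, 'm, 'd) module_scheme \<Rightarrow> ('r, 'n, 'e) module_scheme \<Rightarrow> ('m \<Rightarrow> 'n) set"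
  where "lmod_hom R M N = {f. (\<forall>x\<in>carrier M. f x \<in> carrier N) \<and>
    (\<forall>x\<in>carrier M. \<forall>y\<in>carrier M. f (x \<oplus>\<^bsub>M\<^esub> y) = f x \<oplus>\<^bsub>N\<^esub> f y) \<and>
    (\<forall>a\<in>carrier R. \<forall>x\<in>carrier M. f (a \<odot>\<^bsub>M\<^esub> x) = a \<odot>\<^bsub>N\<^esub> f x)}"

text \<open>The lifting property against epimorphisms.  A definition cannot quantify over types, so
  the test modules live on one fixed type \<open>'m \<Rightarrow> 'r\<close>, which is large enough to hold the free
  module on the carrier of \<open>P\<close>.  Lemma \<open>projective_module_lift\<close> below shows that nothing is
  lost: lifts then exist against epimorphisms between modules on arbitrary types.\<close>

definition projective_module ::
  "('r, 'c) ring_scheme \<Rightarrow> ('r, 'm, 'd) module_scheme \<Rightarrow> bool"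
  where "projective_module R P \<longleftrightarrow> left_module R P \<and>
    (\<forall>(M :: ('r, 'm \<Rightarrow> 'r) module) (N :: ('r, 'm \<Rightarrow> 'r) module) f g.
      left_module R M \<longrightarrow> left_module R N \<longrightarrow>
      f \<in> lmod_hom R M N \<longrightarrow> f ` carrier M = carrier N \<longrightarrow> g \<in> lmod_hom R P N \<longrightarrow>
      (\<exists>h \<in> lmod_hom R P M. \<forall>x\<in>carrier P. f (h x) = g x))"


section \<open>Algebras with a multiplicative basis\<close>

text \<open>A \<open>K\<close>-algebra is a record of type \<open>module\<close>, as in the library locale \<open>algebra\<close> (which
  however covers commutative algebras only).\<close>

definition fin_supp :: "('k, 'c) ring_scheme \<Rightarrow> 'b set \<Rightarrow> ('b \<Rightarrow> 'k) set"
  where "fin_supp K B = {f. (\<forall>b. f b \<in> carrier K) \<and> (\<forall>b. b \<notin> B \<longrightarrow> f b = \<zero>\<^bsub>K\<^esub>) \<and>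
    finite {b. f b \<noteq> \<zero>\<^bsub>K\<^esub>}}"

definition basis_elt :: "('k, 'c) ring_scheme \<Rightarrow> 'b \<Rightarrow> 'b \<Rightarrow> 'k"
  where "basis_elt K b = (\<lambda>c. if c = b then \<one>\<^bsub>K\<^esub> else \<zero>\<^bsub>K\<^esub>)"

text \<open>The free \<open>K\<close>-module on \<open>B\<close>, the product of two basis elements \<open>b\<close>, \<open>c\<close> being the basis
  element \<open>d\<close> if \<open>m b c = Some d\<close> and \<open>0\<close> if \<open>m b c = None\<close>; the identity is the sum of the
  basis elements in \<open>E\<close>.\<close>

definition basis_algebra ::
  "('k, 'c) ring_scheme \<Rightarrow> 'b set \<Rightarrow> 'b set \<Rightarrow> ('b \<Rightarrow> 'b \<Rightarrow> 'b option) \<Rightarrow> ('k, 'b \<Rightarrow> 'k) module"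
  where "basis_algebra K B E m = \<lparr>
    carrier = fin_supp K B,
    mult = (\<lambda>f g d. \<Oplus>\<^bsub>K\<^esub>p\<in>{(b, c). f b \<noteq> \<zero>\<^bsub>K\<^esub> \<and> g c \<noteq> \<zero>\<^bsub>K\<^esub> \<and> m b c = Some d}.
      f (fst p) \<otimes>\<^bsub>K\<^esub> g (snd p)),
    one = (\<lambda>b. if b \<in> E then \<one>\<^bsub>K\<^esub> else \<zero>\<^bsub>K\<^esub>),
    zero = (\<lambda>b. \<zero>\<^bsub>K\<^esub>),
    add = (\<lambda>f g b. f b \<oplus>\<^bsub>K\<^esub> g b),
    smult = (\<lambda>c f b. c \<otimes>\<^bsub>K\<^esub> f b)\<rparr>"

definition quotient_algebra ::
  "('k, 'a, 'd) module_scheme \<Rightarrow> 'a set \<Rightarrow> ('k, 'a set) module"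
  where "quotient_algebra R I =
    ring.extend (R Quot I) (module.fields (\<lambda>c X. \<Union>x\<in>X. I +>\<^bsub>R\<^esub> (c \<odot>\<^bsub>R\<^esub> x)))"

definition opposite_algebra :: "('k, 'a, 'd) module_scheme \<Rightarrow> ('k, 'a, 'd) module_scheme"
  where "opposite_algebra S = S\<lparr>mult := (\<lambda>x y. y \<otimes>\<^bsub>S\<^esub> x)\<rparr>"


section \<open>Tensor products of algebras and bimodules\<close>

text \<open>The free \<open>K\<close>-module on \<open>carrier S \<times> carrier T\<close> with \<open>(s, t) (s', t') = (s s', t t')\<close>.\<close>

definition pair_algebra ::
  "('k, 'c) ring_scheme \<Rightarrow> ('k, 's, 'd) module_scheme \<Rightarrow> ('k, 't, 'e) module_scheme
    \<Rightarrow> ('k, 's \<times> 't \<Rightarrow> 'k) module"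
  where "pair_algebra K S T = basis_algebra K (carrier S \<times> carrier T) {(\<one>\<^bsub>S\<^esub>, \<one>\<^bsub>T\<^esub>)}
    (\<lambda>(s, t) (s', t'). Some (s \<otimes>\<^bsub>S\<^esub> s', t \<otimes>\<^bsub>T\<^esub> t'))"

definition bilinear_relations ::
  "('k, 'c) ring_scheme \<Rightarrow> ('k, 's, 'd) module_scheme \<Rightarrow> ('k, 't, 'e) module_scheme
    \<Rightarrow> ('s \<times> 't \<Rightarrow> 'k) set"
  where "bilinear_relations K S T = (let F = pair_algebra K S T; \<beta> = (\<lambda>s t. basis_elt K (s, t)) in
      {\<beta> (s \<oplus>\<^bsub>S\<^esub> s') t \<ominus>\<^bsub>F\<^esub> (\<beta> s t \<oplus>\<^bsub>F\<^esub> \<beta> s' t) | s s' t.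
        s \<in> carrier S \<and> s' \<in> carrier S \<and> t \<in> carrier T} \<union>
      {\<beta> s (t \<oplus>\<^bsub>T\<^esub> t') \<ominus>\<^bsub>F\<^esub> (\<beta> s t \<oplus>\<^bsub>F\<^esub> \<beta> s t') | s t t'.
        s \<in> carrier S \<and> t \<in> carrier T \<and> t' \<in> carrier T} \<union>
      {\<beta> (c \<odot>\<^bsub>S\<^esub> s) t \<ominus>\<^bsub>F\<^esub> (c \<odot>\<^bsub>F\<^esub> \<beta> s t) | c s t.
        c \<in> carrier K \<and> s \<in> carrier S \<and> t \<in> carrier T} \<union>
      {\<beta> s (c \<odot>\<^bsub>T\<^esub> t) \<ominus>\<^bsub>F\<^esub> (c \<odot>\<^bsub>F\<^esub> \<beta> s t) | c s t.
        c \<in> carrier K \<and> s \<in> carrier S \<and> t \<in> carrier T})"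

text \<open>The set of relations is stable, up to scalars, under multiplication by basis elements on
  either side, so the ideal it generates is just its linear span.\<close>

definition tensor_algebra ::
  "('k, 'c) ring_scheme \<Rightarrow> ('k, 's, 'd) module_scheme \<Rightarrow> ('k, 't, 'e) module_scheme
    \<Rightarrow> ('k, ('s \<times> 't \<Rightarrow> 'k) set) module"
  where "tensor_algebra K S T = quotient_algebra (pair_algebra K S T)
    (Idl\<^bsub>pair_algebra K S T\<^esub> (bilinear_relations K S T))"

definition enveloping_algebra ::
  "('k, 'c) ring_scheme \<Rightarrow> ('k, 's, 'd) module_scheme \<Rightarrow> ('k, ('s \<times> 's \<Rightarrow> 'k) set) module"
  where "enveloping_algebra K S = tensor_algebra K S (opposite_algebra S)"

text \<open>An ideal \<open>J\<close> of \<open>S\<close> as a module over the enveloping algebra: \<open>(a \<otimes> b) x = a x b\<close>.  The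
  action of a coset \<open>Z\<close> is computed from any representative \<open>f\<close>; as the value does not depend
  on \<open>f\<close>, the argument of \<open>the_elem\<close> is a singleton.  The fields \<open>mult\<close> and \<open>one\<close> of the record
  play no role for modules.\<close>

definition ideal_bimodule ::
  "('k, 'c) ring_scheme \<Rightarrow> ('k, 's, 'd) module_scheme \<Rightarrow> 's set
    \<Rightarrow> (('s \<times> 's \<Rightarrow> 'k) set, 's) module"
  where "ideal_bimodule K S J = \<lparr>
    carrier = J, mult = mult S, one = one S, zero = zero S, add = add S,
    smult = (\<lambda>Z x. the_elem ((\<lambda>f. \<Oplus>\<^bsub>S\<^esub>p\<in>{p. f p \<noteq> \<zero>\<^bsub>K\<^esub>}.
      f p \<odot>\<^bsub>S\<^esub> (fst p \<otimes>\<^bsub>S\<^esub> x \<otimes>\<^bsub>S\<^esub> snd p)) ` Z))\<rparr>"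


section \<open>Bound quiver algebras\<close>

text \<open>A finite quiver is a \<open>fin_digraph\<close> (loops and parallel arrows are allowed), with \<open>tail\<close>
  and \<open>head\<close> as source and target.  A path carries its source and target, so that there is one
  trivial path per vertex.\<close>

type_synonym ('v, 'a) qpath = "'v \<times> 'a list \<times> 'v"

definition qpaths :: "('v, 'a) pre_digraph \<Rightarrow> ('v, 'a) qpath set"
  where "qpaths Q = {(u, p, v). pre_digraph.awalk Q u p v}"

fun path_arrows :: "('v, 'a) qpath \<Rightarrow> 'a list"
  where "path_arrows (u, p, v) = p"

definition trivial_path :: "'v \<Rightarrow> ('v, 'a) qpath"
  where "trivial_path v = (v, [], v)"

definition arrow_path :: "('v, 'a) pre_digraph \<Rightarrow> 'a \<Rightarrow> ('v, 'a) qpath"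
  where "arrow_path Q a = (tail Q a, [a], head Q a)"

fun path_comp :: "('v, 'a) qpath \<Rightarrow> ('v, 'a) qpath \<Rightarrow> ('v, 'a) qpath option"
  where "path_comp (u, p, v) (v', q, w) = (if v = v' then Some (u, p @ q, w) else None)"

definition path_algebra ::
  "('k, 'c) ring_scheme \<Rightarrow> ('v, 'a) pre_digraph \<Rightarrow> ('k, ('v, 'a) qpath \<Rightarrow> 'k) module"
  where "path_algebra K Q = basis_algebra K (qpaths Q) (trivial_path ` verts Q) path_comp"

definition admissible_ideal ::
  "('k, 'c) ring_scheme \<Rightarrow> ('v, 'a) pre_digraph \<Rightarrow> (('v, 'a) qpath \<Rightarrow> 'k) set \<Rightarrow> bool"
  where "admissible_ideal K Q I \<longleftrightarrow> ideal I (path_algebra K Q) \<and>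
    (\<forall>z\<in>I. \<forall>p. z p \<noteq> \<zero>\<^bsub>K\<^esub> \<longrightarrow> 2 \<le> length (path_arrows p)) \<and>
    (\<exists>N>1. \<forall>p\<in>qpaths Q. length (path_arrows p) = N \<longrightarrow> basis_elt K p \<in> I)"

definition bound_quiver_algebra ::
  "('k, 'c) ring_scheme \<Rightarrow> ('v, 'a) pre_digraph \<Rightarrow> (('v, 'a) qpath \<Rightarrow> 'k) set
    \<Rightarrow> ('k, (('v, 'a) qpath \<Rightarrow> 'k) set) module"
  where "bound_quiver_algebra K Q I = quotient_algebra (path_algebra K Q) I"

definition path_class ::
  "('k, 'c) ring_scheme \<Rightarrow> ('v, 'a) pre_digraph \<Rightarrow> (('v, 'a) qpath \<Rightarrow> 'k) set \<Rightarrow> ('v, 'a) qpath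
    \<Rightarrow> (('v, 'a) qpath \<Rightarrow> 'k) set"
  where "path_class K Q I p = I +>\<^bsub>path_algebra K Q\<^esub> basis_elt K p"

definition arrow_ideal ::
  "('k, 'c) ring_scheme \<Rightarrow> ('v, 'a) pre_digraph \<Rightarrow> (('v, 'a) qpath \<Rightarrow> 'k) set \<Rightarrow> 'a set
    \<Rightarrow> (('v, 'a) qpath \<Rightarrow> 'k) set set"
  where "arrow_ideal K Q I A =
    Idl\<^bsub>bound_quiver_algebra K Q I\<^esub> ((\<lambda>a. path_class K Q I (arrow_path Q a)) ` A)"


section \<open>Arrow removal\<close>

definition path_avoids :: "'a set \<Rightarrow> ('v, 'a) qpath \<Rightarrow> bool"
  where "path_avoids A p \<longleftrightarrow> set (path_arrows p) \<inter> A = {}"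

definition arrow_removal ::
  "('k, 'c) ring_scheme \<Rightarrow> ('v, 'a) pre_digraph \<Rightarrow> (('v, 'a) qpath \<Rightarrow> 'k) set \<Rightarrow> 'a set \<Rightarrow> bool"
  where "arrow_removal K Q I A \<longleftrightarrow>
    (\<exists>G \<subseteq> carrier (path_algebra K Q). I = Idl\<^bsub>path_algebra K Q\<^esub> G \<and>
      (\<forall>z\<in>G. \<forall>p. z p \<noteq> \<zero>\<^bsub>K\<^esub> \<longrightarrow> path_avoids A p)) \<and>
    (let \<Lambda> = bound_quiver_algebra K Q I; e = (\<lambda>v. path_class K Q I (trivial_path v)) in
      \<forall>a1\<in>A. \<forall>a2\<in>A.
        {e (head Q a1) \<otimes>\<^bsub>\<Lambda>\<^esub> x \<otimes>\<^bsub>\<Lambda>\<^esub> e (tail Q a2) | x. x \<in> carrier \<Lambda>} = {\<zero>\<^bsub>\<Lambda>\<^esub>})"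

definition part_through ::
  "('k, 'c) ring_scheme \<Rightarrow> 'a set \<Rightarrow> (('v, 'a) qpath \<Rightarrow> 'k) \<Rightarrow> ('v, 'a) qpath \<Rightarrow> 'k"
  where "part_through K A z = (\<lambda>p. if path_avoids A p then \<zero>\<^bsub>K\<^esub> else z p)"

definition part_avoiding ::
  "('k, 'c) ring_scheme \<Rightarrow> 'a set \<Rightarrow> (('v, 'a) qpath \<Rightarrow> 'k) \<Rightarrow> ('v, 'a) qpath \<Rightarrow> 'k"
  where "part_avoiding K A z = (\<lambda>p. if path_avoids A p then z p else \<zero>\<^bsub>K\<^esub>)"

definition pre_removable ::
  "('k, 'c) ring_scheme \<Rightarrow> (('v, 'a) qpath \<Rightarrow> 'k) set \<Rightarrow> 'a set \<Rightarrow> bool"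
  where "pre_removable K I A \<longleftrightarrow>
    (\<forall>z\<in>I. part_through K A z \<in> I \<and> part_avoiding K A z \<in> I)"


section \<open>Projectivity does not depend on the type of the test modules\<close>

lemma fin_suppD:
  assumes "u \<in> fin_supp R X"
  shows "u b \<in> carrier R" "finite {b. u b \<noteq> \<zero>\<^bsub>R\<^esub>}" "{b. u b \<noteq> \<zero>\<^bsub>R\<^esub>} \<subseteq> X"
  using assms by (auto simp: fin_supp_def)

lemma (in ring) fin_supp_add:
  assumes "u \<in> fin_supp R X" "v \<in> fin_supp R X"
  shows "(\<lambda>b. u b \<oplus> v b) \<in> fin_supp R X"
proof -
  have "{b. u b \<oplus> v b \<noteq> \<zero>} \<subseteq> {b. u b \<noteq> \<zero>} \<union> {b. v b \<noteq> \<zero>}"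
    by auto
  then have "finite {b. u b \<oplus> v b \<noteq> \<zero>}"
    by (rule finite_subset) (simp add: fin_suppD(2)[OF assms(1)] fin_suppD(2)[OF assms(2)])
  then show ?thesis
    using assms by (auto simp: fin_supp_def)
qed

lemma (in ring) fin_supp_smult:
  assumes "u \<in> fin_supp R X" "a \<in> carrier R"
  shows "(\<lambda>b. a \<otimes> u b) \<in> fin_supp R X"
proof -
  have "{b. a \<otimes> u b \<noteq> \<zero>} \<subseteq> {b. u b \<noteq> \<zero>}"
    using assms by auto
  then have "finite {b. a \<otimes> u b \<noteq> \<zero>}"
    by (rule finite_subset) (rule fin_suppD(2)[OF assms(1)])
  then show ?thesis
    using assms by (auto simp: fin_supp_def)
qed

lemma (in ring) left_module_basis_algebra:
  "left_module R (basis_algebra R X E m)"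
proof -
  have z: "(\<lambda>b. \<zero>) \<in> fin_supp R X"
    by (auto simp: fin_supp_def)
  have inv: "\<exists>v\<in>fin_supp R X. (\<lambda>b. v b \<oplus> u b) = (\<lambda>b. \<zero>)" if "u \<in> fin_supp R X" for u
    using fin_supp_smult[OF that, of "\<ominus> \<one>"] fin_suppD(1)[OF that]
    by (intro bexI[of _ "\<lambda>b. (\<ominus> \<one>) \<otimes> u b"]) (auto simp: l_minus l_neg)
  have "abelian_group (basis_algebra R X E m)"
    using z inv fin_supp_add
    by (intro abelian_groupI) (auto simp: basis_algebra_def fun_eq_iff fin_suppD(1) a_ac)
  moreover have "left_module_axioms R (basis_algebra R X E m)"
    by (auto simp: left_module_axioms_def basis_algebra_def fun_eq_iff fin_suppD(1)
        fin_supp_smult l_distr r_distr m_assoc)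
  ultimately show ?thesis
    by (simp add: left_module_def ring_axioms)
qed

definition lin_ext ::
  "('r, 'c) ring_scheme \<Rightarrow> ('r, 'm, 'd) module_scheme \<Rightarrow> ('b \<Rightarrow> 'm) \<Rightarrow> ('b \<Rightarrow> 'r) \<Rightarrow> 'm"
  where "lin_ext R M m u = (\<Oplus>\<^bsub>M\<^esub>x\<in>{x. u x \<noteq> \<zero>\<^bsub>R\<^esub>}. u x \<odot>\<^bsub>M\<^esub> m x)"

context left_module begin

lemma smult_l_null: "x \<in> carrier M \<Longrightarrow> \<zero> \<odot>\<^bsub>M\<^esub> x = \<zero>\<^bsub>M\<^esub>"
  using smult_l_distr[of \<zero> \<zero> x] smult_closed[of \<zero> x]
  by (metis M.add.r_cancel_one' R.add.one_closed R.add.r_one)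

lemma smult_r_null: "a \<in> carrier R \<Longrightarrow> a \<odot>\<^bsub>M\<^esub> \<zero>\<^bsub>M\<^esub> = \<zero>\<^bsub>M\<^esub>"
  using smult_r_distr[of a "\<zero>\<^bsub>M\<^esub>" "\<zero>\<^bsub>M\<^esub>"] smult_closed[of a "\<zero>\<^bsub>M\<^esub>"]
  by (metis M.add.r_cancel_one' M.add.one_closed M.add.r_one)

lemma smult_finsum:
  assumes "a \<in> carrier R" "finite S" "f \<in> Pi S (\<lambda>_. carrier M)"
  shows "a \<odot>\<^bsub>M\<^esub> (\<Oplus>\<^bsub>M\<^esub>x\<in>S. f x) = (\<Oplus>\<^bsub>M\<^esub>x\<in>S. a \<odot>\<^bsub>M\<^esub> f x)"
  using assms(2,3)
proof (induction S)
  case empty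
  then show ?case using assms(1) by (simp add: smult_r_null)
next
  case (insert x S)
  then show ?case
    using assms(1) by (simp add: smult_r_distr smult_closed Pi_iff)
qed

lemma lin_ext_superset:
  assumes "u \<in> fin_supp R X" "m \<in> Pi X (\<lambda>_. carrier M)" "finite S" "{x. u x \<noteq> \<zero>} \<subseteq> S" "S \<subseteq> X"
  shows "lin_ext R M m u = (\<Oplus>\<^bsub>M\<^esub>x\<in>S. u x \<odot>\<^bsub>M\<^esub> m x)"
  unfolding lin_ext_def
  using assms
  by (intro M.add.finprod_mono_neutral_cong_left)
     (auto simp: smult_l_null fin_suppD(1) smult_closed Pi_iff subset_iff)

lemma lin_ext_hom:
  assumes m: "m \<in> Pi X (\<lambda>_. carrier M)"
  shows "lin_ext R M m \<in> lmod_hom R (basis_algebra R X E k) M"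
proof -
  have cl: "lin_ext R M m u \<in> carrier M" if "u \<in> fin_supp R X" for u
    unfolding lin_ext_def using fin_suppD[OF that] m
    by (intro M.add.finprod_closed) (auto simp: smult_closed Pi_iff subset_iff)
  have add: "lin_ext R M m (\<lambda>b. u b \<oplus> v b) = lin_ext R M m u \<oplus>\<^bsub>M\<^esub> lin_ext R M m v"
    if uv: "u \<in> fin_supp R X" "v \<in> fin_supp R X" for u v
  proof -
    let ?S = "{b. u b \<noteq> \<zero>} \<union> {b. v b \<noteq> \<zero>}"
    have S: "finite ?S" "?S \<subseteq> X" "{b. u b \<oplus> v b \<noteq> \<zero>} \<subseteq> ?S"
      using fin_suppD[OF uv(1)] fin_suppD[OF uv(2)] by auto
    have mS: "m x \<in> carrier M" if "x \<in> ?S" for x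
      using S(2) m that by blast
    have "lin_ext R M m (\<lambda>b. u b \<oplus> v b) = (\<Oplus>\<^bsub>M\<^esub>x\<in>?S. (u x \<oplus> v x) \<odot>\<^bsub>M\<^esub> m x)"
      using lin_ext_superset[OF R.fin_supp_add[OF uv] m S(1,3,2)] .
    also have "\<dots> = (\<Oplus>\<^bsub>M\<^esub>x\<in>?S. u x \<odot>\<^bsub>M\<^esub> m x \<oplus>\<^bsub>M\<^esub> v x \<odot>\<^bsub>M\<^esub> m x)"
      using mS fin_suppD(1)[OF uv(1)] fin_suppD(1)[OF uv(2)]
      by (intro M.add.finprod_cong') (auto simp: smult_l_distr smult_closed)
    also have "\<dots> = (\<Oplus>\<^bsub>M\<^esub>x\<in>?S. u x \<odot>\<^bsub>M\<^esub> m x) \<oplus>\<^bsub>M\<^esub> (\<Oplus>\<^bsub>M\<^esub>x\<in>?S. v x \<odot>\<^bsub>M\<^esub> m x)"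
      using mS fin_suppD(1)[OF uv(1)] fin_suppD(1)[OF uv(2)]
      by (intro M.add.finprod_multf) (auto simp: smult_closed)
    also have "\<dots> = lin_ext R M m u \<oplus>\<^bsub>M\<^esub> lin_ext R M m v"
      using lin_ext_superset[OF uv(1) m S(1) _ S(2)] lin_ext_superset[OF uv(2) m S(1) _ S(2)]
      by simp
    finally show ?thesis .
  qed
  have smult: "lin_ext R M m (\<lambda>b. a \<otimes> u b) = a \<odot>\<^bsub>M\<^esub> lin_ext R M m u"
    if u: "u \<in> fin_supp R X" and a: "a \<in> carrier R" for u a
  proof -
    let ?S = "{b. u b \<noteq> \<zero>}"
    have S: "finite ?S" "?S \<subseteq> X" "{b. a \<otimes> u b \<noteq> \<zero>} \<subseteq> ?S"
      using fin_suppD[OF u] a by auto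
    have mS: "m x \<in> carrier M" if "x \<in> ?S" for x
      using S(2) m that by blast
    have "lin_ext R M m (\<lambda>b. a \<otimes> u b) = (\<Oplus>\<^bsub>M\<^esub>x\<in>?S. (a \<otimes> u x) \<odot>\<^bsub>M\<^esub> m x)"
      using lin_ext_superset[OF R.fin_supp_smult[OF u a] m S(1,3,2)] .
    also have "\<dots> = (\<Oplus>\<^bsub>M\<^esub>x\<in>?S. a \<odot>\<^bsub>M\<^esub> (u x \<odot>\<^bsub>M\<^esub> m x))"
      using mS fin_suppD(1)[OF u] a
      by (intro M.add.finprod_cong') (auto simp: smult_assoc smult_closed)
    also have "\<dots> = a \<odot>\<^bsub>M\<^esub> lin_ext R M m u"
      unfolding lin_ext_def using mS fin_suppD(1)[OF u] a S(1)
      by (intro smult_finsum[symmetric]) (auto simp: smult_closed)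
    finally show ?thesis .
  qed
  show ?thesis
    using cl add smult by (auto simp: lmod_hom_def basis_algebra_def)
qed

lemma lin_ext_basis_elt:
  assumes "x \<in> X" "m \<in> Pi X (\<lambda>_. carrier M)"
  shows "lin_ext R M m (basis_elt R x) = m x"
proof -
  have "basis_elt R x \<in> fin_supp R X"
    using assms(1) by (auto simp: fin_supp_def basis_elt_def)
  then have "lin_ext R M m (basis_elt R x) = (\<Oplus>\<^bsub>M\<^esub>y\<in>{x}. basis_elt R x y \<odot>\<^bsub>M\<^esub> m y)"
    using assms by (intro lin_ext_superset) (auto simp: basis_elt_def split: if_splits)
  also have "\<dots> = m x"
    using assms by (simp add: basis_elt_def smult_one Pi_iff)
  finally show ?thesis .
qed

end

lemma lmod_hom_finsum:
  assumes "left_module R M" "left_module R N" "f \<in> lmod_hom R M N" "finite S" "g \<in> Pi S (\<lambda>_. carrier M)"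
  shows "f (\<Oplus>\<^bsub>M\<^esub>x\<in>S. g x) = (\<Oplus>\<^bsub>N\<^esub>x\<in>S. f (g x))"
proof -
  interpret M: left_module R M by fact
  interpret N: left_module R N by fact
  have f: "f x \<in> carrier N" "f (x \<oplus>\<^bsub>M\<^esub> y) = f x \<oplus>\<^bsub>N\<^esub> f y"
    if "x \<in> carrier M" "y \<in> carrier M" for x y
    using assms(3) that by (auto simp: lmod_hom_def)
  have f0: "f \<zero>\<^bsub>M\<^esub> = \<zero>\<^bsub>N\<^esub>"
    using f(1)[of "\<zero>\<^bsub>M\<^esub>"] f(2)[of "\<zero>\<^bsub>M\<^esub>" "\<zero>\<^bsub>M\<^esub>"]
    by (metis M.M.add.one_closed M.M.add.r_one N.M.add.r_cancel_one')
  show ?thesis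
    using assms(4,5)
  proof (induction S)
    case empty
    then show ?case by (simp add: f0)
  next
    case (insert x S)
    then have gS: "g \<in> Pi S (\<lambda>_. carrier M)" "g x \<in> carrier M" by auto
    have "f (\<Oplus>\<^bsub>M\<^esub>x\<in>insert x S. g x) = f (g x \<oplus>\<^bsub>M\<^esub> (\<Oplus>\<^bsub>M\<^esub>x\<in>S. g x))"
      using insert gS by simp
    also have "\<dots> = f (g x) \<oplus>\<^bsub>N\<^esub> f (\<Oplus>\<^bsub>M\<^esub>x\<in>S. g x)"
      using gS by (intro f(2)) auto
    also have "\<dots> = (\<Oplus>\<^bsub>N\<^esub>x\<in>insert x S. f (g x))"
      using insert gS f(1) by (subst N.M.finsum_insert) auto
    finally show ?case .
  qed
qed

lemma projective_module_lift:
  fixes R :: "('r, 'c) ring_scheme" and P :: "('r, 'm, 'd) module_scheme"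
  assumes P: "projective_module R P" and M: "left_module R M" and N: "left_module R N"
    and f: "f \<in> lmod_hom R M N" and surj: "f ` carrier M = carrier N"
    and g: "g \<in> lmod_hom R P N"
  shows "\<exists>h \<in> lmod_hom R P M. \<forall>x\<in>carrier P. f (h x) = g x"
proof -
  interpret P: left_module R P using P by (simp add: projective_module_def)
  interpret M: left_module R M by fact
  interpret N: left_module R N by fact
  define F :: "('r, 'm \<Rightarrow> 'r) module" where "F = basis_algebra R (carrier P) {} (\<lambda>_ _. None)"
  interpret F: left_module R F unfolding F_def by (rule P.left_module_basis_algebra)
  define \<pi> where "\<pi> = lin_ext R P (\<lambda>x. x)"
  have \<pi>: "\<pi> \<in> lmod_hom R F P"
    unfolding \<pi>_def F_def by (rule P.lin_ext_hom) auto
  have \<pi>b: "\<pi> (basis_elt R x) = x" if "x \<in> carrier P" for x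
    unfolding \<pi>_def using P.lin_ext_basis_elt[of x "carrier P" "\<lambda>x. x"] that by auto
  \<comment> \<open>a copy of \<open>P\<close> on the type of \<open>F\<close>\<close>
  define j :: "'m \<Rightarrow> 'm \<Rightarrow> 'r" where "j = basis_elt R"
  have inj: "x = y" if "x \<in> carrier P" "y \<in> carrier P" "j x = j y" for x y
    using \<pi>b that by (metis j_def)
  define i where "i = inv_into (carrier P) j"
  have ij: "i (j x) = x" if "x \<in> carrier P" for x
    unfolding i_def using inj that by (intro inv_into_f_f inj_onI) auto
  define P' :: "('r, 'm \<Rightarrow> 'r) module" where "P' = \<lparr>carrier = j ` carrier P, mult = undefined,
    one = undefined, zero = j \<zero>\<^bsub>P\<^esub>, add = (\<lambda>x y. j (i x \<oplus>\<^bsub>P\<^esub> i y)), smult = (\<lambda>a x. j (a \<odot>\<^bsub>P\<^esub> i x))\<rparr>"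
  have "abelian_group P'"
    using P.M.l_neg
    by (intro abelian_groupI) (auto simp: P'_def ij P.M.a_ac intro!: bexI[of _ "\<ominus>\<^bsub>P\<^esub> _"])
  moreover have "left_module_axioms R P'"
    by (auto simp: left_module_axioms_def P'_def ij P.smult_closed P.smult_l_distr P.smult_r_distr
        P.smult_assoc P.smult_one)
  ultimately have P': "left_module R P'"
    by (simp add: left_module_def P.R.ring_axioms)
  have j: "j \<in> lmod_hom R P P'"
    by (auto simp: lmod_hom_def P'_def ij)
  have \<pi>m: "\<pi> u \<in> carrier P" if "u \<in> carrier F" for u
    using \<pi> that by (auto simp: lmod_hom_def)
  have "(\<lambda>u. j (\<pi> u)) \<in> lmod_hom R F P'"
    using \<pi> by (auto simp: lmod_hom_def P'_def ij Pi_iff)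
  moreover have "(\<lambda>u. j (\<pi> u)) ` carrier F = carrier P'"
  proof -
    have "basis_elt R x \<in> carrier F" if "x \<in> carrier P" for x
      using that by (auto simp: F_def basis_algebra_def fin_supp_def basis_elt_def)
    then have "j x \<in> (\<lambda>u. j (\<pi> u)) ` carrier F" if "x \<in> carrier P" for x
      using that \<pi>b by (metis (no_types, lifting) image_eqI)
    then show ?thesis using \<pi>m by (auto simp: P'_def)
  qed
  ultimately obtain s where s: "s \<in> lmod_hom R P F" "\<forall>x\<in>carrier P. j (\<pi> (s x)) = j x"
    using P j P' F.left_module_axioms unfolding projective_module_def by blast
  have sF: "s x \<in> carrier F" if "x \<in> carrier P" for x
    using s(1) that by (auto simp: lmod_hom_def)
  have \<pi>s: "\<pi> (s x) = x" if "x \<in> carrier P" for x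
    using s(2) that inj \<pi>m sF by blast
  have gN: "g x \<in> carrier N" if "x \<in> carrier P" for x
    using g that by (auto simp: lmod_hom_def)
  then have "\<exists>y. y \<in> carrier M \<and> f y = g x" if "x \<in> carrier P" for x
    using surj that by (metis imageE)
  then obtain m where m: "\<And>x. x \<in> carrier P \<Longrightarrow> m x \<in> carrier M \<and> f (m x) = g x"
    by metis
  define h where "h = (\<lambda>x. lin_ext R M m (s x))"
  have L: "lin_ext R M m \<in> lmod_hom R F M"
    unfolding F_def using m by (intro M.lin_ext_hom) auto
  have "h \<in> lmod_hom R P M"
    using L s(1) by (auto simp: lmod_hom_def h_def Pi_iff)
  moreover have "f (h x) = g x" if x: "x \<in> carrier P" for x
  proof -
    let ?u = "s x" and ?S = "{y. s x y \<noteq> \<zero>\<^bsub>R\<^esub>}"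
    have u: "?u \<in> fin_supp R (carrier P)"
      using sF[OF x] by (simp add: F_def basis_algebra_def)
    note S = fin_suppD[OF u]
    have fm: "f (a \<odot>\<^bsub>M\<^esub> y) = a \<odot>\<^bsub>N\<^esub> f y" if "a \<in> carrier R" "y \<in> carrier M" for a y
      using f that by (auto simp: lmod_hom_def)
    have gm: "g (a \<odot>\<^bsub>P\<^esub> y) = a \<odot>\<^bsub>N\<^esub> g y" if "a \<in> carrier R" "y \<in> carrier P" for a y
      using g that by (auto simp: lmod_hom_def)
    have "f (h x) = (\<Oplus>\<^bsub>N\<^esub>y\<in>?S. f (?u y \<odot>\<^bsub>M\<^esub> m y))"
      unfolding h_def lin_ext_def using S m
      by (intro lmod_hom_finsum[OF M N f]) (auto intro!: M.smult_closed)
    also have "\<dots> = (\<Oplus>\<^bsub>N\<^esub>y\<in>?S. g (?u y \<odot>\<^bsub>P\<^esub> y))"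
      using S m by (intro N.M.add.finprod_cong')
        (auto simp: fm gm subset_iff intro!: N.smult_closed gN P.smult_closed)
    also have "\<dots> = g (\<pi> (s x))"
      unfolding \<pi>_def lin_ext_def using S
      by (intro lmod_hom_finsum[OF P.left_module_axioms N g, symmetric])
        (auto simp: subset_iff P.smult_closed)
    finally show ?thesis by (simp add: \<pi>s x)
  qed
  ultimately show ?thesis by blast
qed


section \<open>The path algebra and the algebra of pairs are rings\<close>

lemma (in ring) fin_supp_zero: "(\<lambda>b. \<zero>) \<in> fin_supp R X"
  by (auto simp: fin_supp_def)

lemma (in ring) fin_supp_basis_elt: "b \<in> X \<Longrightarrow> basis_elt R b \<in> fin_supp R X"
  by (auto simp: fin_supp_def basis_elt_def)

lemma (in ring) fin_supp_induct [consumes 1, case_names zero add]: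
  assumes "u \<in> fin_supp R X"
    and "P (\<lambda>b. \<zero>)"
    and "\<And>v a x. v \<in> fin_supp R X \<Longrightarrow> a \<in> carrier R \<Longrightarrow> x \<in> X \<Longrightarrow> P v \<Longrightarrow>
      P (\<lambda>b. a \<otimes> basis_elt R x b \<oplus> v b)"
  shows "P u"
proof -
  have "P u" if "finite S" "{b. u b \<noteq> \<zero>} = S" "u \<in> fin_supp R X" for S u
    using that
  proof (induction S arbitrary: u)
    case empty
    then have "u = (\<lambda>b. \<zero>)" by auto
    then show ?case using assms(2) by simp
  next
    case (insert x S)
    let ?v = "u(x := \<zero>)"
    have x: "x \<in> X" using insert.prems fin_suppD(3) by fastforce
    have u: "u b \<in> carrier R" for b using insert.prems fin_suppD(1) by metis
    have "{b. ?v b \<noteq> \<zero>} = S" using insert by auto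
    moreover from this have "?v \<in> fin_supp R X"
      using insert by (auto simp: fin_supp_def)
    ultimately have "P ?v" "?v \<in> fin_supp R X" using insert.IH[of ?v] by blast+
    then have "P (\<lambda>b. u x \<otimes> basis_elt R x b \<oplus> ?v b)"
      using assms(3) u x by blast
    moreover have "(\<lambda>b. u x \<otimes> basis_elt R x b \<oplus> ?v b) = u"
      using u by (auto simp: basis_elt_def fun_eq_iff)
    ultimately show ?case by simp
  qed
  then show ?thesis using fin_suppD(2)[OF assms(1)] assms(1) by blast
qed

locale basis_product = cring R for R (structure) +
  fixes B E :: "'b set" and m :: "'b \<Rightarrow> 'b \<Rightarrow> 'b option"
  assumes closed: "\<lbrakk>b \<in> B; c \<in> B; m b c = Some d\<rbrakk> \<Longrightarrow> d \<in> B"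
    and assoc: "\<lbrakk>b \<in> B; c \<in> B; d \<in> B\<rbrakk>
      \<Longrightarrow> Option.bind (m b c) (\<lambda>x. m x d) = Option.bind (m c d) (m b)"
    and E: "finite E" "E \<subseteq> B"
    and unit_l: "b \<in> B \<Longrightarrow> \<exists>e\<in>E. m e b = Some b \<and> (\<forall>e'\<in>E. e' \<noteq> e \<longrightarrow> m e' b = None)"
    and unit_r: "b \<in> B \<Longrightarrow> \<exists>e\<in>E. m b e = Some b \<and> (\<forall>e'\<in>E. e' \<noteq> e \<longrightarrow> m b e' = None)"
begin

abbreviation "F \<equiv> basis_algebra R B E m"
abbreviation "h f g d p \<equiv> (if m (fst p) (snd p) = Some d then f (fst p) \<otimes> g (snd p) else \<zero>)"

lemma carrier_F: "carrier F = fin_supp R B"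
  by (simp add: basis_algebra_def)

lemma mult_superset:
  assumes "f \<in> fin_supp R B" "g \<in> fin_supp R B" "finite S" "finite T"
    "{b. f b \<noteq> \<zero>} \<subseteq> S" "{b. g b \<noteq> \<zero>} \<subseteq> T"
  shows "(f \<otimes>\<^bsub>F\<^esub> g) d = (\<Oplus>p\<in>S \<times> T. h f g d p)"
proof -
  note cl = fin_suppD(1)[OF assms(1)] fin_suppD(1)[OF assms(2)]
  have "(f \<otimes>\<^bsub>F\<^esub> g) d = (\<Oplus>p\<in>{(b, c). f b \<noteq> \<zero> \<and> g c \<noteq> \<zero> \<and> m b c = Some d}. f (fst p) \<otimes> g (snd p))"
    by (simp add: basis_algebra_def)
  also have "\<dots> = (\<Oplus>p\<in>S \<times> T. h f g d p)"
  proof (rule add.finprod_mono_neutral_cong_left)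
    show "finite (S \<times> T)" using assms by simp
    show "{(b, c). f b \<noteq> \<zero> \<and> g c \<noteq> \<zero> \<and> m b c = Some d} \<subseteq> S \<times> T"
      using assms(5,6) by blast
    show "h f g d p = \<zero>"
      if "p \<in> S \<times> T - {(b, c). f b \<noteq> \<zero> \<and> g c \<noteq> \<zero> \<and> m b c = Some d}" for p
      using that cl by (cases "f (fst p) = \<zero>"; cases "g (snd p) = \<zero>") (auto simp: split_beta)
  qed (use cl in auto)
  finally show ?thesis .
qed

lemma mult_in: 
  assumes "f \<in> fin_supp R B" "g \<in> fin_supp R B"
  shows "f \<otimes>\<^bsub>F\<^esub> g \<in> fin_supp R B"
proof -
  note f = fin_suppD[OF assms(1)] and g = fin_suppD[OF assms(2)]
  let ?P = "{b. f b \<noteq> \<zero>} \<times> {b. g b \<noteq> \<zero>}"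
  have ms: "(f \<otimes>\<^bsub>F\<^esub> g) d = (\<Oplus>p\<in>?P. h f g d p)" for d
    by (rule mult_superset[OF assms f(2) g(2) subset_refl subset_refl])
  have ne: "\<exists>p\<in>?P. m (fst p) (snd p) = Some d" if "(f \<otimes>\<^bsub>F\<^esub> g) d \<noteq> \<zero>" for d
  proof (rule ccontr)
    assume n: "\<not> ?thesis"
    have "(f \<otimes>\<^bsub>F\<^esub> g) d = \<zero>"
      unfolding ms
    proof (rule add.finprod_one_eqI)
      fix p assume "p \<in> ?P"
      then have "m (fst p) (snd p) \<noteq> Some d" using n by blast
      then show "h f g d p = \<zero>" by (rule if_not_P)
    qed
    then show False using that by blast
  qed
  have "{d. (f \<otimes>\<^bsub>F\<^esub> g) d \<noteq> \<zero>} \<subseteq> (\<lambda>p. the (m (fst p) (snd p))) ` ?P"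
  proof
    fix d assume "d \<in> {d. (f \<otimes>\<^bsub>F\<^esub> g) d \<noteq> \<zero>}"
    then obtain p where "p \<in> ?P" "m (fst p) (snd p) = Some d" using ne by blast
    then show "d \<in> (\<lambda>p. the (m (fst p) (snd p))) ` ?P" by (intro image_eqI[of _ _ p]) simp_all
  qed
  then have "finite {d. (f \<otimes>\<^bsub>F\<^esub> g) d \<noteq> \<zero>}"
    by (rule finite_subset) (simp add: f(2) g(2))
  moreover have "(f \<otimes>\<^bsub>F\<^esub> g) d \<in> carrier R" for d
    unfolding ms using f(1) g(1) by (intro finsum_closed) auto
  moreover have "(f \<otimes>\<^bsub>F\<^esub> g) d = \<zero>" if "d \<notin> B" for d
  proof (rule ccontr)
    assume "(f \<otimes>\<^bsub>F\<^esub> g) d \<noteq> \<zero>"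
    from ne[OF this] obtain p where "p \<in> ?P" "m (fst p) (snd p) = Some d" by blast
    moreover from this have "fst p \<in> B" "snd p \<in> B" using f(3) g(3) by auto
    ultimately show False using closed that by blast
  qed
  ultimately show ?thesis by (simp add: fin_supp_def)
qed

lemma l_dist:
  assumes "f \<in> fin_supp R B" "f' \<in> fin_supp R B" "g \<in> fin_supp R B"
  shows "(\<lambda>b. f b \<oplus> f' b) \<otimes>\<^bsub>F\<^esub> g = (\<lambda>d. (f \<otimes>\<^bsub>F\<^esub> g) d \<oplus> (f' \<otimes>\<^bsub>F\<^esub> g) d)"
proof
  fix d
  note f = fin_suppD[OF assms(1)] and f' = fin_suppD[OF assms(2)] and g = fin_suppD[OF assms(3)]
  let ?S = "{b. f b \<noteq> \<zero>} \<union> {b. f' b \<noteq> \<zero>}" and ?T = "{b. g b \<noteq> \<zero>}"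
  have S: "finite ?S" "{b. f b \<oplus> f' b \<noteq> \<zero>} \<subseteq> ?S" using f f' by auto
  have "((\<lambda>b. f b \<oplus> f' b) \<otimes>\<^bsub>F\<^esub> g) d = (\<Oplus>p\<in>?S \<times> ?T. h (\<lambda>b. f b \<oplus> f' b) g d p)"
    by (rule mult_superset[OF fin_supp_add[OF assms(1,2)] assms(3) S(1) g(2) S(2) subset_refl])
  also have "\<dots> = (\<Oplus>p\<in>?S \<times> ?T. h f g d p \<oplus> h f' g d p)"
    using f(1) f'(1) g(1) by (intro add.finprod_cong') (auto simp: l_distr)
  also have "\<dots> = (\<Oplus>p\<in>?S \<times> ?T. h f g d p) \<oplus> (\<Oplus>p\<in>?S \<times> ?T. h f' g d p)"
    using f(1) f'(1) g(1) by (intro add.finprod_multf) auto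
  also have "\<dots> = (f \<otimes>\<^bsub>F\<^esub> g) d \<oplus> (f' \<otimes>\<^bsub>F\<^esub> g) d"
    using mult_superset[OF assms(1,3) S(1) g(2) _ subset_refl]
      mult_superset[OF assms(2,3) S(1) g(2) _ subset_refl] by simp
  finally show "((\<lambda>b. f b \<oplus> f' b) \<otimes>\<^bsub>F\<^esub> g) d = (f \<otimes>\<^bsub>F\<^esub> g) d \<oplus> (f' \<otimes>\<^bsub>F\<^esub> g) d" .
qed

lemma r_dist:
  assumes "f \<in> fin_supp R B" "f' \<in> fin_supp R B" "g \<in> fin_supp R B"
  shows "g \<otimes>\<^bsub>F\<^esub> (\<lambda>b. f b \<oplus> f' b) = (\<lambda>d. (g \<otimes>\<^bsub>F\<^esub> f) d \<oplus> (g \<otimes>\<^bsub>F\<^esub> f') d)"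
proof
  fix d
  note f = fin_suppD[OF assms(1)] and f' = fin_suppD[OF assms(2)] and g = fin_suppD[OF assms(3)]
  let ?S = "{b. f b \<noteq> \<zero>} \<union> {b. f' b \<noteq> \<zero>}" and ?T = "{b. g b \<noteq> \<zero>}"
  have S: "finite ?S" "{b. f b \<oplus> f' b \<noteq> \<zero>} \<subseteq> ?S" using f f' by auto
  have "(g \<otimes>\<^bsub>F\<^esub> (\<lambda>b. f b \<oplus> f' b)) d = (\<Oplus>p\<in>?T \<times> ?S. h g (\<lambda>b. f b \<oplus> f' b) d p)"
    by (rule mult_superset[OF assms(3) fin_supp_add[OF assms(1,2)] g(2) S(1) subset_refl S(2)])
  also have "\<dots> = (\<Oplus>p\<in>?T \<times> ?S. h g f d p \<oplus> h g f' d p)"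
    using f(1) f'(1) g(1) by (intro add.finprod_cong') (auto simp: r_distr)
  also have "\<dots> = (\<Oplus>p\<in>?T \<times> ?S. h g f d p) \<oplus> (\<Oplus>p\<in>?T \<times> ?S. h g f' d p)"
    using f(1) f'(1) g(1) by (intro add.finprod_multf) auto
  also have "\<dots> = (g \<otimes>\<^bsub>F\<^esub> f) d \<oplus> (g \<otimes>\<^bsub>F\<^esub> f') d"
    using mult_superset[OF assms(3,1) g(2) S(1) subset_refl]
      mult_superset[OF assms(3,2) g(2) S(1) subset_refl] by simp
  finally show "(g \<otimes>\<^bsub>F\<^esub> (\<lambda>b. f b \<oplus> f' b)) d = (g \<otimes>\<^bsub>F\<^esub> f) d \<oplus> (g \<otimes>\<^bsub>F\<^esub> f') d" .
qed

lemma smult_l: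
  assumes "f \<in> fin_supp R B" "g \<in> fin_supp R B" "a \<in> carrier R"
  shows "(\<lambda>b. a \<otimes> f b) \<otimes>\<^bsub>F\<^esub> g = (\<lambda>d. a \<otimes> (f \<otimes>\<^bsub>F\<^esub> g) d)"
proof
  fix d
  note f = fin_suppD[OF assms(1)] and g = fin_suppD[OF assms(2)]
  have S: "{b. a \<otimes> f b \<noteq> \<zero>} \<subseteq> {b. f b \<noteq> \<zero>}" using assms(3) by auto
  have "((\<lambda>b. a \<otimes> f b) \<otimes>\<^bsub>F\<^esub> g) d = (\<Oplus>p\<in>{b. f b \<noteq> \<zero>} \<times> {b. g b \<noteq> \<zero>}. a \<otimes> h f g d p)"
    unfolding mult_superset[OF fin_supp_smult[OF assms(1,3)] assms(2) f(2) g(2) S subset_refl]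
    using f(1) g(1) assms(3) by (intro add.finprod_cong') (auto simp: m_assoc)
  also have "\<dots> = a \<otimes> (f \<otimes>\<^bsub>F\<^esub> g) d"
    unfolding mult_superset[OF assms(1,2) f(2) g(2) subset_refl subset_refl]
    using f g assms(3) by (intro finsum_rdistr[symmetric]) auto
  finally show "((\<lambda>b. a \<otimes> f b) \<otimes>\<^bsub>F\<^esub> g) d = a \<otimes> (f \<otimes>\<^bsub>F\<^esub> g) d" .
qed

lemma smult_r:
  assumes "f \<in> fin_supp R B" "g \<in> fin_supp R B" "a \<in> carrier R"
  shows "g \<otimes>\<^bsub>F\<^esub> (\<lambda>b. a \<otimes> f b) = (\<lambda>d. a \<otimes> (g \<otimes>\<^bsub>F\<^esub> f) d)"
proof
  fix d
  note f = fin_suppD[OF assms(1)] and g = fin_suppD[OF assms(2)]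
  have S: "{b. a \<otimes> f b \<noteq> \<zero>} \<subseteq> {b. f b \<noteq> \<zero>}" using assms(3) by auto
  have "(g \<otimes>\<^bsub>F\<^esub> (\<lambda>b. a \<otimes> f b)) d = (\<Oplus>p\<in>{b. g b \<noteq> \<zero>} \<times> {b. f b \<noteq> \<zero>}. a \<otimes> h g f d p)"
    unfolding mult_superset[OF assms(2) fin_supp_smult[OF assms(1,3)] g(2) f(2) subset_refl S]
    using f(1) g(1) assms(3) by (intro add.finprod_cong') (auto simp: m_lcomm)
  also have "\<dots> = a \<otimes> (g \<otimes>\<^bsub>F\<^esub> f) d"
    unfolding mult_superset[OF assms(2,1) g(2) f(2) subset_refl subset_refl]
    using f g assms(3) by (intro finsum_rdistr[symmetric]) auto
  finally show "(g \<otimes>\<^bsub>F\<^esub> (\<lambda>b. a \<otimes> f b)) d = a \<otimes> (g \<otimes>\<^bsub>F\<^esub> f) d" .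
qed

lemma mult_basis:
  assumes "b \<in> B" "c \<in> B"
  shows "basis_elt R b \<otimes>\<^bsub>F\<^esub> basis_elt R c =
    (case m b c of None \<Rightarrow> (\<lambda>_. \<zero>) | Some d \<Rightarrow> basis_elt R d)"
proof
  fix x
  have "(basis_elt R b \<otimes>\<^bsub>F\<^esub> basis_elt R c) x = (\<Oplus>p\<in>{b} \<times> {c}. h (basis_elt R b) (basis_elt R c) x p)"
    using assms by (intro mult_superset fin_supp_basis_elt) (auto simp: basis_elt_def)
  then show "(basis_elt R b \<otimes>\<^bsub>F\<^esub> basis_elt R c) x =
    (case m b c of None \<Rightarrow> (\<lambda>_. \<zero>) | Some d \<Rightarrow> basis_elt R d) x"
    by (auto simp: basis_elt_def split: option.splits)
qed

lemma zero_l: "g \<in> fin_supp R B \<Longrightarrow> (\<lambda>_. \<zero>) \<otimes>\<^bsub>F\<^esub> g = (\<lambda>_. \<zero>)"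
  by (simp add: basis_algebra_def)

lemma zero_r: "g \<in> fin_supp R B \<Longrightarrow> g \<otimes>\<^bsub>F\<^esub> (\<lambda>_. \<zero>) = (\<lambda>_. \<zero>)"
  by (simp add: basis_algebra_def)

lemma lin_l:
  assumes "f \<in> fin_supp R B" "g \<in> fin_supp R B" "a \<in> carrier R" "x \<in> B"
  shows "(\<lambda>b. a \<otimes> basis_elt R x b \<oplus> f b) \<otimes>\<^bsub>F\<^esub> g =
    (\<lambda>d. a \<otimes> (basis_elt R x \<otimes>\<^bsub>F\<^esub> g) d \<oplus> (f \<otimes>\<^bsub>F\<^esub> g) d)"
  using l_dist[OF fin_supp_smult[OF fin_supp_basis_elt[OF assms(4)] assms(3)] assms(1,2)]
    smult_l[OF fin_supp_basis_elt[OF assms(4)] assms(2,3)] by simp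

lemma lin_r:
  assumes "f \<in> fin_supp R B" "g \<in> fin_supp R B" "a \<in> carrier R" "x \<in> B"
  shows "g \<otimes>\<^bsub>F\<^esub> (\<lambda>b. a \<otimes> basis_elt R x b \<oplus> f b) =
    (\<lambda>d. a \<otimes> (g \<otimes>\<^bsub>F\<^esub> basis_elt R x) d \<oplus> (g \<otimes>\<^bsub>F\<^esub> f) d)"
  using r_dist[OF fin_supp_smult[OF fin_supp_basis_elt[OF assms(4)] assms(3)] assms(1,2)]
    smult_r[OF fin_supp_basis_elt[OF assms(4)] assms(2,3)] by simp

lemma mult_assoc:
  assumes f: "f \<in> fin_supp R B" and g: "g \<in> fin_supp R B" and k: "k \<in> fin_supp R B"
  shows "(f \<otimes>\<^bsub>F\<^esub> g) \<otimes>\<^bsub>F\<^esub> k = f \<otimes>\<^bsub>F\<^esub> (g \<otimes>\<^bsub>F\<^esub> k)"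
proof -
  note be = fin_supp_basis_elt
  have 1: "(basis_elt R b \<otimes>\<^bsub>F\<^esub> basis_elt R c) \<otimes>\<^bsub>F\<^esub> basis_elt R d =
     basis_elt R b \<otimes>\<^bsub>F\<^esub> (basis_elt R c \<otimes>\<^bsub>F\<^esub> basis_elt R d)" if bcd: "b \<in> B" "c \<in> B" "d \<in> B" for b c d
  proof -
    have "(basis_elt R b \<otimes>\<^bsub>F\<^esub> basis_elt R c) \<otimes>\<^bsub>F\<^esub> basis_elt R d =
      (case Option.bind (m b c) (\<lambda>x. m x d) of None \<Rightarrow> (\<lambda>_. \<zero>) | Some x \<Rightarrow> basis_elt R x)"
      using closed[OF bcd(1,2)] bcd
      by (cases "m b c") (simp_all add: mult_basis zero_l be)
    also have "\<dots> = (case Option.bind (m c d) (m b) of None \<Rightarrow> (\<lambda>_. \<zero>) | Some x \<Rightarrow> basis_elt R x)"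
      by (simp only: assoc[OF bcd])
    also have "\<dots> = basis_elt R b \<otimes>\<^bsub>F\<^esub> (basis_elt R c \<otimes>\<^bsub>F\<^esub> basis_elt R d)"
      using closed[OF bcd(2,3)] bcd
      by (cases "m c d") (simp_all add: mult_basis zero_r be)
    finally show ?thesis .
  qed
  have 2: "(basis_elt R b \<otimes>\<^bsub>F\<^esub> basis_elt R c) \<otimes>\<^bsub>F\<^esub> k =
     basis_elt R b \<otimes>\<^bsub>F\<^esub> (basis_elt R c \<otimes>\<^bsub>F\<^esub> k)" if "b \<in> B" "c \<in> B" for b c
    using k
  proof (induction rule: fin_supp_induct)
    case zero then show ?case by (simp add: zero_r mult_in be that)
  next
    case (add v a x)
    then show ?case
      by (simp add: lin_r mult_in be that 1 r_dist smult_r fin_supp_smult)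
  qed
  have 3: "(basis_elt R b \<otimes>\<^bsub>F\<^esub> g) \<otimes>\<^bsub>F\<^esub> k = basis_elt R b \<otimes>\<^bsub>F\<^esub> (g \<otimes>\<^bsub>F\<^esub> k)" if "b \<in> B" for b
    using g
  proof (induction rule: fin_supp_induct)
    case zero then show ?case by (simp add: zero_r zero_l mult_in be that k)
  next
    case (add v a x)
    then show ?case
      by (simp add: lin_r lin_l mult_in be that 2 k r_dist smult_r l_dist smult_l fin_supp_smult)
  qed
  show ?thesis
    using f
  proof (induction rule: fin_supp_induct)
    case zero then show ?case by (simp add: zero_l mult_in g k)
  next
    case (add v a x)
    then show ?case
      by (simp add: lin_l mult_in be 3 g k l_dist smult_l fin_supp_smult)
  qed
qed

lemma one_in: "\<one>\<^bsub>F\<^esub> \<in> fin_supp R B"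
  using E by (auto simp: basis_algebra_def fin_supp_def)

lemma one_basis:
  assumes "b \<in> B"
  shows "\<one>\<^bsub>F\<^esub> \<otimes>\<^bsub>F\<^esub> basis_elt R b = basis_elt R b" (is ?l)
    and "basis_elt R b \<otimes>\<^bsub>F\<^esub> \<one>\<^bsub>F\<^esub> = basis_elt R b" (is ?r)
proof -
  have one: "\<one>\<^bsub>F\<^esub> x = (if x \<in> E then \<one> else \<zero>)" for x
    by (simp add: basis_algebra_def)
  have supp: "{x. \<one>\<^bsub>F\<^esub> x \<noteq> \<zero>} \<subseteq> E" "{x. basis_elt R b x \<noteq> \<zero>} \<subseteq> {b}"
    unfolding one by (auto simp: basis_elt_def)
  have cl: "basis_elt R b x \<in> carrier R" for x
    by (simp add: basis_elt_def)
  have fin: "finite {b}" by simp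
  obtain e where e: "e \<in> E" "m e b = Some b"
    and ne: "\<forall>e'\<in>E. e' \<noteq> e \<longrightarrow> m e' b = None"
    using unit_l[OF assms] by blast
  have ue: "e' = e" if "e' \<in> E" "m e' b = Some x" for e' x
    using ne that by (cases "e' = e") simp_all
  obtain e2 where e2: "e2 \<in> E" "m b e2 = Some b"
    and ne2: "\<forall>e'\<in>E. e' \<noteq> e2 \<longrightarrow> m b e' = None"
    using unit_r[OF assms] by blast
  have ue2: "e' = e2" if "e' \<in> E" "m b e' = Some x" for e' x
    using ne2 that by (cases "e' = e2") simp_all
  show ?l
  proof
    fix d
    have "(\<one>\<^bsub>F\<^esub> \<otimes>\<^bsub>F\<^esub> basis_elt R b) d = (\<Oplus>p\<in>E \<times> {b}. h (\<one>\<^bsub>F\<^esub>) (basis_elt R b) d p)"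
      by (rule mult_superset[OF one_in fin_supp_basis_elt[OF assms] E(1) fin supp])
    also have "\<dots> = (\<Oplus>p\<in>{(e, b)}. basis_elt R b d)"
    proof (rule add.finprod_mono_neutral_cong_right)
      show "finite (E \<times> {b})" using E by simp
      show "{(e, b)} \<subseteq> E \<times> {b}" using e by simp
      show "h (\<one>\<^bsub>F\<^esub>) (basis_elt R b) d p = \<zero>" if "p \<in> E \<times> {b} - {(e, b)}" for p
      proof -
        have "fst p \<in> E" "fst p \<noteq> e" "snd p = b" using that by auto
        then have "m (fst p) (snd p) \<noteq> Some d" using ue by metis
        then show ?thesis by (rule if_not_P)
      qed
      show "h (\<one>\<^bsub>F\<^esub>) (basis_elt R b) d p = basis_elt R b d" if "p \<in> {(e, b)}" for p
        using that e(1,2) by (auto simp: one basis_elt_def)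
      show "(\<lambda>p. h (\<one>\<^bsub>F\<^esub>) (basis_elt R b) d p) \<in> Pi (E \<times> {b}) (\<lambda>_. carrier R)"
        by (simp add: Pi_iff one basis_elt_def)
    qed
    finally show "(\<one>\<^bsub>F\<^esub> \<otimes>\<^bsub>F\<^esub> basis_elt R b) d = basis_elt R b d"
      using cl by simp
  qed
  show ?r
  proof
    fix d
    have "(basis_elt R b \<otimes>\<^bsub>F\<^esub> \<one>\<^bsub>F\<^esub>) d = (\<Oplus>p\<in>{b} \<times> E. h (basis_elt R b) (\<one>\<^bsub>F\<^esub>) d p)"
      by (rule mult_superset[OF fin_supp_basis_elt[OF assms] one_in fin E(1) supp(2,1)])
    also have "\<dots> = (\<Oplus>p\<in>{(b, e2)}. basis_elt R b d)"
    proof (rule add.finprod_mono_neutral_cong_right)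
      show "finite ({b} \<times> E)" using E by simp
      show "{(b, e2)} \<subseteq> {b} \<times> E" using e2 by simp
      show "h (basis_elt R b) (\<one>\<^bsub>F\<^esub>) d p = \<zero>" if "p \<in> {b} \<times> E - {(b, e2)}" for p
      proof -
        have "snd p \<in> E" "snd p \<noteq> e2" "fst p = b" using that by auto
        then have "m (fst p) (snd p) \<noteq> Some d" using ue2 by metis
        then show ?thesis by (rule if_not_P)
      qed
      show "h (basis_elt R b) (\<one>\<^bsub>F\<^esub>) d p = basis_elt R b d" if "p \<in> {(b, e2)}" for p
        using that e2(1,2) by (auto simp: one basis_elt_def)
      show "(\<lambda>p. h (basis_elt R b) (\<one>\<^bsub>F\<^esub>) d p) \<in> Pi ({b} \<times> E) (\<lambda>_. carrier R)"
        by (simp add: Pi_iff one basis_elt_def)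
    qed
    finally show "(basis_elt R b \<otimes>\<^bsub>F\<^esub> \<one>\<^bsub>F\<^esub>) d = basis_elt R b d"
      using cl by simp
  qed
qed

lemma one_mult:
  assumes "f \<in> fin_supp R B"
  shows "\<one>\<^bsub>F\<^esub> \<otimes>\<^bsub>F\<^esub> f = f \<and> f \<otimes>\<^bsub>F\<^esub> \<one>\<^bsub>F\<^esub> = f"
  using assms
proof (induction rule: fin_supp_induct)
  case zero then show ?case by (simp add: zero_l zero_r one_in)
next
  case (add v a x)
  then show ?case
    by (simp add: lin_l lin_r one_in one_basis)
qed

lemma basis_algebra_ring: "ring F"
proof -
  have "abelian_group F"
    using left_module_basis_algebra[of B E m] by (simp add: left_module_def)
  moreover have "monoid F"
    by (intro monoidI) (auto simp: carrier_F mult_in one_in mult_assoc one_mult)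
  moreover have "add F = (\<lambda>f g b. f b \<oplus> g b)" by (simp add: basis_algebra_def)
  ultimately show ?thesis
    by (intro ringI) (auto simp: carrier_F l_dist r_dist)
qed

end

lemma path_algebra_ring:
  assumes "cring K" "fin_digraph Q"
  shows "ring (path_algebra K Q)"
proof -
  interpret K: cring K by fact
  interpret Q: fin_digraph Q by fact
  have "basis_product K (qpaths Q) (trivial_path ` verts Q) path_comp"
  proof (unfold_locales, goal_cases)
    case (1 b c d)
    then show ?case by (auto simp: qpaths_def split: if_splits)
  next
    case (2 b c d)
    then show ?case by (cases b; cases c; cases d) auto
  next
    case 3
    then show ?case by simp
  next
    case 4
    then show ?case by (auto simp: qpaths_def trivial_path_def Q.awalk_Nil_iff)
  next
    case (5 b)
    then show ?case by (auto simp: qpaths_def trivial_path_def intro: Q.awalkI)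
  next
    case (6 b)
    then show ?case by (auto simp: qpaths_def trivial_path_def intro: Q.awalkI)
  qed
  then show ?thesis unfolding path_algebra_def by (rule basis_product.basis_algebra_ring)
qed

lemma pair_algebra_ring:
  assumes "cring K" "ring S" "ring T"
  shows "ring (pair_algebra K S T)"
proof -
  interpret K: cring K by fact
  interpret S: ring S by fact
  interpret T: ring T by fact
  have "basis_product K (carrier S \<times> carrier T) {(\<one>\<^bsub>S\<^esub>, \<one>\<^bsub>T\<^esub>)}
    (\<lambda>(s, t) (s', t'). Some (s \<otimes>\<^bsub>S\<^esub> s', t \<otimes>\<^bsub>T\<^esub> t'))"
    by unfold_locales (auto simp: S.m_assoc T.m_assoc)
  then show ?thesis unfolding pair_algebra_def by (rule basis_product.basis_algebra_ring)
qed

end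

theory Submission
  imports Defs
begin

text \<open>
  If \<open>I\<close> is generated by elements avoiding \<open>A\<close>, then for every bimodule \<open>M\<close> and every family of
  elements \<open>m\<^sub>a \<in> e\<^bsub>s(a)\<^esub> M e\<^bsub>t(a)\<^esub>\<close> the derivation of \<open>kQ\<close> with \<open>a \<mapsto> m\<^sub>a\<close> for \<open>a \<in> A\<close>, which is zero on the
  other arrows, kills \<open>I\<close>; by the vanishing of \<open>e\<^bsub>t(a)\<^esub> \<Lambda> e\<^bsub>s(b)\<^esub>\<close> it restricts to a bimodule
  homomorphism on \<open>\<langle>A + I\<rangle>\<close>. So lifts along epimorphisms may be chosen freely on the arrows.

  Conversely, let \<open>\<langle>A + I\<rangle>\<close> be projective, and split the map onto it from the free bimodule on \<open>A\<close>.
  Modulo the radical the splitting is the identity on \<open>A\<close>, since arrows are independent modulo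
  paths of length two; by nilpotency every family \<open>m\<^sub>a\<close> as above then extends to a homomorphism
  \<open>\<langle>A + I\<rangle> \<rightarrow> M\<close>. Taking for \<open>M\<close> the algebra with its left or right action made trivial at one vertex
  yields the vanishing of \<open>e\<^bsub>t(a)\<^esub> \<Lambda> e\<^bsub>s(b)\<^esub>\<close>. Let \<open>I'\<close> be the ideal generated by the elements of \<open>I\<close>
  avoiding \<open>A\<close>; taking for \<open>M\<close> the ideal of \<open>kQ/I'\<close> generated by \<open>A\<close>, and \<open>m\<^sub>a = a + I'\<close>, shows that
  elements of \<open>I\<close> all of whose paths pass through \<open>A\<close> lie in \<open>I'\<close>. Pre-removability then gives \<open>I = I'\<close>.
\<close>

section \<open>Associative algebras and their quotients\<close>

text \<open>Both directions turn on one property: every choice of elements m_a in e_{s(a)} M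
  e_{t(a)} extends to a bimodule homomorphism on the arrow ideal. This is the universal property of
  the direct sum of the bimodules \<Lambda> e_{s(a)} \<otimes> e_{t(a)} \<Lambda>, expressed without
  bases or dimensions of tensor products. The obstacle is that an element of the arrow ideal has
  many expressions as a sum of products x a y. A derivation avoids choosing one of them: it is
  defined on all of kQ through the basis of paths, and independence of the representative reduces to
  vanishing on generators of I. The bimodule M stays abstract, on an arbitrary type, because it has
  to serve as the source of a lifting problem, as a twisted copy of \<Lambda>, and as a part of a
  different quotient of kQ.\<close>

locale assoc_algebra = S: ring S + K: cring K + V: left_module K S for K and S +
  assumes smult_mult_l: "\<lbrakk>c \<in> carrier K; x \<in> carrier S; y \<in> carrier S\<rbrakk>
      \<Longrightarrow> (c \<odot>\<^bsub>S\<^esub> x) \<otimes>\<^bsub>S\<^esub> y = c \<odot>\<^bsub>S\<^esub> (x \<otimes>\<^bsub>S\<^esub> y)"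
    and smult_mult_r: "\<lbrakk>c \<in> carrier K; x \<in> carrier S; y \<in> carrier S\<rbrakk>
      \<Longrightarrow> x \<otimes>\<^bsub>S\<^esub> (c \<odot>\<^bsub>S\<^esub> y) = c \<odot>\<^bsub>S\<^esub> (x \<otimes>\<^bsub>S\<^esub> y)"
begin

text \<open>The scalar c acts as multiplication by c \<odot> 1, so ideals in the sense of rings are
  subspaces.\<close>

lemma ideal_smult_closed:
  assumes "ideal I S" "c \<in> carrier K" "x \<in> I"
  shows "c \<odot>\<^bsub>S\<^esub> x \<in> I"
proof -
  interpret I: ideal I S by fact
  have x: "x \<in> carrier S" using assms(3) by simp
  have "c \<odot>\<^bsub>S\<^esub> x = (c \<odot>\<^bsub>S\<^esub> \<one>\<^bsub>S\<^esub>) \<otimes>\<^bsub>S\<^esub> x"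
    using x assms(2) by (simp add: smult_mult_l)
  then show ?thesis
    using assms x by (simp add: I.I_l_closed V.smult_closed)
qed

lemma smult_minus:
  assumes "c \<in> carrier K" "x \<in> carrier S"
  shows "c \<odot>\<^bsub>S\<^esub> (\<ominus>\<^bsub>S\<^esub> x) = \<ominus>\<^bsub>S\<^esub> (c \<odot>\<^bsub>S\<^esub> x)"
proof -
  have "c \<odot>\<^bsub>S\<^esub> (\<ominus>\<^bsub>S\<^esub> x) \<oplus>\<^bsub>S\<^esub> c \<odot>\<^bsub>S\<^esub> x = \<zero>\<^bsub>S\<^esub>"
    using assms by (simp add: V.smult_r_distr[symmetric] S.l_neg V.smult_r_null)
  then show ?thesis
    using assms by (metis S.add.inv_closed S.minus_equality V.smult_closed)
qed

end

lemma (in basis_product) basis_algebra_assoc_algebra: "assoc_algebra R F"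
proof -
  have [simp]: "smult F = (\<lambda>c f b. c \<otimes> f b)" by (simp add: basis_algebra_def)
  show ?thesis
    using basis_algebra_ring left_module_basis_algebra[of B E m]
    by (auto simp: assoc_algebra_def assoc_algebra_axioms_def cring_axioms carrier_F smult_l smult_r)
qed

locale algebra_ideal = assoc_algebra K S + I: ideal I S for K and S and I
begin

abbreviation L where "L \<equiv> quotient_algebra S I"
abbreviation cls where "cls x \<equiv> I +>\<^bsub>S\<^esub> x"

lemma quotient_fields:
  "carrier L = carrier (S Quot I)" "mult L = mult (S Quot I)" "one L = one (S Quot I)"
  "zero L = zero (S Quot I)" "add L = add (S Quot I)"
  "smult L = (\<lambda>c X. \<Union>x\<in>X. I +>\<^bsub>S\<^esub> (c \<odot>\<^bsub>S\<^esub> x))"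
  by (simp_all add: quotient_algebra_def ring.defs module.defs)

lemma quotient_carrierE:
  assumes "X \<in> carrier L"
  obtains x where "x \<in> carrier S" "X = cls x"
  using assms by (auto simp: quotient_fields FactRing_def A_RCOSETS_def' )

lemma cls_closed [simp]: "x \<in> carrier S \<Longrightarrow> cls x \<in> carrier L"
  by (auto simp: quotient_fields FactRing_def A_RCOSETS_def')

lemma cls_mult: "x \<in> carrier S \<Longrightarrow> y \<in> carrier S \<Longrightarrow> cls x \<otimes>\<^bsub>L\<^esub> cls y = cls (x \<otimes>\<^bsub>S\<^esub> y)"
  by (simp add: quotient_fields FactRing_def I.rcoset_mult_add)

lemma cls_add: "x \<in> carrier S \<Longrightarrow> y \<in> carrier S \<Longrightarrow> cls x \<oplus>\<^bsub>L\<^esub> cls y = cls (x \<oplus>\<^bsub>S\<^esub> y)"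
  by (simp add: quotient_fields FactRing_def I.a_rcos_sum)

lemma one_eq_cls: "\<one>\<^bsub>L\<^esub> = cls \<one>\<^bsub>S\<^esub>"
  by (simp add: quotient_fields FactRing_def)

lemma zero_eq_ideal: "\<zero>\<^bsub>L\<^esub> = I"
  by (simp add: quotient_fields FactRing_def)

lemma cls_eq_iff:
  assumes "x \<in> carrier S" "y \<in> carrier S"
  shows "cls x = cls y \<longleftrightarrow> x \<ominus>\<^bsub>S\<^esub> y \<in> I"
  using assms I.a_rcos_module_minus[OF S.ring_axioms, of y x] I.a_rcos_self I.a_repr_independence'
  by metis

lemma cls_eq_zero_iff:
  assumes "x \<in> carrier S"
  shows "cls x = \<zero>\<^bsub>L\<^esub> \<longleftrightarrow> x \<in> I"
  unfolding zero_eq_ideal using assms I.a_rcos_const I.a_rcos_self by auto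

lemma zero_eq_cls: "\<zero>\<^bsub>L\<^esub> = cls \<zero>\<^bsub>S\<^esub>"
  using cls_eq_zero_iff[of "\<zero>\<^bsub>S\<^esub>"] by simp

lemma mem_cls_iff:
  assumes "x \<in> carrier S"
  shows "y \<in> cls x \<longleftrightarrow> y \<in> carrier S \<and> cls y = cls x"
  using assms I.a_rcos_self I.a_repr_independence'
  by (metis I.a_elemrcos_carrier)

text \<open>The quotient defines a scalar multiple as a union of cosets over all representatives.
  These cosets coincide, so the union collapses to one of them.\<close>

lemma cls_smult:
  assumes c: "c \<in> carrier K" and x: "x \<in> carrier S"
  shows "c \<odot>\<^bsub>L\<^esub> cls x = cls (c \<odot>\<^bsub>S\<^esub> x)"
proof -
  have "cls (c \<odot>\<^bsub>S\<^esub> y) = cls (c \<odot>\<^bsub>S\<^esub> x)" if "y \<in> cls x" for y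
  proof -
    have y: "y \<in> carrier S" "y \<ominus>\<^bsub>S\<^esub> x \<in> I"
      using that x mem_cls_iff cls_eq_iff by auto
    have "c \<odot>\<^bsub>S\<^esub> y \<ominus>\<^bsub>S\<^esub> c \<odot>\<^bsub>S\<^esub> x = c \<odot>\<^bsub>S\<^esub> (y \<ominus>\<^bsub>S\<^esub> x)"
      using c x y by (simp add: S.minus_eq V.smult_r_distr smult_minus)
    then show ?thesis
      using c x y ideal_smult_closed[OF I.is_ideal c y(2)] by (simp add: cls_eq_iff V.smult_closed)
  qed
  moreover have "x \<in> cls x" using x I.a_rcos_self by blast
  ultimately show ?thesis unfolding quotient_fields(6) by blast
qed

lemma cls_lincomb:
  "c \<in> carrier K \<Longrightarrow> x \<in> carrier S \<Longrightarrow> y \<in> carrier S \<Longrightarrow>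
    cls (c \<odot>\<^bsub>S\<^esub> x \<oplus>\<^bsub>S\<^esub> y) = c \<odot>\<^bsub>L\<^esub> cls x \<oplus>\<^bsub>L\<^esub> cls y"
  by (simp add: cls_add cls_smult V.smult_closed)

lemma quotient_assoc_algebra: "assoc_algebra K L"
proof -
  have q: "ring (S Quot I)" by (rule I.quotient_is_ring)
  interpret q: ring "S Quot I" by (rule q)
  have ag: "abelian_group L"
    by (rule abelian_groupI)
      (auto simp: quotient_fields q.a_ac intro!: bexI[of _ "\<ominus>\<^bsub>S Quot I\<^esub> _"] q.l_neg)
  have r: "ring L"
    by (intro ringI ag monoidI) (auto simp: quotient_fields q.m_assoc q.l_distr q.r_distr)
  have "left_module K L"
    using ag by (auto simp: left_module_def left_module_axioms_def K.ring_axioms V.smult_closed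
        V.smult_l_distr V.smult_r_distr V.smult_assoc V.smult_one cls_smult cls_add cls_mult
        elim!: quotient_carrierE)
  then show ?thesis
    using r by (auto simp: assoc_algebra_def assoc_algebra_axioms_def K.cring_axioms cls_smult
        cls_mult smult_mult_l smult_mult_r V.smult_closed elim!: quotient_carrierE)
qed

end

sublocale algebra_ideal \<subseteq> L: assoc_algebra K L
  by (rule quotient_assoc_algebra)

section \<open>Modules over the enveloping algebra\<close>

lemma (in ring) idealI':
  assumes "I \<subseteq> carrier R" "\<zero> \<in> I"
    and add: "\<And>a b. a \<in> I \<Longrightarrow> b \<in> I \<Longrightarrow> a \<oplus> b \<in> I"
    and l: "\<And>a x. a \<in> I \<Longrightarrow> x \<in> carrier R \<Longrightarrow> x \<otimes> a \<in> I"
    and r: "\<And>a x. a \<in> I \<Longrightarrow> x \<in> carrier R \<Longrightarrow> a \<otimes> x \<in> I"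
  shows "ideal I R"
proof (rule idealI[OF ring_axioms])
  show "subgroup I (add_monoid R)"
  proof (rule add.subgroupI)
    fix a assume a: "a \<in> I"
    then have "(\<ominus> \<one>) \<otimes> a \<in> I" using l by simp
    moreover have "(\<ominus> \<one>) \<otimes> a = \<ominus> a"
      using a assms(1) by (simp add: l_minus subset_iff)
    ultimately show "\<ominus> a \<in> I" by simp
  qed (use assms in auto)
qed (use l r in auto)

lemma opposite_algebra_fields [simp]:
  "carrier (opposite_algebra S) = carrier S" "add (opposite_algebra S) = add S"
  "zero (opposite_algebra S) = zero S" "one (opposite_algebra S) = one S"
  "smult (opposite_algebra S) = smult S" "mult (opposite_algebra S) = (\<lambda>x y. y \<otimes>\<^bsub>S\<^esub> x)"
  by (simp_all add: opposite_algebra_def)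

definition pure_tensor ::
  "('k, 'c) ring_scheme \<Rightarrow> ('k, 's, 'd) module_scheme \<Rightarrow> 's \<Rightarrow> 's \<Rightarrow> ('s \<times> 's \<Rightarrow> 'k) set"
  where "pure_tensor K S x y = (let F = pair_algebra K S (opposite_algebra S) in
    (Idl\<^bsub>F\<^esub> (bilinear_relations K S (opposite_algebra S))) +>\<^bsub>F\<^esub> basis_elt K (x, y))"

text \<open>In the following record, \<open>act (x, y) m\<close> stands for \<open>x m y\<close>.\<close>

definition env_module ::
  "('k, 'c) ring_scheme \<Rightarrow> ('k, 'm, 'e) module_scheme \<Rightarrow> 'm set \<Rightarrow> ('s \<times> 's \<Rightarrow> 'm \<Rightarrow> 'm)
    \<Rightarrow> (('s \<times> 's \<Rightarrow> 'k) set, 'm) module"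
  where "env_module K M C act = \<lparr>
    carrier = C, mult = mult M, one = one M, zero = zero M, add = add M,
    smult = (\<lambda>Z x. the_elem ((\<lambda>f. \<Oplus>\<^bsub>M\<^esub>p\<in>{p. f p \<noteq> \<zero>\<^bsub>K\<^esub>}.
      f p \<odot>\<^bsub>M\<^esub> act p x) ` Z))\<rparr>"

text \<open>Through this identity the bimodule of the theorem inherits the module axioms and the
  independence of representatives from the general construction.\<close>

lemma ideal_bimodule_eq_env_module:
  "ideal_bimodule K S J = env_module K S J (\<lambda>p x. fst p \<otimes>\<^bsub>S\<^esub> x \<otimes>\<^bsub>S\<^esub> snd p)"
  by (simp add: ideal_bimodule_def env_module_def)

section \<open>The enveloping algebra and its pure tensors\<close>

context assoc_algebra
begin

abbreviation Sop where "Sop \<equiv> opposite_algebra S"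
abbreviation Pr where "Pr \<equiv> pair_algebra K S Sop"
abbreviation Rl where "Rl \<equiv> Idl\<^bsub>Pr\<^esub> (bilinear_relations K S Sop)"
abbreviation E where "E \<equiv> enveloping_algebra K S"
abbreviation tens where "tens \<equiv> pure_tensor K S"

lemma pair_basis_product:
  "basis_product K (carrier S \<times> carrier Sop) {(\<one>\<^bsub>S\<^esub>, \<one>\<^bsub>Sop\<^esub>)}
    (\<lambda>(s, t) (s', t'). Some (s \<otimes>\<^bsub>S\<^esub> s', t \<otimes>\<^bsub>Sop\<^esub> t'))"
  by unfold_locales (auto simp: S.m_assoc)

lemma pair_assoc_algebra: "assoc_algebra K Pr"
  using basis_product.basis_algebra_assoc_algebra[OF pair_basis_product]
  by (simp add: pair_algebra_def)

lemma pair_carrier: "carrier Pr = fin_supp K (carrier S \<times> carrier S)"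
  by (simp add: pair_algebra_def basis_algebra_def)

lemma pair_add: "f \<oplus>\<^bsub>Pr\<^esub> g = (\<lambda>p. f p \<oplus>\<^bsub>K\<^esub> g p)"
  by (simp add: pair_algebra_def basis_algebra_def)

lemma pair_smult: "c \<odot>\<^bsub>Pr\<^esub> g = (\<lambda>p. c \<otimes>\<^bsub>K\<^esub> g p)"
  by (simp add: pair_algebra_def basis_algebra_def)

lemma pair_zero: "\<zero>\<^bsub>Pr\<^esub> = (\<lambda>p. \<zero>\<^bsub>K\<^esub>)"
  by (simp add: pair_algebra_def basis_algebra_def)

lemma pair_one: "\<one>\<^bsub>Pr\<^esub> = basis_elt K (\<one>\<^bsub>S\<^esub>, \<one>\<^bsub>S\<^esub>)"
  by (auto simp: pair_algebra_def basis_algebra_def basis_elt_def)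

lemma pair_basis_closed [simp]:
  "x \<in> carrier S \<Longrightarrow> y \<in> carrier S \<Longrightarrow> basis_elt K (x, y) \<in> carrier Pr"
  by (simp add: pair_carrier K.fin_supp_basis_elt)

lemma pair_mult_basis:
  assumes "x \<in> carrier S" "y \<in> carrier S" "x' \<in> carrier S" "y' \<in> carrier S"
  shows "basis_elt K (x, y) \<otimes>\<^bsub>Pr\<^esub> basis_elt K (x', y') = basis_elt K (x \<otimes>\<^bsub>S\<^esub> x', y' \<otimes>\<^bsub>S\<^esub> y)"
  using basis_product.mult_basis[OF pair_basis_product, of "(x, y)" "(x', y')"] assms
  by (simp add: pair_algebra_def)

lemma pair_induct [consumes 1, case_names zero add]:
  assumes "f \<in> carrier Pr" "P \<zero>\<^bsub>Pr\<^esub>"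
    and "\<And>g c x y. g \<in> carrier Pr \<Longrightarrow> c \<in> carrier K \<Longrightarrow> x \<in> carrier S \<Longrightarrow> y \<in> carrier S \<Longrightarrow> P g \<Longrightarrow>
      P (c \<odot>\<^bsub>Pr\<^esub> basis_elt K (x, y) \<oplus>\<^bsub>Pr\<^esub> g)"
  shows "P f"
  using assms(1) unfolding pair_carrier
proof (induction rule: K.fin_supp_induct)
  case zero
  then show ?case using assms(2) by (simp add: pair_zero)
next
  case (add v a x)
  then show ?case using assms(3)[of v a "fst x" "snd x"] by (auto simp: pair_add pair_smult pair_carrier)
qed

lemma bilinear_relations_subset: "bilinear_relations K S Sop \<subseteq> carrier Pr"
proof -
  interpret Pr: assoc_algebra K Pr by (rule pair_assoc_algebra)
  show ?thesis
    by (auto simp: bilinear_relations_def Let_def Pr.V.smult_closed V.smult_closed)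
qed

lemma tensor_algebra_ideal: "algebra_ideal K Pr Rl"
proof -
  interpret Pr: assoc_algebra K Pr by (rule pair_assoc_algebra)
  show ?thesis
    by (intro algebra_ideal.intro Pr.assoc_algebra_axioms Pr.S.genideal_ideal bilinear_relations_subset)
qed

lemma enveloping_algebra_eq: "E = quotient_algebra Pr Rl"
  by (simp add: enveloping_algebra_def tensor_algebra_def)

lemma pure_tensor_eq: "tens x y = Rl +>\<^bsub>Pr\<^esub> basis_elt K (x, y)"
  by (simp add: pure_tensor_def Let_def)

lemma enveloping_assoc_algebra: "assoc_algebra K E"
  unfolding enveloping_algebra_eq by (rule algebra_ideal.quotient_assoc_algebra[OF tensor_algebra_ideal])

lemma tens_closed [simp]: "x \<in> carrier S \<Longrightarrow> y \<in> carrier S \<Longrightarrow> tens x y \<in> carrier E"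
  by (simp add: enveloping_algebra_eq pure_tensor_eq algebra_ideal.cls_closed[OF tensor_algebra_ideal])

text \<open>The second factors belong to the opposite algebra. Their reversed order is what makes
  the assignment of x m y to m a left action.\<close>

lemma tens_mult:
  assumes "x \<in> carrier S" "y \<in> carrier S" "x' \<in> carrier S" "y' \<in> carrier S"
  shows "tens x y \<otimes>\<^bsub>E\<^esub> tens x' y' = tens (x \<otimes>\<^bsub>S\<^esub> x') (y' \<otimes>\<^bsub>S\<^esub> y)"
  using assms by (simp add: enveloping_algebra_eq pure_tensor_eq pair_mult_basis
      algebra_ideal.cls_mult[OF tensor_algebra_ideal])

lemma tens_one: "\<one>\<^bsub>E\<^esub> = tens \<one>\<^bsub>S\<^esub> \<one>\<^bsub>S\<^esub>"
  by (simp add: enveloping_algebra_eq pure_tensor_eq pair_one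
      algebra_ideal.one_eq_cls[OF tensor_algebra_ideal])

lemma tens_eqI:
  assumes "f \<ominus>\<^bsub>Pr\<^esub> g \<in> bilinear_relations K S Sop" "f \<in> carrier Pr" "g \<in> carrier Pr"
  shows "Rl +>\<^bsub>Pr\<^esub> f = Rl +>\<^bsub>Pr\<^esub> g"
proof -
  interpret Pr: assoc_algebra K Pr by (rule pair_assoc_algebra)
  have "f \<ominus>\<^bsub>Pr\<^esub> g \<in> Rl"
    using assms(1) Pr.S.genideal_self[OF bilinear_relations_subset] by blast
  then show ?thesis
    using assms algebra_ideal.cls_eq_iff[OF tensor_algebra_ideal] by blast
qed

lemma tens_add:
  assumes [simp]: "x \<in> carrier S" "y \<in> carrier S" "z \<in> carrier S"
  shows tens_add_l: "tens (x \<oplus>\<^bsub>S\<^esub> y) z = tens x z \<oplus>\<^bsub>E\<^esub> tens y z"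
    and tens_add_r: "tens z (x \<oplus>\<^bsub>S\<^esub> y) = tens z x \<oplus>\<^bsub>E\<^esub> tens z y"
proof -
  interpret Pr: assoc_algebra K Pr by (rule pair_assoc_algebra)
  interpret T: algebra_ideal K Pr Rl by (rule tensor_algebra_ideal)
  note rel = bilinear_relations_def[of K S Sop, unfolded Let_def]
  have "basis_elt K (x \<oplus>\<^bsub>S\<^esub> y, z) \<ominus>\<^bsub>Pr\<^esub> (basis_elt K (x, z) \<oplus>\<^bsub>Pr\<^esub> basis_elt K (y, z))
    \<in> bilinear_relations K S Sop"
    \<comment> \<open>The union rules select one of the four families of relations, here additivity
      in the first factor; the witnesses are its three parameters.\<close>
    unfolding rel by (rule UnI1, rule UnI1, rule UnI1, rule CollectI,
      rule exI[of _ x], rule exI[of _ y], rule exI[of _ z]) simp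
  from tens_eqI[OF this] show "tens (x \<oplus>\<^bsub>S\<^esub> y) z = tens x z \<oplus>\<^bsub>E\<^esub> tens y z"
    by (simp add: enveloping_algebra_eq pure_tensor_eq T.cls_add)
  have "basis_elt K (z, x \<oplus>\<^bsub>S\<^esub> y) \<ominus>\<^bsub>Pr\<^esub> (basis_elt K (z, x) \<oplus>\<^bsub>Pr\<^esub> basis_elt K (z, y))
    \<in> bilinear_relations K S Sop"
    unfolding rel by (rule UnI1, rule UnI1, rule UnI2, rule CollectI,
      rule exI[of _ z], rule exI[of _ x], rule exI[of _ y]) simp
  from tens_eqI[OF this] show "tens z (x \<oplus>\<^bsub>S\<^esub> y) = tens z x \<oplus>\<^bsub>E\<^esub> tens z y"
    by (simp add: enveloping_algebra_eq pure_tensor_eq T.cls_add)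
qed

lemma tens_smult:
  assumes [simp]: "c \<in> carrier K" "x \<in> carrier S" "y \<in> carrier S"
  shows tens_smult_l: "tens (c \<odot>\<^bsub>S\<^esub> x) y = c \<odot>\<^bsub>E\<^esub> tens x y"
    and tens_smult_r: "tens x (c \<odot>\<^bsub>S\<^esub> y) = c \<odot>\<^bsub>E\<^esub> tens x y"
proof -
  interpret Pr: assoc_algebra K Pr by (rule pair_assoc_algebra)
  interpret T: algebra_ideal K Pr Rl by (rule tensor_algebra_ideal)
  note [simp] = Pr.V.smult_closed V.smult_closed
  note rel = bilinear_relations_def[of K S Sop, unfolded Let_def]
  have "basis_elt K (c \<odot>\<^bsub>S\<^esub> x, y) \<ominus>\<^bsub>Pr\<^esub> (c \<odot>\<^bsub>Pr\<^esub> basis_elt K (x, y))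
    \<in> bilinear_relations K S Sop"
    unfolding rel by (rule UnI1, rule UnI2, rule CollectI,
      rule exI[of _ c], rule exI[of _ x], rule exI[of _ y]) simp
  from tens_eqI[OF this] show "tens (c \<odot>\<^bsub>S\<^esub> x) y = c \<odot>\<^bsub>E\<^esub> tens x y"
    by (simp add: enveloping_algebra_eq pure_tensor_eq T.cls_smult V.smult_closed Pr.V.smult_closed)
  have "basis_elt K (x, c \<odot>\<^bsub>S\<^esub> y) \<ominus>\<^bsub>Pr\<^esub> (c \<odot>\<^bsub>Pr\<^esub> basis_elt K (x, y))
    \<in> bilinear_relations K S Sop"
    unfolding rel by (rule UnI2, rule CollectI,
      rule exI[of _ c], rule exI[of _ x], rule exI[of _ y]) simp
  from tens_eqI[OF this] show "tens x (c \<odot>\<^bsub>S\<^esub> y) = c \<odot>\<^bsub>E\<^esub> tens x y"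
    by (simp add: enveloping_algebra_eq pure_tensor_eq T.cls_smult V.smult_closed Pr.V.smult_closed)
qed

lemma tens_zero [simp]:
  assumes "x \<in> carrier S"
  shows "tens \<zero>\<^bsub>S\<^esub> x = \<zero>\<^bsub>E\<^esub>" "tens x \<zero>\<^bsub>S\<^esub> = \<zero>\<^bsub>E\<^esub>"
proof -
  interpret E: assoc_algebra K E by (rule enveloping_assoc_algebra)
  show "tens \<zero>\<^bsub>S\<^esub> x = \<zero>\<^bsub>E\<^esub>" "tens x \<zero>\<^bsub>S\<^esub> = \<zero>\<^bsub>E\<^esub>"
    using assms tens_smult_l[of "\<zero>\<^bsub>K\<^esub>" x x] tens_smult_r[of "\<zero>\<^bsub>K\<^esub>" x x]
    by (simp_all add: V.smult_l_null E.V.smult_l_null)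
qed

text \<open>There is no case for coefficients, because c times x \<otimes> y is the pure tensor (c
  x) \<otimes> y: pure tensors generate the enveloping algebra additively.\<close>

lemma tens_induct [consumes 1, case_names zero add tens]:
  assumes "w \<in> carrier E" "P \<zero>\<^bsub>E\<^esub>"
    and add: "\<And>w w'. w \<in> carrier E \<Longrightarrow> w' \<in> carrier E \<Longrightarrow> P w \<Longrightarrow> P w' \<Longrightarrow> P (w \<oplus>\<^bsub>E\<^esub> w')"
    and tens: "\<And>x y. x \<in> carrier S \<Longrightarrow> y \<in> carrier S \<Longrightarrow> P (tens x y)"
  shows "P w"
proof -
  interpret Pr: assoc_algebra K Pr by (rule pair_assoc_algebra)
  interpret T: algebra_ideal K Pr Rl by (rule tensor_algebra_ideal)
  obtain f where f: "f \<in> carrier Pr" "w = T.cls f"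
    using assms(1) unfolding enveloping_algebra_eq by (elim T.quotient_carrierE)
  from f(1) have "P (T.cls f)"
  proof (induction rule: pair_induct)
    case zero
    then show ?case using assms(2) by (simp add: enveloping_algebra_eq T.zero_eq_cls)
  next
    case (add g c x y)
    have "T.cls (c \<odot>\<^bsub>Pr\<^esub> basis_elt K (x, y)) = tens (c \<odot>\<^bsub>S\<^esub> x) y"
      using add by (simp add: tens_smult_l) (simp add: enveloping_algebra_eq pure_tensor_eq T.cls_smult)
    then have "P (T.cls (c \<odot>\<^bsub>Pr\<^esub> basis_elt K (x, y)))"
      using tens[of "c \<odot>\<^bsub>S\<^esub> x" y] add by (simp add: V.smult_closed)
    then have "P (T.cls (c \<odot>\<^bsub>Pr\<^esub> basis_elt K (x, y)) \<oplus>\<^bsub>E\<^esub> T.cls g)"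
      using add by (intro assms(3)) (simp_all add: enveloping_algebra_eq Pr.V.smult_closed)
    then show ?case
      using add by (simp add: enveloping_algebra_eq T.cls_add Pr.V.smult_closed)
  qed
  then show ?thesis using f(2) by simp
qed

end

text \<open>A bimodule on which K acts centrally, carried by a subspace C of a K-module M.
  Separating C from M lets an ideal of S, or a part of another quotient algebra, carry a bimodule on
  the type where it already lives. The reversed order of y' and y in \<open>act_mult\<close> is that
  of the opposite algebra.\<close>

locale env_action = assoc_algebra K S + M: left_module K M for K and S and M +
  fixes C and act
  assumes C: "C \<subseteq> carrier M" "\<zero>\<^bsub>M\<^esub> \<in> C"
    and C_add: "m \<in> C \<Longrightarrow> m' \<in> C \<Longrightarrow> m \<oplus>\<^bsub>M\<^esub> m' \<in> C"
    and C_smult: "c \<in> carrier K \<Longrightarrow> m \<in> C \<Longrightarrow> c \<odot>\<^bsub>M\<^esub> m \<in> C"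
    and act_closed: "\<lbrakk>x \<in> carrier S; y \<in> carrier S; m \<in> C\<rbrakk> \<Longrightarrow> act (x, y) m \<in> C"
    and act_add: "\<lbrakk>x \<in> carrier S; y \<in> carrier S; m \<in> C; m' \<in> C\<rbrakk>
      \<Longrightarrow> act (x, y) (m \<oplus>\<^bsub>M\<^esub> m') = act (x, y) m \<oplus>\<^bsub>M\<^esub> act (x, y) m'"
    and act_smult: "\<lbrakk>x \<in> carrier S; y \<in> carrier S; m \<in> C; c \<in> carrier K\<rbrakk>
      \<Longrightarrow> act (x, y) (c \<odot>\<^bsub>M\<^esub> m) = c \<odot>\<^bsub>M\<^esub> act (x, y) m"
    and act_add_l: "\<lbrakk>x \<in> carrier S; x' \<in> carrier S; y \<in> carrier S; m \<in> C\<rbrakk>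
      \<Longrightarrow> act (x \<oplus>\<^bsub>S\<^esub> x', y) m = act (x, y) m \<oplus>\<^bsub>M\<^esub> act (x', y) m"
    and act_add_r: "\<lbrakk>x \<in> carrier S; y \<in> carrier S; y' \<in> carrier S; m \<in> C\<rbrakk>
      \<Longrightarrow> act (x, y \<oplus>\<^bsub>S\<^esub> y') m = act (x, y) m \<oplus>\<^bsub>M\<^esub> act (x, y') m"
    and act_smult_l: "\<lbrakk>c \<in> carrier K; x \<in> carrier S; y \<in> carrier S; m \<in> C\<rbrakk>
      \<Longrightarrow> act (c \<odot>\<^bsub>S\<^esub> x, y) m = c \<odot>\<^bsub>M\<^esub> act (x, y) m"
    and act_smult_r: "\<lbrakk>c \<in> carrier K; x \<in> carrier S; y \<in> carrier S; m \<in> C\<rbrakk>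
      \<Longrightarrow> act (x, c \<odot>\<^bsub>S\<^esub> y) m = c \<odot>\<^bsub>M\<^esub> act (x, y) m"
    and act_one: "m \<in> C \<Longrightarrow> act (\<one>\<^bsub>S\<^esub>, \<one>\<^bsub>S\<^esub>) m = m"
    and act_mult: "\<lbrakk>x \<in> carrier S; y \<in> carrier S; x' \<in> carrier S; y' \<in> carrier S; m \<in> C\<rbrakk>
      \<Longrightarrow> act (x \<otimes>\<^bsub>S\<^esub> x', y' \<otimes>\<^bsub>S\<^esub> y) m = act (x, y) (act (x', y') m)"
begin

abbreviation N where "N \<equiv> env_module K M C act"

abbreviation pact where "pact f m \<equiv> lin_ext K M (\<lambda>p. act p m) f"

lemma act_Pi: "m \<in> C \<Longrightarrow> (\<lambda>p. act p m) \<in> Pi (carrier S \<times> carrier S) (\<lambda>_. carrier M)"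
  using act_closed C by (auto simp: subset_iff)

lemma CM: "m \<in> C \<Longrightarrow> m \<in> carrier M"
  using C by auto

lemma pact_hom: "m \<in> C \<Longrightarrow> (\<lambda>f. pact f m) \<in> lmod_hom K Pr M"
  unfolding pair_algebra_def opposite_algebra_fields by (rule M.lin_ext_hom[OF act_Pi])

lemma pact_add: "\<lbrakk>m \<in> C; f \<in> carrier Pr; g \<in> carrier Pr\<rbrakk> \<Longrightarrow> pact (f \<oplus>\<^bsub>Pr\<^esub> g) m = pact f m \<oplus>\<^bsub>M\<^esub> pact g m"
  using pact_hom by (auto simp: lmod_hom_def)

lemma pact_smult: "\<lbrakk>m \<in> C; f \<in> carrier Pr; c \<in> carrier K\<rbrakk> \<Longrightarrow> pact (c \<odot>\<^bsub>Pr\<^esub> f) m = c \<odot>\<^bsub>M\<^esub> pact f m"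
  using pact_hom by (auto simp: lmod_hom_def)

lemma pact_zero: "pact \<zero>\<^bsub>Pr\<^esub> m = \<zero>\<^bsub>M\<^esub>"
  by (simp add: pair_zero lin_ext_def)

lemma pact_basis: "\<lbrakk>m \<in> C; x \<in> carrier S; y \<in> carrier S\<rbrakk> \<Longrightarrow> pact (basis_elt K (x, y)) m = act (x, y) m"
  using M.lin_ext_basis_elt[OF _ act_Pi, of "(x, y)" m] by simp

lemma pact_closed:
  assumes "f \<in> carrier Pr" "m \<in> C"
  shows "pact f m \<in> C"
proof -
  interpret Pr: assoc_algebra K Pr by (rule pair_assoc_algebra)
  show ?thesis using assms(1)
    by (induction rule: pair_induct)
      (simp_all add: pact_zero pact_add pact_smult pact_basis assms C C_add C_smult act_closed
        Pr.V.smult_closed)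
qed

lemma pact_add_r:
  assumes "f \<in> carrier Pr" "m \<in> C" "m' \<in> C"
  shows "pact f (m \<oplus>\<^bsub>M\<^esub> m') = pact f m \<oplus>\<^bsub>M\<^esub> pact f m'"
proof -
  interpret Pr: assoc_algebra K Pr by (rule pair_assoc_algebra)
  show ?thesis using assms(1)
  proof (induction rule: pair_induct)
    case zero
    then show ?case by (simp add: pact_zero)
  next
    case (add g c x y)
    then show ?case using assms
      by (simp add: pact_add pact_smult pact_basis C_add act_add M.smult_r_distr CM act_closed
          pact_closed M.smult_closed Pr.V.smult_closed M.M.a_ac)
  qed
qed

lemma pact_smult_r:
  assumes "f \<in> carrier Pr" "m \<in> C" "c \<in> carrier K"
  shows "pact f (c \<odot>\<^bsub>M\<^esub> m) = c \<odot>\<^bsub>M\<^esub> pact f m"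
proof -
  interpret Pr: assoc_algebra K Pr by (rule pair_assoc_algebra)
  show ?thesis using assms(1)
  proof (induction rule: pair_induct)
    case zero
    then show ?case using assms by (simp add: pact_zero M.smult_r_null)
  next
    case (add g d x y)
    have "d \<odot>\<^bsub>M\<^esub> (c \<odot>\<^bsub>M\<^esub> act (x, y) m) = c \<odot>\<^bsub>M\<^esub> (d \<odot>\<^bsub>M\<^esub> act (x, y) m)"
      using add assms by (simp add: M.smult_assoc[symmetric] CM act_closed K.m_comm)
    then show ?case using assms add
      by (simp add: pact_add pact_smult pact_basis C_smult act_smult M.smult_r_distr CM act_closed
          pact_closed M.smult_closed Pr.V.smult_closed)
  qed
qed

lemma pact_mult:
  assumes "f \<in> carrier Pr" "g \<in> carrier Pr" "m \<in> C"
  shows "pact (f \<otimes>\<^bsub>Pr\<^esub> g) m = pact f (pact g m)"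
proof -
  interpret Pr: assoc_algebra K Pr by (rule pair_assoc_algebra)
  have 1: "pact (basis_elt K (x, y) \<otimes>\<^bsub>Pr\<^esub> g) m = act (x, y) (pact g m)"
    if xy: "x \<in> carrier S" "y \<in> carrier S" for x y
    using assms(2)
  proof (induction rule: pair_induct)
    case zero
    have "act (x, y) \<zero>\<^bsub>M\<^esub> = \<zero>\<^bsub>M\<^esub>"
      using act_smult[OF xy C(2), of "\<zero>\<^bsub>K\<^esub>"] C act_closed[OF xy C(2)] by (simp add: M.smult_l_null CM)
    then show ?case by (simp add: pact_zero xy)
  next
    case (add g d x' y')
    then show ?case using assms xy
      by (simp add: pact_add pact_smult pact_basis pair_mult_basis CM act_closed act_mult act_add
          act_smult C_smult Pr.S.r_distr Pr.smult_mult_r pact_closed Pr.V.smult_closed)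
  qed
  show ?thesis using assms(1)
  proof (induction rule: pair_induct)
    case zero
    then show ?case using assms by (simp add: pact_zero)
  next
    case (add h d x y)
    then show ?case using assms
      by (simp add: pact_add pact_smult pact_basis 1 CM act_closed Pr.S.l_distr Pr.smult_mult_l
          pact_closed Pr.V.smult_closed)
  qed
qed

text \<open>The elements of the pair algebra that annihilate C form a two-sided ideal. The
  bilinearity axioms of the action put each generating relation into it, hence all of
  \<open>Rl\<close>.\<close>

lemma pact_relations:
  assumes "f \<in> Rl" "m \<in> C"
  shows "pact f m = \<zero>\<^bsub>M\<^esub>"
proof -
  interpret Pr: assoc_algebra K Pr by (rule pair_assoc_algebra)
  let ?Z = "{f \<in> carrier Pr. \<forall>m\<in>C. pact f m = \<zero>\<^bsub>M\<^esub>}"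
  have z: "pact f \<zero>\<^bsub>M\<^esub> = \<zero>\<^bsub>M\<^esub>" if "f \<in> carrier Pr" for f
    using pact_smult_r[OF that C(2), of "\<zero>\<^bsub>K\<^esub>"] C that by (simp add: M.smult_l_null CM pact_closed)
  have "ideal ?Z Pr"
    by (rule Pr.S.idealI') (auto simp: pact_zero pact_add pact_mult z pact_closed)
  \<comment> \<open>Every relation is a difference of two elements that act equally. Since
    \<open>pact\<close> is known to respect sums and scalars, the minus sign is traded for the
    scalar -1.\<close>
  moreover have eq: "pact (f \<ominus>\<^bsub>Pr\<^esub> g) m = \<zero>\<^bsub>M\<^esub>" if "f \<in> carrier Pr" "g \<in> carrier Pr" "pact f m = pact g m" "m \<in> C" for f g m
  proof -
    have "\<ominus>\<^bsub>Pr\<^esub> g = (\<ominus>\<^bsub>K\<^esub> \<one>\<^bsub>K\<^esub>) \<odot>\<^bsub>Pr\<^esub> g"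
    proof -
      have "g \<oplus>\<^bsub>Pr\<^esub> (\<ominus>\<^bsub>K\<^esub> \<one>\<^bsub>K\<^esub>) \<odot>\<^bsub>Pr\<^esub> g = (\<one>\<^bsub>K\<^esub> \<oplus>\<^bsub>K\<^esub> \<ominus>\<^bsub>K\<^esub> \<one>\<^bsub>K\<^esub>) \<odot>\<^bsub>Pr\<^esub> g"
        using that by (subst Pr.V.smult_l_distr) (simp_all add: Pr.V.smult_one)
      then have "g \<oplus>\<^bsub>Pr\<^esub> (\<ominus>\<^bsub>K\<^esub> \<one>\<^bsub>K\<^esub>) \<odot>\<^bsub>Pr\<^esub> g = \<zero>\<^bsub>Pr\<^esub>"
        using that by (simp add: K.r_neg Pr.V.smult_l_null)
      then show ?thesis
        using that by (metis Pr.S.add.m_comm Pr.S.minus_equality Pr.V.smult_closed K.add.inv_closed K.one_closed)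
    qed
    moreover have "pact g m \<oplus>\<^bsub>M\<^esub> (\<ominus>\<^bsub>K\<^esub> \<one>\<^bsub>K\<^esub>) \<odot>\<^bsub>M\<^esub> pact g m = (\<one>\<^bsub>K\<^esub> \<oplus>\<^bsub>K\<^esub> \<ominus>\<^bsub>K\<^esub> \<one>\<^bsub>K\<^esub>) \<odot>\<^bsub>M\<^esub> pact g m"
      using that by (subst M.smult_l_distr) (simp_all add: M.smult_one pact_closed CM)
    ultimately show ?thesis
      using that by (simp add: Pr.S.minus_eq pact_add pact_smult Pr.V.smult_closed K.r_neg M.smult_l_null pact_closed CM)
  qed
  moreover have "bilinear_relations K S Sop \<subseteq> ?Z"
  proof
    fix f assume f: "f \<in> bilinear_relations K S Sop"
    have "pact f m = \<zero>\<^bsub>M\<^esub>" if "m \<in> C" for m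
      using f that unfolding bilinear_relations_def Let_def
      by (auto intro!: eq simp: pact_add pact_smult pact_basis V.smult_closed Pr.V.smult_closed
          act_add_l act_add_r act_smult_l act_smult_r)
    then show "f \<in> ?Z" using f bilinear_relations_subset by auto
  qed
  ultimately show ?thesis
    using assms Pr.S.genideal_minimal[of ?Z "bilinear_relations K S Sop"] by auto
qed

lemma env_module_fields [simp]:
  "carrier N = C" "add N = add M" "zero N = zero M"
  by (simp_all add: env_module_def)

text \<open>Elements of \<open>Rl\<close> act as zero, so all representatives of a coset act alike
  and \<open>the_elem\<close> is applied to a singleton.\<close>

lemma env_module_smult:
  assumes f: "f \<in> carrier Pr" and m: "m \<in> C"
  shows "(Rl +>\<^bsub>Pr\<^esub> f) \<odot>\<^bsub>N\<^esub> m = pact f m"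
proof -
  interpret T: algebra_ideal K Pr Rl by (rule tensor_algebra_ideal)
  have "pact g m = pact f m" if g: "g \<in> T.cls f" for g
  proof -
    from g f have gc: "g \<in> carrier Pr" "g \<ominus>\<^bsub>Pr\<^esub> f \<in> Rl" using T.mem_cls_iff T.cls_eq_iff by auto
    then have "g = (g \<ominus>\<^bsub>Pr\<^esub> f) \<oplus>\<^bsub>Pr\<^esub> f"
      using f by (simp add: T.S.minus_eq T.S.a_assoc T.S.l_neg)
    then have "pact g m = pact (g \<ominus>\<^bsub>Pr\<^esub> f) m \<oplus>\<^bsub>M\<^esub> pact f m"
      using pact_add[OF m] f gc by (metis T.S.minus_closed)
    then show ?thesis
      using pact_relations[OF gc(2) m] f m by (simp add: pact_closed CM)
  qed
  moreover have "f \<in> T.cls f" using f T.mem_cls_iff by blast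
  ultimately have "(\<lambda>g. pact g m) ` T.cls f = {pact f m}" by blast
  then show ?thesis by (simp add: env_module_def lin_ext_def)
qed

lemma env_module_tens:
  "\<lbrakk>x \<in> carrier S; y \<in> carrier S; m \<in> C\<rbrakk> \<Longrightarrow> tens x y \<odot>\<^bsub>N\<^esub> m = act (x, y) m"
  by (simp add: pure_tensor_eq env_module_smult pact_basis)

lemma left_module_env_module: "left_module E N"
proof -
  interpret T: algebra_ideal K Pr Rl by (rule tensor_algebra_ideal)
  have "m \<oplus>\<^bsub>M\<^esub> (\<ominus>\<^bsub>K\<^esub> \<one>\<^bsub>K\<^esub>) \<odot>\<^bsub>M\<^esub> m = \<zero>\<^bsub>M\<^esub>" if "m \<in> C" for m
  proof -
    have "(\<ominus>\<^bsub>K\<^esub> \<one>\<^bsub>K\<^esub>) \<odot>\<^bsub>M\<^esub> m \<oplus>\<^bsub>M\<^esub> m = (\<ominus>\<^bsub>K\<^esub> \<one>\<^bsub>K\<^esub> \<oplus>\<^bsub>K\<^esub> \<one>\<^bsub>K\<^esub>) \<odot>\<^bsub>M\<^esub> m"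
      using that by (subst M.smult_l_distr) (simp_all add: M.smult_one CM)
    then show ?thesis using that by (simp add: K.l_neg M.smult_l_null CM M.smult_closed M.M.a_comm)
  qed
  then have "abelian_group N"
    by (intro abelian_groupI) (auto simp: C C_add CM M.M.a_ac intro!: bexI[of _ "(\<ominus>\<^bsub>K\<^esub> \<one>\<^bsub>K\<^esub>) \<odot>\<^bsub>M\<^esub> _"] C_smult)
  moreover have "ring E"
    using enveloping_assoc_algebra by (simp add: assoc_algebra_def)
  moreover have "left_module_axioms E N"
    unfolding left_module_axioms_def enveloping_algebra_eq
    by (auto elim!: T.quotient_carrierE simp: env_module_smult pact_closed T.cls_add T.cls_mult
        pact_add pact_mult pact_add_r C_add T.one_eq_cls pair_one pact_basis act_one)
  ultimately show ?thesis by (simp add: left_module_def)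
qed

end

lemma (in assoc_algebra) ideal_bimodule_env_action:
  assumes "ideal J S"
  shows "env_action K S S J (\<lambda>p x. fst p \<otimes>\<^bsub>S\<^esub> x \<otimes>\<^bsub>S\<^esub> snd p)"
proof -
  interpret J: ideal J S by fact
  have [simp]: "x \<in> carrier S" if "x \<in> J" for x using that by simp
  show ?thesis
    by (intro env_action.intro env_action_axioms.intro assoc_algebra_axioms V.left_module_axioms)
      (auto simp: ideal_smult_closed[OF assms] J.I_l_closed J.I_r_closed S.l_distr S.r_distr
        smult_mult_l smult_mult_r V.smult_closed S.m_assoc)
qed

section \<open>Path algebras\<close>

lemma (in ring) fin_supp_restrict:
  assumes u: "u \<in> fin_supp R X" and v: "\<And>b. v b = u b \<or> v b = \<zero>"
  shows "v \<in> fin_supp R X"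
proof -
  have "v b \<in> carrier R" for b
    using v[of b] fin_suppD(1)[OF u, of b] by auto
  moreover have "v b = \<zero>" if "b \<notin> X" for b
    using v[of b] fin_suppD(3)[OF u] that by auto
  moreover have "{b. v b \<noteq> \<zero>} \<subseteq> {b. u b \<noteq> \<zero>}"
    using v by (auto; metis)
  then have "finite {b. v b \<noteq> \<zero>}"
    by (rule finite_subset) (rule fin_suppD(2)[OF u])
  ultimately show ?thesis by (simp add: fin_supp_def)
qed

text \<open>Serves to make the set equation in \<open>arrow_removal\<close> pointwise. The element c
  guarantees that the set of values is nonempty, on which the right-to-left direction rests.\<close>

lemma setcompr_eq_singleton_iff:
  assumes "c \<in> X"
  shows "{f x | x. x \<in> X} = {z} \<longleftrightarrow> (\<forall>x\<in>X. f x = z)"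
proof
  assume *: "{f x | x. x \<in> X} = {z}"
  show "\<forall>x\<in>X. f x = z"
  proof
    fix x assume "x \<in> X"
    then have "f x \<in> {f x | x. x \<in> X}" by blast
    then show "f x = z" unfolding * by simp
  qed
next
  assume *: "\<forall>x\<in>X. f x = z"
  have "{f x | x. x \<in> X} = f ` X" by blast
  also have "\<dots> = (\<lambda>_. z) ` X" using * by (intro image_cong) auto
  finally show "{f x | x. x \<in> X} = {z}" using assms by auto
qed

locale quiver_algebra = K: field K + Q: fin_digraph Q for K and Q
begin

abbreviation P where "P \<equiv> path_algebra K Q"
abbreviation pe where "pe p \<equiv> basis_elt K p"
abbreviation triv where "triv v \<equiv> (v, [], v)"
abbreviation arr where "arr a \<equiv> (tail Q a, [a], head Q a)"

lemma path_basis_product: "basis_product K (qpaths Q) (trivial_path ` verts Q) path_comp"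
proof (unfold_locales, goal_cases)
  case (1 b c d)
  then show ?case by (auto simp: qpaths_def split: if_splits)
next
  case (2 b c d)
  then show ?case by (cases b; cases c; cases d) auto
next
  case 3
  then show ?case by simp
next
  case 4
  then show ?case by (auto simp: qpaths_def trivial_path_def Q.awalk_Nil_iff)
next
  case (5 b)
  then show ?case by (auto simp: qpaths_def trivial_path_def intro: Q.awalkI)
next
  case (6 b)
  then show ?case by (auto simp: qpaths_def trivial_path_def intro: Q.awalkI)
qed

lemma path_assoc_algebra: "assoc_algebra K P"
  using basis_product.basis_algebra_assoc_algebra[OF path_basis_product] by (simp add: path_algebra_def)

end

sublocale quiver_algebra \<subseteq> P: assoc_algebra K "path_algebra K Q"
  by (rule path_assoc_algebra)

context quiver_algebra
begin

lemma P_carrier: "carrier P = fin_supp K (qpaths Q)"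
  by (simp add: path_algebra_def basis_algebra_def)

lemma P_add: "f \<oplus>\<^bsub>P\<^esub> g = (\<lambda>p. f p \<oplus>\<^bsub>K\<^esub> g p)"
  by (simp add: path_algebra_def basis_algebra_def)

lemma P_smult: "c \<odot>\<^bsub>P\<^esub> g = (\<lambda>p. c \<otimes>\<^bsub>K\<^esub> g p)"
  by (simp add: path_algebra_def basis_algebra_def)

lemma P_zero: "\<zero>\<^bsub>P\<^esub> = (\<lambda>p. \<zero>\<^bsub>K\<^esub>)"
  by (simp add: path_algebra_def basis_algebra_def)

lemma P_value [simp]: "z \<in> carrier P \<Longrightarrow> z p \<in> carrier K"
  by (simp add: P_carrier fin_suppD(1))

lemma P_minus:
  assumes "x \<in> carrier P" "y \<in> carrier P"
  shows "(x \<ominus>\<^bsub>P\<^esub> y) p = x p \<ominus>\<^bsub>K\<^esub> y p"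
proof -
  have "(x \<ominus>\<^bsub>P\<^esub> y) \<oplus>\<^bsub>P\<^esub> y = x"
    using assms by (simp add: P.S.minus_eq P.S.a_assoc P.S.l_neg)
  then have "(x \<ominus>\<^bsub>P\<^esub> y) p \<oplus>\<^bsub>K\<^esub> y p = x p"
    by (metis P_add)
  moreover have "(x \<ominus>\<^bsub>P\<^esub> y) p \<in> carrier K" using assms by simp
  ultimately show ?thesis
    using assms by (metis K.add.inv_solve_right K.minus_eq P_value)
qed

lemma pe_closed [simp]: "p \<in> qpaths Q \<Longrightarrow> pe p \<in> carrier P"
  by (simp add: P_carrier K.fin_supp_basis_elt)

lemma pe_mult:
  assumes "p \<in> qpaths Q" "q \<in> qpaths Q"
  shows "pe p \<otimes>\<^bsub>P\<^esub> pe q = (case path_comp p q of None \<Rightarrow> \<zero>\<^bsub>P\<^esub> | Some r \<Rightarrow> pe r)"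
  unfolding P_zero unfolding path_algebra_def
  by (rule basis_product.mult_basis[OF path_basis_product assms])

lemma qpaths_iff: "(u, p, v) \<in> qpaths Q \<longleftrightarrow> Q.awalk u p v"
  by (simp add: qpaths_def)

lemma triv_path [simp]: "triv v \<in> qpaths Q \<longleftrightarrow> v \<in> verts Q"
  by (simp add: qpaths_iff Q.awalk_Nil_iff)

lemma arr_path [simp]: "a \<in> arcs Q \<Longrightarrow> arr a \<in> qpaths Q"
  by (simp add: qpaths_iff Q.awalk_Cons_iff Q.awalk_Nil_iff)

lemma Cons_path_iff: "(u, a # p, v) \<in> qpaths Q \<longleftrightarrow> a \<in> arcs Q \<and> u = tail Q a \<and> (head Q a, p, v) \<in> qpaths Q"
  by (simp add: qpaths_iff Q.awalk_Cons_iff)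

lemma append_path: "(u, p, v) \<in> qpaths Q \<Longrightarrow> (v, q, w) \<in> qpaths Q \<Longrightarrow> (u, p @ q, w) \<in> qpaths Q"
  unfolding qpaths_iff by (rule Q.awalk_appendI)

lemma append_pathE:
  assumes "(u, p @ q, w) \<in> qpaths Q"
  obtains v where "(u, p, v) \<in> qpaths Q" "(v, q, w) \<in> qpaths Q"
  using assms by (auto simp: qpaths_iff)

lemma path_ends: "(u, p, v) \<in> qpaths Q \<Longrightarrow> u \<in> verts Q \<and> v \<in> verts Q"
  using Q.awalk_last_in_verts by (auto simp: qpaths_iff dest: Q.awalk_hd_in_verts)

lemma pe_append:
  "(u, p, v) \<in> qpaths Q \<Longrightarrow> (v, q, w) \<in> qpaths Q \<Longrightarrow> pe (u, p, v) \<otimes>\<^bsub>P\<^esub> pe (v, q, w) = pe (u, p @ q, w)"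
  by (simp add: pe_mult)

lemma pe_orth:
  "(u, p, v) \<in> qpaths Q \<Longrightarrow> (v', q, w) \<in> qpaths Q \<Longrightarrow> v \<noteq> v' \<Longrightarrow> pe (u, p, v) \<otimes>\<^bsub>P\<^esub> pe (v', q, w) = \<zero>\<^bsub>P\<^esub>"
  by (simp add: pe_mult)

lemma P_induct [consumes 1, case_names zero add]:
  assumes "f \<in> carrier P" "R \<zero>\<^bsub>P\<^esub>"
    and "\<And>g c u p v. g \<in> carrier P \<Longrightarrow> c \<in> carrier K \<Longrightarrow> (u, p, v) \<in> qpaths Q \<Longrightarrow> R g \<Longrightarrow>
      R (c \<odot>\<^bsub>P\<^esub> pe (u, p, v) \<oplus>\<^bsub>P\<^esub> g)"
  shows "R f"
  using assms(1) unfolding P_carrier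
proof (induction rule: K.fin_supp_induct)
  case zero
  then show ?case using assms(2) by (simp add: P_zero)
next
  case (add v a x)
  obtain u p w where "x = (u, p, w)" by (cases x)
  then show ?case using add assms(3)[of v a u p w] by (auto simp: P_add P_smult P_carrier)
qed

lemma P_one: "\<one>\<^bsub>P\<^esub> p = (if p \<in> triv ` verts Q then \<one>\<^bsub>K\<^esub> else \<zero>\<^bsub>K\<^esub>)"
  by (auto simp: path_algebra_def basis_algebra_def trivial_path_def)

text \<open>A composite is trivial only if both factors are trivial, so the coefficient at a trivial
  path is a character of the path algebra. Through this character an action can later be made
  trivial on one side.\<close>

lemma triv_coeff_mult:
  assumes x: "x \<in> carrier P" and y: "y \<in> carrier P"
  shows "(x \<otimes>\<^bsub>P\<^esub> y) (triv v) = x (triv v) \<otimes>\<^bsub>K\<^esub> y (triv v)"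
proof -
  have z: "\<zero>\<^bsub>P\<^esub> (triv v) = \<zero>\<^bsub>K\<^esub>" by (simp add: P_zero)
  have 1: "(pe p \<otimes>\<^bsub>P\<^esub> pe q) (triv v) = pe p (triv v) \<otimes>\<^bsub>K\<^esub> pe q (triv v)"
    if "p \<in> qpaths Q" "q \<in> qpaths Q" for p q
  proof -
    have "(pe p \<otimes>\<^bsub>P\<^esub> pe q) (triv v) = (case path_comp p q of None \<Rightarrow> \<zero>\<^bsub>K\<^esub> | Some r \<Rightarrow> pe r (triv v))"
      using that by (simp add: pe_mult z split: option.split)
    also have "\<dots> = pe p (triv v) \<otimes>\<^bsub>K\<^esub> pe q (triv v)"
      using that by (cases p; cases q) (auto simp: basis_elt_def qpaths_iff Q.awalk_Nil_iff)
    finally show ?thesis .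
  qed
  have 2: "(pe p \<otimes>\<^bsub>P\<^esub> y) (triv v) = pe p (triv v) \<otimes>\<^bsub>K\<^esub> y (triv v)" if p: "p \<in> qpaths Q" for p
    using y
  proof (induction rule: P_induct)
    case zero
    then show ?case using p by (simp add: z)
  next
    case (add g c u q w)
    let ?s = "pe p (triv v)" and ?t = "pe (u, q, w) (triv v)"
    have cl: "?s \<in> carrier K" "?t \<in> carrier K" using p add by simp_all
    have "(pe p \<otimes>\<^bsub>P\<^esub> (c \<odot>\<^bsub>P\<^esub> pe (u, q, w) \<oplus>\<^bsub>P\<^esub> g)) (triv v) =
        c \<otimes>\<^bsub>K\<^esub> (pe p \<otimes>\<^bsub>P\<^esub> pe (u, q, w)) (triv v) \<oplus>\<^bsub>K\<^esub> (pe p \<otimes>\<^bsub>P\<^esub> g) (triv v)"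
      using p add by (simp add: P.S.r_distr P.smult_mult_r P.V.smult_closed) (simp add: P_add P_smult)
    also have "\<dots> = ?s \<otimes>\<^bsub>K\<^esub> (c \<otimes>\<^bsub>K\<^esub> ?t \<oplus>\<^bsub>K\<^esub> g (triv v))"
      using cl add by (simp add: 1 p K.r_distr K.m_lcomm)
    finally show ?case by (simp add: P_add P_smult)
  qed
  show ?thesis
    using x
  proof (induction rule: P_induct)
    case zero
    then show ?case using y by (simp add: z)
  next
    case (add g c u q w)
    let ?t = "pe (u, q, w) (triv v)"
    have cl: "?t \<in> carrier K" using add by simp
    have "((c \<odot>\<^bsub>P\<^esub> pe (u, q, w) \<oplus>\<^bsub>P\<^esub> g) \<otimes>\<^bsub>P\<^esub> y) (triv v) =
        c \<otimes>\<^bsub>K\<^esub> (pe (u, q, w) \<otimes>\<^bsub>P\<^esub> y) (triv v) \<oplus>\<^bsub>K\<^esub> (g \<otimes>\<^bsub>P\<^esub> y) (triv v)"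
      using y add by (simp add: P.S.l_distr P.smult_mult_l P.V.smult_closed) (simp add: P_add P_smult)
    also have "\<dots> = (c \<otimes>\<^bsub>K\<^esub> ?t \<oplus>\<^bsub>K\<^esub> g (triv v)) \<otimes>\<^bsub>K\<^esub> y (triv v)"
      using cl add y by (simp add: 2 K.l_distr K.m_assoc)
    finally show ?case by (simp add: P_add P_smult)
  qed
qed

subsection \<open>The parts through and avoiding a set of arrows\<close>

lemma part_zero [simp]: "part_through K A \<zero>\<^bsub>P\<^esub> = \<zero>\<^bsub>P\<^esub>"
  by (simp add: part_through_def P_zero)

lemma part_closed [simp]:
  assumes "z \<in> carrier P"
  shows "part_through K A z \<in> carrier P" "part_avoiding K A z \<in> carrier P"
  using assms unfolding P_carrier part_through_def part_avoiding_def
  by (rule K.fin_supp_restrict; simp)+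

lemma part_add: "part_through K A (x \<oplus>\<^bsub>P\<^esub> y) = part_through K A x \<oplus>\<^bsub>P\<^esub> part_through K A y"
  by (auto simp: part_through_def P_add)

lemma part_smult: "c \<in> carrier K \<Longrightarrow> part_through K A (c \<odot>\<^bsub>P\<^esub> x) = c \<odot>\<^bsub>P\<^esub> part_through K A x"
  by (auto simp: part_through_def P_smult)

lemma part_basis: "part_through K A (pe p) = (if path_avoids A p then \<zero>\<^bsub>P\<^esub> else pe p)"
  by (auto simp: part_through_def basis_elt_def P_zero)

lemma part_sum: "z \<in> carrier P \<Longrightarrow> part_through K A z \<oplus>\<^bsub>P\<^esub> part_avoiding K A z = z"
  by (auto simp: part_through_def part_avoiding_def P_add)

lemma part_avoiding_eq: "z \<in> carrier P \<Longrightarrow> part_avoiding K A z = z \<ominus>\<^bsub>P\<^esub> part_through K A z"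
  by (rule ext, subst P_minus, simp, simp, auto simp: part_through_def part_avoiding_def K.minus_eq K.r_neg)

lemma avoids_append [simp]:
  "path_avoids A (u, p @ q, v) \<longleftrightarrow> set p \<inter> A = {} \<and> set q \<inter> A = {}"
  by (auto simp: path_avoids_def)

text \<open>A composite avoids A exactly when both factors do. If q already meets A, then so does
  every path in the product, and the projection leaves it unchanged.\<close>

lemma part_mult_r:
  assumes z: "z \<in> carrier P" and q: "q \<in> qpaths Q"
  shows "part_through K A (z \<otimes>\<^bsub>P\<^esub> pe q) =
    (if path_avoids A q then part_through K A z \<otimes>\<^bsub>P\<^esub> pe q else z \<otimes>\<^bsub>P\<^esub> pe q)"
  using z
proof (induction rule: P_induct)
  case zero
  then show ?case using q by simp
next
  case (add g c u p v)
  have "part_through K A (pe (u, p, v) \<otimes>\<^bsub>P\<^esub> pe q) =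
    (if path_avoids A q then part_through K A (pe (u, p, v)) \<otimes>\<^bsub>P\<^esub> pe q else pe (u, p, v) \<otimes>\<^bsub>P\<^esub> pe q)"
    using add q by (cases q) (auto simp: pe_mult part_basis path_avoids_def)
  then show ?case using add q
    by (auto simp: P.S.l_distr P.smult_mult_l P.V.smult_closed part_add part_smult)
qed

lemma part_mult_l:
  assumes z: "z \<in> carrier P" and q: "q \<in> qpaths Q"
  shows "part_through K A (pe q \<otimes>\<^bsub>P\<^esub> z) =
    (if path_avoids A q then pe q \<otimes>\<^bsub>P\<^esub> part_through K A z else pe q \<otimes>\<^bsub>P\<^esub> z)"
  using z
proof (induction rule: P_induct)
  case zero
  then show ?case using q by simp
next
  case (add g c u p v)
  have "part_through K A (pe q \<otimes>\<^bsub>P\<^esub> pe (u, p, v)) =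
    (if path_avoids A q then pe q \<otimes>\<^bsub>P\<^esub> part_through K A (pe (u, p, v)) else pe q \<otimes>\<^bsub>P\<^esub> pe (u, p, v))"
    using add q by (cases q) (auto simp: pe_mult part_basis path_avoids_def)
  then show ?case using add q
    by (auto simp: P.S.r_distr P.smult_mult_r P.V.smult_closed part_add part_smult)
qed

text \<open>The elements of the ideal whose part through A stays in the ideal form an ideal
  themselves, and generators have no part through A at all. Membership of z itself is kept in
  \<open>?Z\<close>, since for a path q meeting A the part of z q through A is all of z q.\<close>

lemma pre_removable_if_generated:
  assumes G: "G \<subseteq> carrier P" and av: "\<forall>z\<in>G. \<forall>p. z p \<noteq> \<zero>\<^bsub>K\<^esub> \<longrightarrow> path_avoids A p"
  shows "pre_removable K (Idl\<^bsub>P\<^esub> G) A"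
proof -
  let ?I = "Idl\<^bsub>P\<^esub> G"
  interpret I: ideal ?I P by (rule P.S.genideal_ideal[OF G])
  let ?Z = "{z \<in> ?I. part_through K A z \<in> ?I}"
  note [simp] = P.V.smult_closed P.ideal_smult_closed[OF I.is_ideal]
  have r: "z \<otimes>\<^bsub>P\<^esub> x \<in> ?Z" if "z \<in> ?Z" "x \<in> carrier P" for z x
  proof -
    have "part_through K A (z \<otimes>\<^bsub>P\<^esub> x) \<in> ?I" using that(2)
    proof (induction rule: P_induct)
      case zero
      then show ?case using that by simp
    next
      case (add g c u p v)
      then show ?case using that
        by (auto simp: P.S.r_distr P.smult_mult_r part_add part_smult part_mult_r I.I_r_closed)
    qed
    then show ?thesis using that by (simp add: I.I_r_closed)
  qed
  have l: "x \<otimes>\<^bsub>P\<^esub> z \<in> ?Z" if "z \<in> ?Z" "x \<in> carrier P" for z x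
  proof -
    have "part_through K A (x \<otimes>\<^bsub>P\<^esub> z) \<in> ?I" using that(2)
    proof (induction rule: P_induct)
      case zero
      then show ?case using that by simp
    next
      case (add g c u p v)
      then show ?case using that
        by (auto simp: P.S.l_distr P.smult_mult_l part_add part_smult part_mult_l I.I_l_closed)
    qed
    then show ?thesis using that by (simp add: I.I_l_closed)
  qed
  have "ideal ?Z P"
    by (rule P.S.idealI'[OF _ _ _ l r]) (auto simp: part_add)
  moreover have "G \<subseteq> ?Z"
  proof
    fix z assume z: "z \<in> G"
    then have "part_through K A z = \<zero>\<^bsub>P\<^esub>"
      unfolding part_through_def P_zero using av by metis
    then show "z \<in> ?Z" using z P.S.genideal_self[OF G] by auto
  qed
  ultimately have Z: "part_through K A z \<in> ?I" if "z \<in> ?I" for z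
    using P.S.genideal_minimal[of ?Z G] that by blast
  moreover have "part_avoiding K A z \<in> ?I" if "z \<in> ?I" for z
    using that Z[OF that] by (simp add: part_avoiding_eq P.S.minus_eq)
  ultimately show ?thesis by (simp add: pre_removable_def)
qed

end

section \<open>Bound quiver algebras\<close>

locale quiver_ideal = quiver_algebra K Q + I: ideal I "path_algebra K Q" for K and Q and I

sublocale quiver_ideal \<subseteq> algebra_ideal K "path_algebra K Q" I
  by unfold_locales

context quiver_ideal
begin

abbreviation pc where "pc p \<equiv> cls (pe p)"

lemma bound_quiver_algebra_eq: "bound_quiver_algebra K Q I = L"
  by (simp add: bound_quiver_algebra_def)

lemma path_class_eq: "path_class K Q I p = pc p"
  by (simp add: path_class_def)

lemma pc_append:
  "(u, p, v) \<in> qpaths Q \<Longrightarrow> (v, q, w) \<in> qpaths Q \<Longrightarrow> pc (u, p, v) \<otimes>\<^bsub>L\<^esub> pc (v, q, w) = pc (u, p @ q, w)"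
  by (simp add: cls_mult pe_append)

lemma pc_orth:
  "(u, p, v) \<in> qpaths Q \<Longrightarrow> (v', q, w) \<in> qpaths Q \<Longrightarrow> v \<noteq> v' \<Longrightarrow> pc (u, p, v) \<otimes>\<^bsub>L\<^esub> pc (v', q, w) = \<zero>\<^bsub>L\<^esub>"
  by (simp add: cls_mult pe_orth zero_eq_cls)

lemma arrow_ideal_eq: "arrow_ideal K Q I A = Idl\<^bsub>L\<^esub> ((\<lambda>a. pc (arr a)) ` A)"
  by (simp add: arrow_ideal_def bound_quiver_algebra_eq path_class_eq arrow_path_def)

lemma arrow_ideal_ideal: "A \<subseteq> arcs Q \<Longrightarrow> ideal (arrow_ideal K Q I A) L"
  unfolding arrow_ideal_eq by (intro L.S.genideal_ideal) (auto simp: subset_iff)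

lemma arrow_in_arrow_ideal: "A \<subseteq> arcs Q \<Longrightarrow> a \<in> A \<Longrightarrow> pc (arr a) \<in> arrow_ideal K Q I A"
  unfolding arrow_ideal_eq
  by (rule subsetD[OF L.S.genideal_self]) auto

lemma arrow_ideal_minimal:
  "ideal Z L \<Longrightarrow> (\<And>a. a \<in> A \<Longrightarrow> pc (arr a) \<in> Z) \<Longrightarrow> arrow_ideal K Q I A \<subseteq> Z"
  unfolding arrow_ideal_eq by (rule L.S.genideal_minimal) auto

lemma corner_condition_iff:
  "{path_class K Q I (trivial_path u) \<otimes>\<^bsub>L\<^esub> x \<otimes>\<^bsub>L\<^esub> path_class K Q I (trivial_path v) | x.
      x \<in> carrier L} = {\<zero>\<^bsub>L\<^esub>} \<longleftrightarrow>
    (\<forall>x\<in>carrier L. pc (triv u) \<otimes>\<^bsub>L\<^esub> x \<otimes>\<^bsub>L\<^esub> pc (triv v) = \<zero>\<^bsub>L\<^esub>)"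
  unfolding path_class_eq trivial_path_def
  by (rule setcompr_eq_singleton_iff[OF L.S.zero_closed])

end

lemma ideal_bimodule_fields [simp]:
  "carrier (ideal_bimodule K S J) = J" "add (ideal_bimodule K S J) = add S"
  "zero (ideal_bimodule K S J) = zero S"
  by (simp_all add: ideal_bimodule_def)

lemma (in assoc_algebra) left_module_ideal_bimodule:
  "ideal J S \<Longrightarrow> left_module E (ideal_bimodule K S J)"
  unfolding ideal_bimodule_eq_env_module
  by (rule env_action.left_module_env_module[OF ideal_bimodule_env_action])

lemma (in assoc_algebra) ideal_bimodule_tens:
  "ideal J S \<Longrightarrow> x \<in> carrier S \<Longrightarrow> y \<in> carrier S \<Longrightarrow> z \<in> J \<Longrightarrow>
    tens x y \<odot>\<^bsub>ideal_bimodule K S J\<^esub> z = x \<otimes>\<^bsub>S\<^esub> z \<otimes>\<^bsub>S\<^esub> y"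
  unfolding ideal_bimodule_eq_env_module
  by (subst env_action.env_module_tens[OF ideal_bimodule_env_action]) auto


section \<open>Abstract bimodules and their underlying vector spaces\<close>

locale env_left_module = S: assoc_algebra K S + M: left_module "enveloping_algebra K S" M for K and S and M
begin

abbreviation tens where "tens \<equiv> pure_tensor K S"

lemma tens_tens:
  assumes "x \<in> carrier S" "y \<in> carrier S" "x' \<in> carrier S" "y' \<in> carrier S" "w \<in> carrier M"
  shows "tens x y \<odot>\<^bsub>M\<^esub> (tens x' y' \<odot>\<^bsub>M\<^esub> w) = tens (x \<otimes>\<^bsub>S\<^esub> x') (y' \<otimes>\<^bsub>S\<^esub> y) \<odot>\<^bsub>M\<^esub> w"
  using assms by (simp add: M.smult_assoc[symmetric] S.tens_mult)

lemma tens_act_closed [simp]: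
  "x \<in> carrier S \<Longrightarrow> y \<in> carrier S \<Longrightarrow> w \<in> carrier M \<Longrightarrow> tens x y \<odot>\<^bsub>M\<^esub> w \<in> carrier M"
  by (simp add: M.smult_closed)

lemma tens_one_act [simp]: "w \<in> carrier M \<Longrightarrow> tens \<one>\<^bsub>S\<^esub> \<one>\<^bsub>S\<^esub> \<odot>\<^bsub>M\<^esub> w = w"
  by (simp add: S.tens_one[symmetric] M.smult_one)

lemma tens_act_add:
  "\<lbrakk>x \<in> carrier S; y \<in> carrier S; w \<in> carrier M; w' \<in> carrier M\<rbrakk> \<Longrightarrow>
    tens x y \<odot>\<^bsub>M\<^esub> (w \<oplus>\<^bsub>M\<^esub> w') = tens x y \<odot>\<^bsub>M\<^esub> w \<oplus>\<^bsub>M\<^esub> tens x y \<odot>\<^bsub>M\<^esub> w'"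
  by (simp add: M.smult_r_distr)

lemma tens_act_zero [simp]: "x \<in> carrier S \<Longrightarrow> y \<in> carrier S \<Longrightarrow> tens x y \<odot>\<^bsub>M\<^esub> \<zero>\<^bsub>M\<^esub> = \<zero>\<^bsub>M\<^esub>"
  by (simp add: M.smult_r_null)

text \<open>Linear extension along the basis of paths takes coefficients in K, while M as given has
  scalars from the enveloping algebra only.\<close>

definition kM where "kM = \<lparr>carrier = carrier M, mult = mult M, one = one M, zero = zero M, add = add M,
  smult = (\<lambda>c w. tens (c \<odot>\<^bsub>S\<^esub> \<one>\<^bsub>S\<^esub>) \<one>\<^bsub>S\<^esub> \<odot>\<^bsub>M\<^esub> w)\<rparr>"

lemma kM_fields [simp]: "carrier kM = carrier M" "zero kM = zero M" "add kM = add M"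
  by (simp_all add: kM_def)

lemma kM_smult: "c \<odot>\<^bsub>kM\<^esub> w = tens (c \<odot>\<^bsub>S\<^esub> \<one>\<^bsub>S\<^esub>) \<one>\<^bsub>S\<^esub> \<odot>\<^bsub>M\<^esub> w"
  by (simp add: kM_def)

lemma left_module_kM: "left_module K kM"
proof -
  have "abelian_group kM"
    by (intro abelian_groupI) (auto simp: M.M.a_ac intro!: bexI[of _ "\<ominus>\<^bsub>M\<^esub> _"] M.M.l_neg M.M.r_neg)
  moreover have "(c \<otimes>\<^bsub>K\<^esub> d) \<odot>\<^bsub>S\<^esub> \<one>\<^bsub>S\<^esub> = (c \<odot>\<^bsub>S\<^esub> \<one>\<^bsub>S\<^esub>) \<otimes>\<^bsub>S\<^esub> (d \<odot>\<^bsub>S\<^esub> \<one>\<^bsub>S\<^esub>)"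
    if "c \<in> carrier K" "d \<in> carrier K" for c d
    using that by (simp add: S.smult_mult_l S.V.smult_assoc S.V.smult_closed)
  then have "left_module_axioms K kM"
    by (auto simp: left_module_axioms_def kM_smult tens_tens S.V.smult_closed tens_act_add
        S.V.smult_l_distr S.tens_add_l M.smult_l_distr S.V.smult_one)
  ultimately show ?thesis by (simp add: left_module_def S.K.ring_axioms)
qed

end

sublocale env_left_module \<subseteq> kM: left_module K kM
  by (rule left_module_kM)

context env_left_module
begin

lemma tens_smult_act:
  assumes "c \<in> carrier K" "x \<in> carrier S" "y \<in> carrier S" "w \<in> carrier M"
  shows "tens (c \<odot>\<^bsub>S\<^esub> x) y \<odot>\<^bsub>M\<^esub> w = c \<odot>\<^bsub>kM\<^esub> (tens x y \<odot>\<^bsub>M\<^esub> w)"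
    and "tens x (c \<odot>\<^bsub>S\<^esub> y) \<odot>\<^bsub>M\<^esub> w = c \<odot>\<^bsub>kM\<^esub> (tens x y \<odot>\<^bsub>M\<^esub> w)"
    and "tens x y \<odot>\<^bsub>M\<^esub> (c \<odot>\<^bsub>kM\<^esub> w) = c \<odot>\<^bsub>kM\<^esub> (tens x y \<odot>\<^bsub>M\<^esub> w)"
proof -
  have "tens x (c \<odot>\<^bsub>S\<^esub> y) = tens (c \<odot>\<^bsub>S\<^esub> x) y"
    using assms by (simp add: S.tens_smult_l S.tens_smult_r)
  then show "tens (c \<odot>\<^bsub>S\<^esub> x) y \<odot>\<^bsub>M\<^esub> w = c \<odot>\<^bsub>kM\<^esub> (tens x y \<odot>\<^bsub>M\<^esub> w)"
    "tens x (c \<odot>\<^bsub>S\<^esub> y) \<odot>\<^bsub>M\<^esub> w = c \<odot>\<^bsub>kM\<^esub> (tens x y \<odot>\<^bsub>M\<^esub> w)"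
    "tens x y \<odot>\<^bsub>M\<^esub> (c \<odot>\<^bsub>kM\<^esub> w) = c \<odot>\<^bsub>kM\<^esub> (tens x y \<odot>\<^bsub>M\<^esub> w)"
    using assms by (simp_all add: kM_smult tens_tens S.V.smult_closed S.smult_mult_l S.smult_mult_r)
qed

lemma kM_add: "c \<in> carrier K \<Longrightarrow> w \<in> carrier M \<Longrightarrow> w' \<in> carrier M \<Longrightarrow>
    c \<odot>\<^bsub>kM\<^esub> (w \<oplus>\<^bsub>M\<^esub> w') = c \<odot>\<^bsub>kM\<^esub> w \<oplus>\<^bsub>M\<^esub> c \<odot>\<^bsub>kM\<^esub> w'"
  using kM.smult_r_distr[of c w w'] by simp

lemma kM_closed [simp]: "c \<in> carrier K \<Longrightarrow> w \<in> carrier M \<Longrightarrow> c \<odot>\<^bsub>kM\<^esub> w \<in> carrier M"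
  using kM.smult_closed[of c w] by simp

lemma kM_zero [simp]: "c \<in> carrier K \<Longrightarrow> c \<odot>\<^bsub>kM\<^esub> \<zero>\<^bsub>M\<^esub> = \<zero>\<^bsub>M\<^esub>"
  using kM.smult_r_null[of c] by simp

lemma env_zero_act [simp]: "w \<in> carrier M \<Longrightarrow> \<zero>\<^bsub>S.E\<^esub> \<odot>\<^bsub>M\<^esub> w = \<zero>\<^bsub>M\<^esub>"
  by (rule M.smult_l_null)

end

section \<open>Projectivity from an arrow removal\<close>

locale arrow_derivation = quiver_ideal K Q I +
  env_left_module K "quotient_algebra (path_algebra K Q) I" M
  for K :: "('k, 'c) ring_scheme" and Q :: "('v, 'a) pre_digraph" and I
    and M :: "(_, 'm, 'e) module_scheme" +
  fixes A and m
  assumes A: "A \<subseteq> arcs Q"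
    and m_closed: "a \<in> A \<Longrightarrow> m a \<in> carrier M"
    and m_corner: "a \<in> A \<Longrightarrow> pure_tensor K (quotient_algebra (path_algebra K Q) I)
      (pc (triv (tail Q a))) (pc (triv (head Q a))) \<odot>\<^bsub>M\<^esub> m a = m a"
begin

text \<open>The derivation of the path algebra with \<open>a \<mapsto> m a\<close> for \<open>a \<in> A\<close>, annihilating the other
  arrows: a path goes to the sum of its factorisations \<open>p' (m a) p''\<close> at the arrows \<open>a\<close> of \<open>A\<close>.\<close>

primrec der where
  "der [] v = \<zero>\<^bsub>M\<^esub>"
| "der (a # p) v =
    (if a \<in> A then L.tens (pc (triv (tail Q a))) (pc (head Q a, p, v)) \<odot>\<^bsub>M\<^esub> m a else \<zero>\<^bsub>M\<^esub>)
    \<oplus>\<^bsub>M\<^esub> L.tens (pc (arr a)) \<one>\<^bsub>L\<^esub> \<odot>\<^bsub>M\<^esub> der p v"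

lemma der_closed [simp]: "(u, p, v) \<in> qpaths Q \<Longrightarrow> der p v \<in> carrier M"
  by (induction p arbitrary: u) (auto simp: Cons_path_iff m_closed)

text \<open>Together with \<open>der_unit_r\<close> this places the value at a path from u to v in
  the corner e_u M e_v, which is what saves the Leibniz rule for paths that cannot be
  composed.\<close>

lemma der_unit_l: "(u, p, v) \<in> qpaths Q \<Longrightarrow> L.tens (pc (triv u)) \<one>\<^bsub>L\<^esub> \<odot>\<^bsub>M\<^esub> der p v = der p v"
proof (cases p)
  case (Cons a p')
  assume "(u, p, v) \<in> qpaths Q"
  then show ?thesis using Cons pc_append[of "tail Q a" "[]" "tail Q a" "[]" "tail Q a"]
      pc_append[of "tail Q a" "[]" "tail Q a" "[a]" "head Q a"]
    by (auto simp: Cons_path_iff m_closed tens_act_add tens_tens)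
qed (use path_ends in auto)

lemma der_unit_r: "(u, p, v) \<in> qpaths Q \<Longrightarrow> L.tens \<one>\<^bsub>L\<^esub> (pc (triv v)) \<odot>\<^bsub>M\<^esub> der p v = der p v"
proof (induction p arbitrary: u)
  case Nil
  then show ?case using path_ends by auto
next
  case (Cons a p)
  then have p: "a \<in> arcs Q" "(head Q a, p, v) \<in> qpaths Q" "v \<in> verts Q"
    using path_ends by (auto simp: Cons_path_iff)
  have "L.tens \<one>\<^bsub>L\<^esub> (pc (triv v)) \<odot>\<^bsub>M\<^esub> (L.tens (pc (arr a)) \<one>\<^bsub>L\<^esub> \<odot>\<^bsub>M\<^esub> der p v) =
    L.tens (pc (arr a)) \<one>\<^bsub>L\<^esub> \<odot>\<^bsub>M\<^esub> (L.tens \<one>\<^bsub>L\<^esub> (pc (triv v)) \<odot>\<^bsub>M\<^esub> der p v)"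
    using p by (simp add: tens_tens)
  also have "\<dots> = L.tens (pc (arr a)) \<one>\<^bsub>L\<^esub> \<odot>\<^bsub>M\<^esub> der p v"
    using Cons.IH p by simp
  finally show ?case
    using p pc_append[of "head Q a" p v "[]" v]
    by (auto simp: m_closed tens_act_add) (simp add: tens_tens m_closed)
qed

text \<open>The Leibniz rule: the distinguished arrow in a factorisation of the composite lies
  either in p or in q.\<close>

lemma der_append:
  assumes "(u, p, v) \<in> qpaths Q" and q: "(v, q, w) \<in> qpaths Q"
  shows "der (p @ q) w = L.tens \<one>\<^bsub>L\<^esub> (pc (v, q, w)) \<odot>\<^bsub>M\<^esub> der p v \<oplus>\<^bsub>M\<^esub> L.tens (pc (u, p, v)) \<one>\<^bsub>L\<^esub> \<odot>\<^bsub>M\<^esub> der q w"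
  using assms(1)
proof (induction p arbitrary: u)
  case Nil
  then have "u = v" by (simp add: qpaths_iff Q.awalk_Nil_iff)
  then show ?case using q der_unit_l[OF q] by simp
next
  case (Cons a p)
  then have p: "a \<in> arcs Q" "(head Q a, p, v) \<in> qpaths Q" "u = tail Q a"
    by (auto simp: Cons_path_iff)
  note cl = append_path[OF p(2) q]
  have 1: "pc (arr a) \<otimes>\<^bsub>L\<^esub> pc (head Q a, p, v) = pc (tail Q a, a # p, v)"
    using pc_append[of "tail Q a" "[a]" "head Q a" p v] p by simp
  have 2: "pc (head Q a, p, v) \<otimes>\<^bsub>L\<^esub> pc (v, q, w) = pc (head Q a, p @ q, w)"
    using pc_append p q by simp
  let ?h = "pc (head Q a, p, v)"
  have "L.tens (pc (arr a)) \<one>\<^bsub>L\<^esub> \<odot>\<^bsub>M\<^esub> der (p @ q) w =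
    L.tens (pc (arr a)) (pc (v, q, w)) \<odot>\<^bsub>M\<^esub> der p v \<oplus>\<^bsub>M\<^esub> L.tens (pc (tail Q a, a # p, v)) \<one>\<^bsub>L\<^esub> \<odot>\<^bsub>M\<^esub> der q w"
    using p q by (simp add: Cons.IH tens_act_add tens_tens 1[symmetric])
  moreover have "L.tens \<one>\<^bsub>L\<^esub> (pc (v, q, w)) \<odot>\<^bsub>M\<^esub> der (a # p) v =
    (if a \<in> A then L.tens (pc (triv (tail Q a))) (pc (head Q a, p @ q, w)) \<odot>\<^bsub>M\<^esub> m a else \<zero>\<^bsub>M\<^esub>)
    \<oplus>\<^bsub>M\<^esub> L.tens (pc (arr a)) (pc (v, q, w)) \<odot>\<^bsub>M\<^esub> der p v"
    using p q by (auto simp: tens_act_add tens_tens 2[symmetric] m_closed)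
  moreover have "pc (tail Q a, a # p, v) \<in> carrier L"
    using Cons.prems p by simp
  ultimately show ?case
    using p q cl by (auto simp: m_closed M.M.a_assoc)
qed

definition D :: "(('v, 'a) qpath \<Rightarrow> 'k) \<Rightarrow> 'm" where "D = lin_ext K kM (\<lambda>(u, p, v). der p v)"

lemma der_Pi: "(\<lambda>(u, p, v). der p v) \<in> Pi (qpaths Q) (\<lambda>_. carrier kM)"
  by auto

lemma D_hom: "D \<in> lmod_hom K P kM"
  using kM.lin_ext_hom[OF der_Pi, of "trivial_path ` verts Q" path_comp]
  unfolding D_def path_algebra_def[symmetric] .

lemma D_closed [simp]: "z \<in> carrier P \<Longrightarrow> D z \<in> carrier M"
  using D_hom by (auto simp: lmod_hom_def)

lemma D_add: "x \<in> carrier P \<Longrightarrow> y \<in> carrier P \<Longrightarrow> D (x \<oplus>\<^bsub>P\<^esub> y) = D x \<oplus>\<^bsub>M\<^esub> D y"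
  using D_hom by (auto simp: lmod_hom_def)

lemma D_smult: "c \<in> carrier K \<Longrightarrow> x \<in> carrier P \<Longrightarrow> D (c \<odot>\<^bsub>P\<^esub> x) = c \<odot>\<^bsub>kM\<^esub> D x"
  using D_hom by (auto simp: lmod_hom_def)

lemma D_zero [simp]: "D \<zero>\<^bsub>P\<^esub> = \<zero>\<^bsub>M\<^esub>"
  by (simp add: D_def P_zero lin_ext_def)

lemma D_pe: "(u, p, v) \<in> qpaths Q \<Longrightarrow> D (pe (u, p, v)) = der p v"
  unfolding D_def using kM.lin_ext_basis_elt[OF _ der_Pi] by simp

lemma D_mult_paths:
  assumes p: "(u, p, v) \<in> qpaths Q" and q: "(v', q, w) \<in> qpaths Q"
  shows "D (pe (u, p, v) \<otimes>\<^bsub>P\<^esub> pe (v', q, w)) =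
    L.tens \<one>\<^bsub>L\<^esub> (pc (v', q, w)) \<odot>\<^bsub>M\<^esub> D (pe (u, p, v)) \<oplus>\<^bsub>M\<^esub>
    L.tens (pc (u, p, v)) \<one>\<^bsub>L\<^esub> \<odot>\<^bsub>M\<^esub> D (pe (v', q, w))"
proof (cases "v = v'")
  case True
  then show ?thesis using p q append_path[of u p v q w] by (simp add: pe_append D_pe der_append)
next
  case False
  \<comment> \<open>The product is zero here, so both Leibniz terms have to vanish. Inserting the
    idempotents at v and v', which fix the two derivatives, creates a product of orthogonal paths in
    each term.\<close>
  have v: "v \<in> verts Q" "v' \<in> verts Q" using path_ends p q by auto
  have "L.tens \<one>\<^bsub>L\<^esub> (pc (v', q, w)) \<odot>\<^bsub>M\<^esub> der p v =
    L.tens \<one>\<^bsub>L\<^esub> (pc (v', q, w)) \<odot>\<^bsub>M\<^esub> (L.tens \<one>\<^bsub>L\<^esub> (pc (triv v)) \<odot>\<^bsub>M\<^esub> der p v)"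
    using der_unit_r p by simp
  also have "\<dots> = \<zero>\<^bsub>M\<^esub>"
    using p q v pc_orth[of v "[]" v v' q w] False by (simp add: tens_tens)
  finally have 1: "L.tens \<one>\<^bsub>L\<^esub> (pc (v', q, w)) \<odot>\<^bsub>M\<^esub> der p v = \<zero>\<^bsub>M\<^esub>" .
  have "L.tens (pc (u, p, v)) \<one>\<^bsub>L\<^esub> \<odot>\<^bsub>M\<^esub> der q w =
    L.tens (pc (u, p, v)) \<one>\<^bsub>L\<^esub> \<odot>\<^bsub>M\<^esub> (L.tens (pc (triv v')) \<one>\<^bsub>L\<^esub> \<odot>\<^bsub>M\<^esub> der q w)"
    using der_unit_l q by simp
  also have "\<dots> = \<zero>\<^bsub>M\<^esub>"
    using p q v pc_orth[of u p v v' "[]" v'] False by (simp add: tens_tens)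
  finally show ?thesis using 1 p q False by (simp add: pe_orth D_pe)
qed

lemma D_mult:
  assumes x: "x \<in> carrier P" and y: "y \<in> carrier P"
  shows "D (x \<otimes>\<^bsub>P\<^esub> y) = L.tens \<one>\<^bsub>L\<^esub> (cls y) \<odot>\<^bsub>M\<^esub> D x \<oplus>\<^bsub>M\<^esub> L.tens (cls x) \<one>\<^bsub>L\<^esub> \<odot>\<^bsub>M\<^esub> D y"
proof -
  have 1: "D (pe (u, p, v) \<otimes>\<^bsub>P\<^esub> y) = L.tens \<one>\<^bsub>L\<^esub> (cls y) \<odot>\<^bsub>M\<^esub> D (pe (u, p, v)) \<oplus>\<^bsub>M\<^esub>
      L.tens (pc (u, p, v)) \<one>\<^bsub>L\<^esub> \<odot>\<^bsub>M\<^esub> D y" if p: "(u, p, v) \<in> qpaths Q" for u p v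
    using y
  proof (induction rule: P_induct)
    case zero
    then show ?case using p by (simp add: zero_eq_cls[symmetric])
  next
    case (add g c v' q w)
    have "D (pe (u, p, v) \<otimes>\<^bsub>P\<^esub> (c \<odot>\<^bsub>P\<^esub> pe (v', q, w) \<oplus>\<^bsub>P\<^esub> g)) =
      c \<odot>\<^bsub>kM\<^esub> D (pe (u, p, v) \<otimes>\<^bsub>P\<^esub> pe (v', q, w)) \<oplus>\<^bsub>M\<^esub> D (pe (u, p, v) \<otimes>\<^bsub>P\<^esub> g)"
      using add p by (simp add: P.S.r_distr P.smult_mult_r P.V.smult_closed D_add D_smult)
    then show ?case
      using add p by (simp add: D_mult_paths cls_lincomb L.tens_add_r M.smult_l_distr tens_smult_act
          D_add D_smult L.V.smult_closed P.V.smult_closed tens_act_add kM_add M.M.a_ac)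
  qed
  show ?thesis
    using x
  proof (induction rule: P_induct)
    case zero
    then show ?case using y by (simp add: zero_eq_cls[symmetric])
  next
    case (add g c u p v)
    have "D ((c \<odot>\<^bsub>P\<^esub> pe (u, p, v) \<oplus>\<^bsub>P\<^esub> g) \<otimes>\<^bsub>P\<^esub> y) =
      c \<odot>\<^bsub>kM\<^esub> D (pe (u, p, v) \<otimes>\<^bsub>P\<^esub> y) \<oplus>\<^bsub>M\<^esub> D (g \<otimes>\<^bsub>P\<^esub> y)"
      using add y by (simp add: P.S.l_distr P.smult_mult_l P.V.smult_closed D_add D_smult)
    then show ?case
      using add y by (simp add: 1 cls_lincomb L.tens_add_l M.smult_l_distr tens_smult_act
          D_add D_smult L.V.smult_closed P.V.smult_closed tens_act_add kM_add M.M.a_ac)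
  qed
qed

lemma der_avoiding: "(u, p, v) \<in> qpaths Q \<Longrightarrow> set p \<inter> A = {} \<Longrightarrow> der p v = \<zero>\<^bsub>M\<^esub>"
  by (induction p arbitrary: u) (auto simp: Cons_path_iff)

text \<open>Elements of I act as zero on M, so by the Leibniz rule those of them killed by
  \<open>D\<close> form an ideal. A generator is killed because the derivation vanishes on every
  path that avoids A.\<close>

lemma D_ideal:
  assumes G: "G \<subseteq> carrier P" "I = Idl\<^bsub>P\<^esub> G"
    and av: "\<forall>z\<in>G. \<forall>p. z p \<noteq> \<zero>\<^bsub>K\<^esub> \<longrightarrow> path_avoids A p"
    and z: "z \<in> I"
  shows "D z = \<zero>\<^bsub>M\<^esub>"
proof -
  let ?Z = "{z \<in> I. D z = \<zero>\<^bsub>M\<^esub>}"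
  have "cls z = \<zero>\<^bsub>L\<^esub>" if "z \<in> I" for z using that cls_eq_zero_iff by simp
  then have "ideal ?Z P"
    by (intro P.S.idealI') (auto simp: D_add D_mult I.I_l_closed I.I_r_closed)
  moreover have "G \<subseteq> ?Z"
  proof
    fix z assume z: "z \<in> G"
    have zP: "z \<in> fin_supp K (qpaths Q)" using z G by (auto simp: P_carrier)
    have 1: "z p \<odot>\<^bsub>kM\<^esub> (case p of (u, p, v) \<Rightarrow> der p v) = \<zero>\<^bsub>M\<^esub>" if "z p \<noteq> \<zero>\<^bsub>K\<^esub>" for p
    proof (cases p)
      case (fields u q v)
      have "path_avoids A p" "p \<in> qpaths Q" using av z that fin_suppD(3)[OF zP] by blast+
      then have "der q v = \<zero>\<^bsub>M\<^esub>" using der_avoiding[of u q v] by (simp add: fields path_avoids_def)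
      then show ?thesis using fin_suppD(1)[OF zP] by (simp add: fields)
    qed
    have "D z = \<zero>\<^bsub>kM\<^esub>"
      unfolding D_def lin_ext_def by (rule kM.M.add.finprod_one_eqI) (simp add: 1)
    then have "D z = \<zero>\<^bsub>M\<^esub>" by simp
    moreover have "z \<in> I" using z P.S.genideal_self[OF G(1)] G(2) by blast
    ultimately show "z \<in> ?Z" by blast
  qed
  ultimately show ?thesis
    using P.S.genideal_minimal[of ?Z G] G(2) z by blast
qed

end

context quiver_ideal
begin

text \<open>An arrow b of A absorbs the idempotent of its source on the left and that of its target
  on the right, so the corner condition kills it. The quantifier over x inside \<open>?Zl\<close>
  and \<open>?Zr\<close> makes these annihilators two-sided ideals, which therefore contain the
  whole arrow ideal.\<close>

lemma arrow_ideal_killed: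
  assumes A: "A \<subseteq> arcs Q"
    and corner: "\<And>a b x. a \<in> A \<Longrightarrow> b \<in> A \<Longrightarrow> x \<in> carrier L \<Longrightarrow>
      pc (triv (head Q a)) \<otimes>\<^bsub>L\<^esub> x \<otimes>\<^bsub>L\<^esub> pc (triv (tail Q b)) = \<zero>\<^bsub>L\<^esub>"
    and Z: "Z \<in> arrow_ideal K Q I A" and a: "a \<in> A" and x: "x \<in> carrier L"
  shows "pc (triv (head Q a)) \<otimes>\<^bsub>L\<^esub> (x \<otimes>\<^bsub>L\<^esub> Z) = \<zero>\<^bsub>L\<^esub>" (is ?l)
    and "(Z \<otimes>\<^bsub>L\<^esub> x) \<otimes>\<^bsub>L\<^esub> pc (triv (tail Q a)) = \<zero>\<^bsub>L\<^esub>" (is ?r)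
proof -
  let ?h = "\<lambda>a. pc (triv (head Q a))" and ?t = "\<lambda>a. pc (triv (tail Q a))"
  have cl: "?h a \<in> carrier L" "?t a \<in> carrier L" "pc (arr a) \<in> carrier L" if "a \<in> A" for a
    using that A by auto
  have arr: "?t a \<otimes>\<^bsub>L\<^esub> pc (arr a) = pc (arr a)" "pc (arr a) \<otimes>\<^bsub>L\<^esub> ?h a = pc (arr a)" if "a \<in> A" for a
    using pc_append[of "tail Q a" "[]" "tail Q a" "[a]" "head Q a"]
      pc_append[of "tail Q a" "[a]" "head Q a" "[]" "head Q a"] that A by auto
  let ?Zl = "{Z \<in> carrier L. \<forall>a\<in>A. \<forall>x\<in>carrier L. ?h a \<otimes>\<^bsub>L\<^esub> (x \<otimes>\<^bsub>L\<^esub> Z) = \<zero>\<^bsub>L\<^esub>}"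
  have "ideal ?Zl L"
  proof (rule L.S.idealI')
    fix Z y assume Z: "Z \<in> ?Zl" and y: "y \<in> carrier L"
    have "?h a \<otimes>\<^bsub>L\<^esub> (x \<otimes>\<^bsub>L\<^esub> (y \<otimes>\<^bsub>L\<^esub> Z)) = \<zero>\<^bsub>L\<^esub>" if "a \<in> A" "x \<in> carrier L" for a x
      using Z y that cl L.S.m_assoc[of x y Z, symmetric] by simp
    then show "y \<otimes>\<^bsub>L\<^esub> Z \<in> ?Zl" using Z y by simp
    have ZL: "Z \<in> carrier L" using Z by simp
    have "?h a \<otimes>\<^bsub>L\<^esub> (x \<otimes>\<^bsub>L\<^esub> (Z \<otimes>\<^bsub>L\<^esub> y)) = (?h a \<otimes>\<^bsub>L\<^esub> (x \<otimes>\<^bsub>L\<^esub> Z)) \<otimes>\<^bsub>L\<^esub> y"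
      if "a \<in> A" "x \<in> carrier L" for a x
      using ZL y that cl by (simp add: L.S.m_assoc)
    then show "Z \<otimes>\<^bsub>L\<^esub> y \<in> ?Zl" using Z y by simp
  qed (auto simp: L.S.r_distr cl)
  moreover have "pc (arr b) \<in> ?Zl" if b: "b \<in> A" for b
  proof -
    have "?h a \<otimes>\<^bsub>L\<^esub> (x \<otimes>\<^bsub>L\<^esub> pc (arr b)) = \<zero>\<^bsub>L\<^esub>" if "a \<in> A" "x \<in> carrier L" for a x
    proof -
      have "?h a \<otimes>\<^bsub>L\<^esub> (x \<otimes>\<^bsub>L\<^esub> (?t b \<otimes>\<^bsub>L\<^esub> pc (arr b))) = (?h a \<otimes>\<^bsub>L\<^esub> x \<otimes>\<^bsub>L\<^esub> ?t b) \<otimes>\<^bsub>L\<^esub> pc (arr b)"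
        using that b cl[OF that(1)] cl[OF b] by (simp only: L.S.m_assoc L.S.m_closed)
      then show ?thesis using that b arr cl by (simp add: corner)
    qed
    then show ?thesis using b cl by simp
  qed
  ultimately have "arrow_ideal K Q I A \<subseteq> ?Zl" by (rule arrow_ideal_minimal)
  then show ?l using Z a x by blast
  let ?Zr = "{Z \<in> carrier L. \<forall>a\<in>A. \<forall>x\<in>carrier L. (Z \<otimes>\<^bsub>L\<^esub> x) \<otimes>\<^bsub>L\<^esub> ?t a = \<zero>\<^bsub>L\<^esub>}"
  have "ideal ?Zr L"
  proof (rule L.S.idealI')
    fix Z y assume Z: "Z \<in> ?Zr" and y: "y \<in> carrier L"
    have "((Z \<otimes>\<^bsub>L\<^esub> y) \<otimes>\<^bsub>L\<^esub> x) \<otimes>\<^bsub>L\<^esub> ?t a = \<zero>\<^bsub>L\<^esub>" if "a \<in> A" "x \<in> carrier L" for a x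
      using Z y that cl L.S.m_assoc[of Z y x] by simp
    then show "Z \<otimes>\<^bsub>L\<^esub> y \<in> ?Zr" using Z y by simp
    have "((y \<otimes>\<^bsub>L\<^esub> Z) \<otimes>\<^bsub>L\<^esub> x) \<otimes>\<^bsub>L\<^esub> ?t a = y \<otimes>\<^bsub>L\<^esub> ((Z \<otimes>\<^bsub>L\<^esub> x) \<otimes>\<^bsub>L\<^esub> ?t a)"
      if "a \<in> A" "x \<in> carrier L" for a x
      using Z y that cl by (simp add: L.S.m_assoc)
    then show "y \<otimes>\<^bsub>L\<^esub> Z \<in> ?Zr" using Z y by simp
  qed (auto simp: L.S.l_distr cl)
  moreover have "pc (arr b) \<in> ?Zr" if b: "b \<in> A" for b
  proof -
    have "(pc (arr b) \<otimes>\<^bsub>L\<^esub> x) \<otimes>\<^bsub>L\<^esub> ?t a = \<zero>\<^bsub>L\<^esub>" if "a \<in> A" "x \<in> carrier L" for a x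
    proof -
      have "((pc (arr b) \<otimes>\<^bsub>L\<^esub> ?h b) \<otimes>\<^bsub>L\<^esub> x) \<otimes>\<^bsub>L\<^esub> ?t a = pc (arr b) \<otimes>\<^bsub>L\<^esub> (?h b \<otimes>\<^bsub>L\<^esub> x \<otimes>\<^bsub>L\<^esub> ?t a)"
        using that b cl[OF that(1)] cl[OF b] by (simp only: L.S.m_assoc L.S.m_closed)
      then show ?thesis using that b arr cl by (simp add: corner)
    qed
    then show ?thesis using b cl by simp
  qed
  ultimately have "arrow_ideal K Q I A \<subseteq> ?Zr" by (rule arrow_ideal_minimal)
  then show ?r using Z a x by blast
qed

end

context arrow_derivation
begin

text \<open>Expanding the derivative of x z y gives x (D z) y and two further terms, in which an
  element of the arrow ideal multiplies \<open>D x\<close> from the right or \<open>D y\<close> from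
  the left. These vanish: since \<open>m a\<close> lies in the corner of a, such a product contains
  e_{t(a)} p Z or Z p e_{s(a)} with Z in the arrow ideal.\<close>

lemma D_induces_hom:
  assumes corner: "\<And>a b x. a \<in> A \<Longrightarrow> b \<in> A \<Longrightarrow> x \<in> carrier L \<Longrightarrow>
      pc (triv (head Q a)) \<otimes>\<^bsub>L\<^esub> x \<otimes>\<^bsub>L\<^esub> pc (triv (tail Q b)) = \<zero>\<^bsub>L\<^esub>"
    and D_I: "\<And>z. z \<in> I \<Longrightarrow> D z = \<zero>\<^bsub>M\<^esub>"
  shows "\<exists>h \<in> lmod_hom L.E (ideal_bimodule K L (arrow_ideal K Q I A)) M. \<forall>a\<in>A. h (pc (arr a)) = m a"
proof
  let ?J = "arrow_ideal K Q I A"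
  interpret J: ideal ?J L by (rule arrow_ideal_ideal[OF A])
  let ?B = "ideal_bimodule K L ?J"
  interpret B: left_module L.E ?B by (rule L.left_module_ideal_bimodule[OF J.is_ideal])
  note killed = arrow_ideal_killed[OF A corner]
  have Jcl: "X \<in> carrier L" if "X \<in> ?J" for X using that by simp
  have der_J: "L.tens \<one>\<^bsub>L\<^esub> Z \<odot>\<^bsub>M\<^esub> der p v = \<zero>\<^bsub>M\<^esub>" if Z: "Z \<in> ?J" and p: "(u, p, v) \<in> qpaths Q" for Z u p v
    using p
  proof (induction p arbitrary: u)
    case Nil
    then show ?case using Z Jcl by simp
  next
    case (Cons a p)
    then have p: "a \<in> arcs Q" "(head Q a, p, v) \<in> qpaths Q" by (auto simp: Cons_path_iff)
    note cl = Jcl[OF Z]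
    have "L.tens \<one>\<^bsub>L\<^esub> Z \<odot>\<^bsub>M\<^esub> (L.tens (pc (triv (tail Q a))) (pc (head Q a, p, v)) \<odot>\<^bsub>M\<^esub> m a) = \<zero>\<^bsub>M\<^esub>" if a: "a \<in> A"
    proof -
      have "L.tens \<one>\<^bsub>L\<^esub> Z \<odot>\<^bsub>M\<^esub> (L.tens (pc (triv (tail Q a))) (pc (head Q a, p, v)) \<odot>\<^bsub>M\<^esub> m a) =
        L.tens \<one>\<^bsub>L\<^esub> Z \<odot>\<^bsub>M\<^esub> (L.tens (pc (triv (tail Q a))) (pc (head Q a, p, v)) \<odot>\<^bsub>M\<^esub>
          (L.tens (pc (triv (tail Q a))) (pc (triv (head Q a))) \<odot>\<^bsub>M\<^esub> m a))"
        using a m_corner by simp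
      then show ?thesis
        using a p cl killed(1)[OF _ _ _ Z a, of "pc (head Q a, p, v)"]
        by (simp add: tens_tens m_closed L.S.m_assoc)
    qed
    moreover have "L.tens \<one>\<^bsub>L\<^esub> Z \<odot>\<^bsub>M\<^esub> (L.tens (pc (arr a)) \<one>\<^bsub>L\<^esub> \<odot>\<^bsub>M\<^esub> der p v) =
      L.tens (pc (arr a)) \<one>\<^bsub>L\<^esub> \<odot>\<^bsub>M\<^esub> (L.tens \<one>\<^bsub>L\<^esub> Z \<odot>\<^bsub>M\<^esub> der p v)"
      using p cl by (simp add: tens_tens)
    ultimately show ?case using p cl Cons.IH by (auto simp: tens_act_add m_closed)
  qed
  have J_der: "L.tens Z \<one>\<^bsub>L\<^esub> \<odot>\<^bsub>M\<^esub> der p v = \<zero>\<^bsub>M\<^esub>" if Z: "Z \<in> ?J" and p: "(u, p, v) \<in> qpaths Q" for Z u p v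
    using p Z
  \<comment> \<open>Z is generalised because moving past the first arrow replaces Z by its product
    with that arrow, again in the arrow ideal. In \<open>der_J\<close> the arrow and Z act on
    opposite sides and commute, so there Z can stay fixed.\<close>
  proof (induction p arbitrary: u Z)
    case Nil
    then show ?case using Jcl by simp
  next
    case (Cons a p)
    then have p: "a \<in> arcs Q" "(head Q a, p, v) \<in> qpaths Q" by (auto simp: Cons_path_iff)
    note Z = Cons.prems(2)
    note cl = Jcl[OF Z]
    have "L.tens Z \<one>\<^bsub>L\<^esub> \<odot>\<^bsub>M\<^esub> (L.tens (pc (triv (tail Q a))) (pc (head Q a, p, v)) \<odot>\<^bsub>M\<^esub> m a) = \<zero>\<^bsub>M\<^esub>" if a: "a \<in> A"
      using a p cl killed(2)[OF _ _ _ Z a, of "\<one>\<^bsub>L\<^esub>"] by (simp add: tens_tens m_closed)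
    moreover have "Z \<otimes>\<^bsub>L\<^esub> pc (arr a) \<in> ?J" using Z p by (simp add: J.I_r_closed)
    then have "L.tens (Z \<otimes>\<^bsub>L\<^esub> pc (arr a)) \<one>\<^bsub>L\<^esub> \<odot>\<^bsub>M\<^esub> der p v = \<zero>\<^bsub>M\<^esub>" using Cons.IH p by blast
    then have "L.tens Z \<one>\<^bsub>L\<^esub> \<odot>\<^bsub>M\<^esub> (L.tens (pc (arr a)) \<one>\<^bsub>L\<^esub> \<odot>\<^bsub>M\<^esub> der p v) = \<zero>\<^bsub>M\<^esub>"
      using p cl by (simp add: tens_tens)
    ultimately show ?case using p cl by (auto simp: tens_act_add m_closed)
  qed
  have DJ: "L.tens \<one>\<^bsub>L\<^esub> Z \<odot>\<^bsub>M\<^esub> D x = \<zero>\<^bsub>M\<^esub>" "L.tens Z \<one>\<^bsub>L\<^esub> \<odot>\<^bsub>M\<^esub> D x = \<zero>\<^bsub>M\<^esub>"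
    if Z: "Z \<in> ?J" and x: "x \<in> carrier P" for Z x
    using x
    by (induction rule: P_induct; use Z Jcl[OF Z] in \<open>simp add: D_add D_smult P.V.smult_closed tens_act_add
      tens_smult_act D_pe der_J J_der\<close>)+
  \<comment> \<open>\<open>h\<close> is well defined and additive on the whole quotient, but its
    compatibility with the two actions is a matter of the arrow ideal, where the extra Leibniz terms
    vanish.\<close>
  define h where "h X = D (SOME x. x \<in> X)" for X
  have h_cls: "h (cls x) = D x" if x: "x \<in> carrier P" for x
  proof -
    have "D y = D x" if y: "y \<in> cls x" for y
    proof -
      have y: "y \<in> carrier P" "y \<ominus>\<^bsub>P\<^esub> x \<in> I" using y x mem_cls_iff cls_eq_iff by auto
      have "D y = D ((y \<ominus>\<^bsub>P\<^esub> x) \<oplus>\<^bsub>P\<^esub> x)"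
        using x y by (simp add: P.S.minus_eq P.S.a_assoc P.S.l_neg)
      then show ?thesis using x y D_I[OF y(2)] D_add[of "y \<ominus>\<^bsub>P\<^esub> x" x] by simp
    qed
    moreover have "x \<in> cls x" using x mem_cls_iff by blast
    ultimately show ?thesis unfolding h_def by (metis someI)
  qed
  have h_closed: "h X \<in> carrier M" if "X \<in> carrier L" for X
    using that by (elim quotient_carrierE) (simp add: h_cls)
  have h_add: "h (X \<oplus>\<^bsub>L\<^esub> Y) = h X \<oplus>\<^bsub>M\<^esub> h Y" if "X \<in> carrier L" "Y \<in> carrier L" for X Y
    using that by (elim quotient_carrierE) (simp add: h_cls cls_add D_add)
  have h_tens: "h (X \<otimes>\<^bsub>L\<^esub> Z \<otimes>\<^bsub>L\<^esub> Y) = L.tens X Y \<odot>\<^bsub>M\<^esub> h Z" if XY: "X \<in> carrier L" "Y \<in> carrier L" and Z: "Z \<in> ?J" for X Y Z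
  proof -
    obtain x where x: "x \<in> carrier P" "X = cls x" by (rule quotient_carrierE[OF XY(1)])
    obtain y where y: "y \<in> carrier P" "Y = cls y" by (rule quotient_carrierE[OF XY(2)])
    obtain z where z: "z \<in> carrier P" "Z = cls z" by (rule quotient_carrierE[OF Jcl[OF Z]])
    have "X \<otimes>\<^bsub>L\<^esub> Z \<in> ?J" using Z XY(1) by (rule J.I_l_closed)
    then have Zy: "L.tens (cls x \<otimes>\<^bsub>L\<^esub> cls z) \<one>\<^bsub>L\<^esub> \<odot>\<^bsub>M\<^esub> D y = \<zero>\<^bsub>M\<^esub>"
      using DJ(2)[OF _ y(1)] x z by simp
    have "D (x \<otimes>\<^bsub>P\<^esub> z) = L.tens (cls x) \<one>\<^bsub>L\<^esub> \<odot>\<^bsub>M\<^esub> D z"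
      using x z DJ(1)[OF Z x(1)] by (simp add: D_mult)
    then have "D (x \<otimes>\<^bsub>P\<^esub> z \<otimes>\<^bsub>P\<^esub> y) = L.tens (cls x) (cls y) \<odot>\<^bsub>M\<^esub> D z"
      using x y z Zy by (simp add: D_mult[of "x \<otimes>\<^bsub>P\<^esub> z" y] tens_tens cls_mult[symmetric])
    then show ?thesis using x y z by (simp add: cls_mult h_cls)
  qed
  have "h (w \<odot>\<^bsub>?B\<^esub> X) = w \<odot>\<^bsub>M\<^esub> h X" if "w \<in> carrier L.E" and X: "X \<in> ?J" for w X
    using that(1)
  proof (induction rule: L.tens_induct)
    case zero
    have "h \<zero>\<^bsub>L\<^esub> = \<zero>\<^bsub>M\<^esub>" unfolding zero_eq_cls by (simp add: h_cls)
    then show ?case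
      using X B.smult_l_null[of X] M.smult_l_null[OF h_closed] Jcl by simp
  next
    case (add w w')
    have "w \<odot>\<^bsub>?B\<^esub> X \<in> ?J" "w' \<odot>\<^bsub>?B\<^esub> X \<in> ?J"
      using B.smult_closed[of _ X] X add by auto
    then show ?case
      using X add B.smult_l_distr[of w w' X] by (simp add: h_add Jcl M.smult_l_distr h_closed)
  next
    case (tens x y)
    then show ?case using X by (simp add: L.ideal_bimodule_tens[OF J.is_ideal] h_tens)
  qed
  then show "h \<in> lmod_hom L.E ?B M"
    by (auto simp: lmod_hom_def h_closed h_add Jcl)
  show "\<forall>a\<in>A. h (pc (arr a)) = m a"
  proof
    fix a assume a: "a \<in> A"
    then have "a \<in> arcs Q" using A by blast
    then show "h (pc (arr a)) = m a"
      using a by (simp add: h_cls D_pe m_corner m_closed)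
  qed
qed

end

lemma (in quiver_ideal) projective_if_generated:
  assumes A: "A \<subseteq> arcs Q"
    and G: "G \<subseteq> carrier P" "I = Idl\<^bsub>P\<^esub> G"
    and av: "\<forall>z\<in>G. \<forall>p. z p \<noteq> \<zero>\<^bsub>K\<^esub> \<longrightarrow> path_avoids A p"
    and corner: "\<And>a b x. a \<in> A \<Longrightarrow> b \<in> A \<Longrightarrow> x \<in> carrier L \<Longrightarrow>
      pc (triv (head Q a)) \<otimes>\<^bsub>L\<^esub> x \<otimes>\<^bsub>L\<^esub> pc (triv (tail Q b)) = \<zero>\<^bsub>L\<^esub>"
  shows "projective_module L.E (ideal_bimodule K L (arrow_ideal K Q I A))"
proof -
  let ?J = "arrow_ideal K Q I A"
  let ?B = "ideal_bimodule K L ?J"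
  interpret J: ideal ?J L by (rule arrow_ideal_ideal[OF A])
  interpret B: left_module L.E ?B by (rule L.left_module_ideal_bimodule[OF J.is_ideal])
  let ?e = "\<lambda>a. L.tens (pc (triv (tail Q a))) (pc (triv (head Q a)))"
  have e: "?e a \<in> carrier L.E" "?e a \<otimes>\<^bsub>L.E\<^esub> ?e a = ?e a" "?e a \<odot>\<^bsub>?B\<^esub> pc (arr a) = pc (arr a)"
    if a: "a \<in> A" for a
  proof -
    have a': "a \<in> arcs Q" using a A by blast
    show "?e a \<in> carrier L.E" using a' by simp
    show "?e a \<otimes>\<^bsub>L.E\<^esub> ?e a = ?e a"
      using a' pc_append[of "tail Q a" "[]" "tail Q a" "[]" "tail Q a"]
        pc_append[of "head Q a" "[]" "head Q a" "[]" "head Q a"] by (simp add: L.tens_mult)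
    show "?e a \<odot>\<^bsub>?B\<^esub> pc (arr a) = pc (arr a)"
      using a' pc_append[of "tail Q a" "[]" "tail Q a" "[a]" "head Q a"]
      pc_append[of "tail Q a" "[a]" "head Q a" "[]" "head Q a"]
      by (simp add: L.ideal_bimodule_tens[OF J.is_ideal] arrow_in_arrow_ideal[OF A a])
  qed
  have "\<exists>h\<in>lmod_hom L.E ?B M. \<forall>x\<in>carrier ?B. f (h x) = g x"
    if M: "left_module L.E M" and N: "left_module L.E N" and f: "f \<in> lmod_hom L.E M N"
      and surj: "f ` carrier M = carrier N" and g: "g \<in> lmod_hom L.E ?B N"
    for M N :: "(_, 'z) module" and f g
  proof -
    interpret M: left_module L.E M by fact
    interpret N: left_module L.E N by fact
    have "\<exists>w. w \<in> carrier M \<and> f w = g (pc (arr a))" if "a \<in> A" for a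
    proof -
      have "g (pc (arr a)) \<in> carrier N"
        using g arrow_in_arrow_ideal[OF A that] by (simp add: lmod_hom_def)
      then show ?thesis using surj by (metis imageE)
    qed
    then obtain m0 where m0: "\<And>a. a \<in> A \<Longrightarrow> m0 a \<in> carrier M \<and> f (m0 a) = g (pc (arr a))" by metis
    \<comment> \<open>An arbitrary preimage of \<open>g (pc (arr a))\<close> is cut down to the
      corner of a. It remains a preimage, because \<open>?e a\<close> fixes the arrow.\<close>
    define m where "m a = ?e a \<odot>\<^bsub>M\<^esub> m0 a" for a
    have m: "m a \<in> carrier M" "?e a \<odot>\<^bsub>M\<^esub> m a = m a" "f (m a) = g (pc (arr a))" if a: "a \<in> A" for a
    proof -
      show "m a \<in> carrier M" using m0 e a by (simp add: m_def M.smult_closed)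
      show "?e a \<odot>\<^bsub>M\<^esub> m a = m a"
        using m0 e a by (simp add: m_def M.smult_assoc[symmetric])
      have "f (m a) = ?e a \<odot>\<^bsub>N\<^esub> g (pc (arr a))"
        using f m0[OF a] e(1)[OF a] by (auto simp: lmod_hom_def m_def)
      also have "\<dots> = g (?e a \<odot>\<^bsub>?B\<^esub> pc (arr a))"
        using g e(1)[OF a] arrow_in_arrow_ideal[OF A a] by (simp add: lmod_hom_def)
      finally show "f (m a) = g (pc (arr a))" using e(3)[OF a] by simp
    qed
    interpret D: arrow_derivation K Q I M A m
      by unfold_locales (use A m in auto)
    obtain h where h: "h \<in> lmod_hom L.E ?B M" "\<forall>a\<in>A. h (pc (arr a)) = m a"
      using D.D_induces_hom[OF corner D.D_ideal[OF G av]] by blast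
    \<comment> \<open>The elements at which the lift is correct form an ideal; it contains the
      arrows of A and so is the whole arrow ideal.\<close>
    let ?Z = "{X \<in> ?J. f (h X) = g X}"
    have hM: "h X \<in> carrier M" if "X \<in> ?J" for X using h(1) that by (simp add: lmod_hom_def)
    have gN: "g X \<in> carrier N" if "X \<in> ?J" for X using g that by (simp add: lmod_hom_def)
    have fg: "f (h (w \<odot>\<^bsub>?B\<^esub> X)) = g (w \<odot>\<^bsub>?B\<^esub> X)" if "X \<in> ?Z" "w \<in> carrier L.E" for w X
      using f g h(1) hM that by (simp add: lmod_hom_def)
    have "ideal ?Z L"
    proof (rule L.S.idealI')
      show "?Z \<subseteq> carrier L" by auto
      have "\<zero>\<^bsub>L.E\<^esub> \<odot>\<^bsub>?B\<^esub> \<zero>\<^bsub>L\<^esub> = \<zero>\<^bsub>L\<^esub>" using B.smult_l_null[of "\<zero>\<^bsub>L\<^esub>"] by simp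
      moreover have "f (h (\<zero>\<^bsub>L.E\<^esub> \<odot>\<^bsub>?B\<^esub> \<zero>\<^bsub>L\<^esub>)) = g (\<zero>\<^bsub>L.E\<^esub> \<odot>\<^bsub>?B\<^esub> \<zero>\<^bsub>L\<^esub>)"
      proof -
        have "f (h (\<zero>\<^bsub>L.E\<^esub> \<odot>\<^bsub>?B\<^esub> \<zero>\<^bsub>L\<^esub>)) = \<zero>\<^bsub>L.E\<^esub> \<odot>\<^bsub>N\<^esub> f (h \<zero>\<^bsub>L\<^esub>)"
          using f h(1) hM by (simp add: lmod_hom_def del: D.env_zero_act)
        moreover have "f (h \<zero>\<^bsub>L\<^esub>) \<in> carrier N" using f hM by (simp add: lmod_hom_def)
        moreover have "g (\<zero>\<^bsub>L.E\<^esub> \<odot>\<^bsub>?B\<^esub> \<zero>\<^bsub>L\<^esub>) = \<zero>\<^bsub>L.E\<^esub> \<odot>\<^bsub>N\<^esub> g \<zero>\<^bsub>L\<^esub>"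
          using g by (simp add: lmod_hom_def)
        ultimately show ?thesis using gN[of "\<zero>\<^bsub>L\<^esub>"] by (simp add: N.smult_l_null)
      qed
      ultimately show "\<zero>\<^bsub>L\<^esub> \<in> ?Z" by simp
      show "X \<oplus>\<^bsub>L\<^esub> Y \<in> ?Z" if "X \<in> ?Z" "Y \<in> ?Z" for X Y
        using f g h(1) hM that by (simp add: lmod_hom_def)
      fix X y assume X: "X \<in> ?Z" and y: "y \<in> carrier L"
      show "y \<otimes>\<^bsub>L\<^esub> X \<in> ?Z"
        using fg[OF X, of "L.tens y \<one>\<^bsub>L\<^esub>"] X y
        by (simp add: L.ideal_bimodule_tens[OF J.is_ideal] J.I_l_closed)
      show "X \<otimes>\<^bsub>L\<^esub> y \<in> ?Z"
        using fg[OF X, of "L.tens \<one>\<^bsub>L\<^esub> y"] X y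
        by (simp add: L.ideal_bimodule_tens[OF J.is_ideal] J.I_r_closed)
    qed
    moreover have "pc (arr a) \<in> ?Z" if "a \<in> A" for a
      using that h(2) m(3) arrow_in_arrow_ideal[OF A that] by simp
    ultimately have "?J \<subseteq> ?Z" by (rule arrow_ideal_minimal)
    then show ?thesis using h(1) by auto
  qed
  then show ?thesis
    unfolding projective_module_def using B.left_module_axioms by blast
qed

section \<open>Homomorphisms out of a projective arrow ideal\<close>

lemma (in left_module) lmod_hom_pointwise_add:
  assumes "f \<in> lmod_hom R P M" "g \<in> lmod_hom R P M"
  shows "(\<lambda>x. f x \<oplus>\<^bsub>M\<^esub> g x) \<in> lmod_hom R P M"
  using assms by (auto simp: lmod_hom_def smult_r_distr M.a_ac)

lemma (in env_left_module) smult_env_act: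
  assumes "c \<in> carrier K" "n \<in> carrier (enveloping_algebra K S)" "w \<in> carrier M"
  shows "(c \<odot>\<^bsub>enveloping_algebra K S\<^esub> n) \<odot>\<^bsub>M\<^esub> w = c \<odot>\<^bsub>kM\<^esub> (n \<odot>\<^bsub>M\<^esub> w)"
proof -
  interpret E: assoc_algebra K "enveloping_algebra K S" by (rule S.enveloping_assoc_algebra)
  have "tens (c \<odot>\<^bsub>S\<^esub> \<one>\<^bsub>S\<^esub>) \<one>\<^bsub>S\<^esub> \<otimes>\<^bsub>S.E\<^esub> n = c \<odot>\<^bsub>S.E\<^esub> n"
    using assms by (simp add: S.tens_smult_l S.tens_one[symmetric] E.smult_mult_l)
  moreover have "tens (c \<odot>\<^bsub>S\<^esub> \<one>\<^bsub>S\<^esub>) \<one>\<^bsub>S\<^esub> \<in> carrier S.E"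
    using assms by (simp add: S.V.smult_closed)
  ultimately show ?thesis
    using assms by (simp add: kM_smult M.smult_assoc[symmetric])
qed

lemma (in assoc_algebra) env_left_module_ideal_bimodule:
  "ideal J S \<Longrightarrow> env_left_module K S (ideal_bimodule K S J)"
  by (intro env_left_module.intro assoc_algebra_axioms left_module_ideal_bimodule)

section \<open>The radical of the enveloping algebra and the cover by a free bimodule\<close>

context quiver_ideal
begin

lemma env_path_induct [consumes 1, case_names zero add smult path]:
  assumes w: "w \<in> carrier L.E" and zero: "R \<zero>\<^bsub>L.E\<^esub>"
    and add: "\<And>w w'. w \<in> carrier L.E \<Longrightarrow> w' \<in> carrier L.E \<Longrightarrow> R w \<Longrightarrow> R w' \<Longrightarrow> R (w \<oplus>\<^bsub>L.E\<^esub> w')"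
    and smult: "\<And>c w. c \<in> carrier K \<Longrightarrow> w \<in> carrier L.E \<Longrightarrow> R w \<Longrightarrow> R (c \<odot>\<^bsub>L.E\<^esub> w)"
    and path: "\<And>u p v u' q v'. (u, p, v) \<in> qpaths Q \<Longrightarrow> (u', q, v') \<in> qpaths Q \<Longrightarrow>
      R (L.tens (pc (u, p, v)) (pc (u', q, v')))"
  shows "R w"
  using w
proof (induction rule: L.tens_induct)
  case (tens x y)
  interpret E: assoc_algebra K L.E by (rule L.enveloping_assoc_algebra)
  obtain x' where x': "x' \<in> carrier P" "x = cls x'" by (rule quotient_carrierE[OF tens(1)])
  obtain y' where y': "y' \<in> carrier P" "y = cls y'" by (rule quotient_carrierE[OF tens(2)])
  have 1: "R (L.tens (pc (u, p, v)) (cls y'))" if p: "(u, p, v) \<in> qpaths Q" for u p v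
    using y'(1)
  proof (induction rule: P_induct)
    case zero
    then show ?case using p by (simp add: zero_eq_cls[symmetric] assms(2))
  next
    case (add g c u' q v')
    then show ?case
      using p by (simp add: cls_lincomb L.V.smult_closed L.tens_add_r L.tens_smult_r E.V.smult_closed
          smult path assms(3))
  qed
  from x'(1) have "R (L.tens (cls x') (cls y'))"
  proof (induction rule: P_induct)
    case zero
    then show ?case using y' by (simp add: zero_eq_cls[symmetric] assms(2))
  next
    case (add g c u p v)
    then show ?case
      using y' by (simp add: cls_lincomb L.V.smult_closed L.tens_add_l L.tens_smult_l E.V.smult_closed
          smult 1 assms(3))
  qed
  then show ?case by (simp add: x' y')
qed (use zero add in auto)

text \<open>For admissible I this is the Jacobson radical of the enveloping algebra, with the span
  of the tensors of trivial paths as a semisimple complement.\<close>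

inductive_set env_rad where
  zero: "\<zero>\<^bsub>L.E\<^esub> \<in> env_rad"
| add: "\<lbrakk>n \<in> env_rad; n' \<in> env_rad\<rbrakk> \<Longrightarrow> n \<oplus>\<^bsub>L.E\<^esub> n' \<in> env_rad"
| smult: "\<lbrakk>c \<in> carrier K; n \<in> env_rad\<rbrakk> \<Longrightarrow> c \<odot>\<^bsub>L.E\<^esub> n \<in> env_rad"
| path: "\<lbrakk>(u, p, v) \<in> qpaths Q; (u', q, v') \<in> qpaths Q; p \<noteq> [] \<or> q \<noteq> []\<rbrakk> \<Longrightarrow>
    L.tens (pc (u, p, v)) (pc (u', q, v')) \<in> env_rad"

lemma env_rad_closed: "n \<in> env_rad \<Longrightarrow> n \<in> carrier L.E"
proof (induction rule: env_rad.induct)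
  interpret E: assoc_algebra K L.E by (rule L.enveloping_assoc_algebra)
  {
    case zero then show ?case by simp
  next
    case (add n n') then show ?case by simp
  next
    case (smult c n) then show ?case by (simp add: E.V.smult_closed)
  next
    case (path u p v u' q v') then show ?case by simp
  }
qed

text \<open>The idempotent e_u \<otimes> e_v has a one-dimensional top: multiplied by it on the
  right, a tensor of paths becomes zero, is the idempotent itself, or has positive total
  length.\<close>

lemma env_local_decomposition:
  assumes "w \<in> carrier L.E" and u: "u \<in> verts Q" and v: "v \<in> verts Q"
  shows "\<exists>c\<in>carrier K. \<exists>n\<in>env_rad. w \<otimes>\<^bsub>L.E\<^esub> L.tens (pc (triv u)) (pc (triv v)) =
    c \<odot>\<^bsub>L.E\<^esub> L.tens (pc (triv u)) (pc (triv v)) \<oplus>\<^bsub>L.E\<^esub> n"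
proof -
  interpret E: assoc_algebra K L.E by (rule L.enveloping_assoc_algebra)
  let ?e = "L.tens (pc (triv u)) (pc (triv v))"
  have e: "?e \<in> carrier L.E" using u v by simp
  note cl = env_rad_closed
  show ?thesis
    using assms(1)
  proof (induction rule: env_path_induct)
    case zero
    show ?case
      by (rule bexI[of _ "\<zero>\<^bsub>K\<^esub>"], rule bexI[of _ "\<zero>\<^bsub>L.E\<^esub>"])
        (use e in \<open>simp_all add: E.V.smult_l_null env_rad.zero\<close>)
  next
    case (add w w')
    then obtain c n c' n' where c: "c \<in> carrier K" "n \<in> env_rad" "w \<otimes>\<^bsub>L.E\<^esub> ?e = c \<odot>\<^bsub>L.E\<^esub> ?e \<oplus>\<^bsub>L.E\<^esub> n"
      "c' \<in> carrier K" "n' \<in> env_rad" "w' \<otimes>\<^bsub>L.E\<^esub> ?e = c' \<odot>\<^bsub>L.E\<^esub> ?e \<oplus>\<^bsub>L.E\<^esub> n'" by blast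
    show ?case
    proof (rule bexI, rule bexI)
      show "(w \<oplus>\<^bsub>L.E\<^esub> w') \<otimes>\<^bsub>L.E\<^esub> ?e = (c \<oplus>\<^bsub>K\<^esub> c') \<odot>\<^bsub>L.E\<^esub> ?e \<oplus>\<^bsub>L.E\<^esub> (n \<oplus>\<^bsub>L.E\<^esub> n')"
        using c add e by (simp add: E.S.l_distr E.V.smult_l_distr E.V.smult_closed cl E.S.a_ac)
    qed (use c in \<open>simp_all add: env_rad.add\<close>)
  next
    case (smult d w)
    then obtain c n where c: "c \<in> carrier K" "n \<in> env_rad" "w \<otimes>\<^bsub>L.E\<^esub> ?e = c \<odot>\<^bsub>L.E\<^esub> ?e \<oplus>\<^bsub>L.E\<^esub> n" by blast
    show ?case
    proof (rule bexI, rule bexI)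
      show "(d \<odot>\<^bsub>L.E\<^esub> w) \<otimes>\<^bsub>L.E\<^esub> ?e = (d \<otimes>\<^bsub>K\<^esub> c) \<odot>\<^bsub>L.E\<^esub> ?e \<oplus>\<^bsub>L.E\<^esub> d \<odot>\<^bsub>L.E\<^esub> n"
        using c smult e by (simp add: E.smult_mult_l E.V.smult_r_distr E.V.smult_assoc E.V.smult_closed cl)
    qed (use c smult in \<open>simp_all add: env_rad.smult\<close>)
  next
    case (path u1 p v1 u2 q v2)
    have t: "pc (u1, p, v1) \<otimes>\<^bsub>L\<^esub> pc (triv u) = (if v1 = u then pc (u1, p, v1) else \<zero>\<^bsub>L\<^esub>)"
      "pc (triv v) \<otimes>\<^bsub>L\<^esub> pc (u2, q, v2) = (if v = u2 then pc (u2, q, v2) else \<zero>\<^bsub>L\<^esub>)"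
      using path u v pc_append[of u1 p v1 "[]" u] pc_orth[of u1 p v1 u "[]" u]
        pc_append[of v "[]" v q v2] pc_orth[of v "[]" v u2 q v2] by auto
    have prod: "L.tens (pc (u1, p, v1)) (pc (u2, q, v2)) \<otimes>\<^bsub>L.E\<^esub> ?e =
      (if v1 = u \<and> v = u2 then L.tens (pc (u1, p, v1)) (pc (u2, q, v2)) else \<zero>\<^bsub>L.E\<^esub>)"
      using path u v by (auto simp: L.tens_mult t)
    consider "v1 = u" "v = u2" "p = []" "q = []" | "\<not> (v1 = u \<and> v = u2)"
      | "v1 = u" "v = u2" "p \<noteq> [] \<or> q \<noteq> []" by blast
    then show ?case
    proof cases
      case 1
      have "u1 = u" "v2 = v" using path 1 by (simp_all add: qpaths_iff Q.awalk_Nil_iff)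
      then show ?thesis
        by (intro bexI[of _ "\<one>\<^bsub>K\<^esub>"] bexI[of _ "\<zero>\<^bsub>L.E\<^esub>"])
          (use 1 e prod in \<open>simp_all add: E.V.smult_one env_rad.zero\<close>)
    next
      case 2
      then show ?thesis
        by (intro bexI[of _ "\<zero>\<^bsub>K\<^esub>"] bexI[of _ "\<zero>\<^bsub>L.E\<^esub>"])
          (use e prod in \<open>auto simp: E.V.smult_l_null env_rad.zero\<close>)
    next
      case 3
      then show ?thesis
        by (intro bexI[of _ "\<zero>\<^bsub>K\<^esub>"] bexI[of _ "L.tens (pc (u1, p, v1)) (pc (u2, q, v2))"])
          (use e prod path in \<open>auto simp: E.V.smult_l_null intro: env_rad.path\<close>)
    qed
  qed
qed

text \<open>The free module on A covers the arrow ideal because its image is an ideal containing the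
  arrows. It lives on functions of arrows, which is not the type of the test modules in the
  definition of projectivity; hence the appeal to \<open>projective_module_lift\<close>.\<close>

lemma arrow_ideal_splitting:
  assumes A: "A \<subseteq> arcs Q"
    and proj: "projective_module L.E (ideal_bimodule K L (arrow_ideal K Q I A))"
  obtains \<sigma> where
    "\<sigma> \<in> lmod_hom L.E (ideal_bimodule K L (arrow_ideal K Q I A)) (basis_algebra L.E A {} (\<lambda>_ _. None))"
    "\<And>X. X \<in> arrow_ideal K Q I A \<Longrightarrow>
      lin_ext L.E (ideal_bimodule K L (arrow_ideal K Q I A)) (\<lambda>a. pc (arr a)) (\<sigma> X) = X"
proof -
  let ?J = "arrow_ideal K Q I A"
  let ?B = "ideal_bimodule K L ?J"
  let ?F = "basis_algebra L.E A {} (\<lambda>_ _. None)"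
  let ?\<pi> = "lin_ext L.E ?B (\<lambda>a. pc (arr a))"
  interpret J: ideal ?J L by (rule arrow_ideal_ideal[OF A])
  interpret B: env_left_module K L ?B by (rule L.env_left_module_ideal_bimodule[OF J.is_ideal])
  interpret F: left_module L.E ?F by (rule B.M.R.left_module_basis_algebra)
  have Pi: "(\<lambda>a. pc (arr a)) \<in> Pi A (\<lambda>_. carrier ?B)"
    by (auto simp: arrow_in_arrow_ideal[OF A])
  have \<pi>: "?\<pi> \<in> lmod_hom L.E ?F ?B" by (rule B.M.lin_ext_hom[OF Pi])
  have cl: "?\<pi> f \<in> ?J" if "f \<in> carrier ?F" for f using \<pi> that by (simp add: lmod_hom_def)
  have "ideal (?\<pi> ` carrier ?F) L"
  proof (rule L.S.idealI')
    show "?\<pi> ` carrier ?F \<subseteq> carrier L" using cl by auto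
    have "?\<pi> \<zero>\<^bsub>?F\<^esub> = \<zero>\<^bsub>L\<^esub>" by (simp add: lin_ext_def basis_algebra_def)
    then show "\<zero>\<^bsub>L\<^esub> \<in> ?\<pi> ` carrier ?F"
      by (intro image_eqI[of _ ?\<pi> "\<zero>\<^bsub>?F\<^esub>"]) simp_all
    fix X assume X: "X \<in> ?\<pi> ` carrier ?F"
    then obtain f where f: "X = ?\<pi> f" "f \<in> carrier ?F" by (rule imageE)
    have act: "w \<odot>\<^bsub>?B\<^esub> X \<in> ?\<pi> ` carrier ?F" if "w \<in> carrier L.E" for w
    proof (rule image_eqI)
      show "w \<odot>\<^bsub>?B\<^esub> X = ?\<pi> (w \<odot>\<^bsub>?F\<^esub> f)" using \<pi> that f by (simp add: lmod_hom_def)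
      show "w \<odot>\<^bsub>?F\<^esub> f \<in> carrier ?F" using that f by (simp add: F.smult_closed)
    qed
    show "X \<oplus>\<^bsub>L\<^esub> Y \<in> ?\<pi> ` carrier ?F" if "Y \<in> ?\<pi> ` carrier ?F" for Y
    proof -
      from that obtain g where g: "Y = ?\<pi> g" "g \<in> carrier ?F" by (rule imageE)
      show ?thesis
      proof (rule image_eqI)
        show "X \<oplus>\<^bsub>L\<^esub> Y = ?\<pi> (f \<oplus>\<^bsub>?F\<^esub> g)" using \<pi> f g by (simp add: lmod_hom_def)
        show "f \<oplus>\<^bsub>?F\<^esub> g \<in> carrier ?F" using f g by simp
      qed
    qed
    fix y assume y: "y \<in> carrier L"
    show "y \<otimes>\<^bsub>L\<^esub> X \<in> ?\<pi> ` carrier ?F"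
      using act[of "L.tens y \<one>\<^bsub>L\<^esub>"] y f(1) cl[OF f(2)] by (simp add: L.ideal_bimodule_tens[OF J.is_ideal])
    show "X \<otimes>\<^bsub>L\<^esub> y \<in> ?\<pi> ` carrier ?F"
      using act[of "L.tens \<one>\<^bsub>L\<^esub> y"] y f(1) cl[OF f(2)] by (simp add: L.ideal_bimodule_tens[OF J.is_ideal])
  qed
  moreover have "pc (arr a) \<in> ?\<pi> ` carrier ?F" if "a \<in> A" for a
  proof (rule image_eqI)
    show "pc (arr a) = ?\<pi> (basis_elt L.E a)" by (rule B.M.lin_ext_basis_elt[OF that Pi, symmetric])
    show "basis_elt L.E a \<in> carrier ?F"
      using B.M.R.fin_supp_basis_elt[OF that] by (simp add: basis_algebra_def)
  qed
  ultimately have "?J \<subseteq> ?\<pi> ` carrier ?F" by (rule arrow_ideal_minimal)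
  then have surj: "?\<pi> ` carrier ?F = carrier ?B" using cl by auto
  have "(\<lambda>X. X) \<in> lmod_hom L.E ?B ?B"
    by (simp add: lmod_hom_def)
  from projective_module_lift[OF proj F.left_module_axioms B.M.left_module_axioms \<pi> surj this]
  obtain \<sigma> where \<sigma>: "\<sigma> \<in> lmod_hom L.E ?B ?F" "\<forall>X\<in>carrier ?B. ?\<pi> (\<sigma> X) = X" by (rule bexE)
  show ?thesis
  proof (rule that[OF \<sigma>(1)])
    fix X assume "X \<in> ?J"
    then show "?\<pi> (\<sigma> X) = X" using \<sigma>(2) by simp
  qed
qed

end

section \<open>Admissible ideals: nilpotency and coefficients at short paths\<close>

locale bound_quiver = quiver_ideal K Q I
  for K :: "('k, 'c) ring_scheme" and Q :: "('v, 'a) pre_digraph" and I +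
  assumes admissible: "admissible_ideal K Q I"
begin

lemma short_coeff_zero: "z \<in> I \<Longrightarrow> length (path_arrows p) < 2 \<Longrightarrow> z p = \<zero>\<^bsub>K\<^esub>"
  using admissible unfolding admissible_ideal_def by (meson not_le)

lemma long_paths_vanish: "\<exists>N. \<forall>u p v. (u, p, v) \<in> qpaths Q \<longrightarrow> N \<le> length p \<longrightarrow> pc (u, p, v) = \<zero>\<^bsub>L\<^esub>"
proof -
  obtain N where N: "\<forall>p\<in>qpaths Q. length (path_arrows p) = N \<longrightarrow> pe p \<in> I"
    using admissible unfolding admissible_ideal_def by blast
  have "pc (u, p, v) = \<zero>\<^bsub>L\<^esub>" if p: "(u, p, v) \<in> qpaths Q" "N \<le> length p" for u p v
  proof -
    \<comment> \<open>Admissibility speaks of paths of length exactly N; a longer path is reached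
      through its prefix of that length.\<close>
    obtain w where w: "(u, take N p, w) \<in> qpaths Q" "(w, drop N p, v) \<in> qpaths Q"
      using append_pathE[of u "take N p" "drop N p" v] p by auto
    then have "pe (u, take N p, w) \<in> I" using N p(2) by fastforce
    then have "pe (u, take N p, w) \<otimes>\<^bsub>P\<^esub> pe (w, drop N p, v) \<in> I" using w by (simp add: I.I_r_closed)
    then have "pe (u, p, v) \<in> I" using w by (simp add: pe_append)
    then show ?thesis using p by (simp add: cls_eq_zero_iff)
  qed
  then show ?thesis by blast
qed

text \<open>Meaningful for paths of length below 2: elements of an admissible ideal vanish there, so
  all representatives of a coset agree. This expresses that vertices and arrows are linearly
  independent modulo I.\<close>

definition coeff :: "('v, 'a) qpath \<Rightarrow> (('v, 'a) qpath \<Rightarrow> 'k) set \<Rightarrow> 'k" where "coeff p X = (SOME x. x \<in> X) p"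

lemma coeff_cls:
  assumes "x \<in> carrier P" "length (path_arrows p) < 2"
  shows "coeff p (cls x) = x p"
proof -
  have "y p = x p" if "y \<in> cls x" for y
  proof -
    have y: "y \<in> carrier P" "y \<ominus>\<^bsub>P\<^esub> x \<in> I" using that assms mem_cls_iff cls_eq_iff by auto
    then have "(y \<ominus>\<^bsub>P\<^esub> x) p = \<zero>\<^bsub>K\<^esub>" using short_coeff_zero assms by blast
    moreover have "y = (y \<ominus>\<^bsub>P\<^esub> x) \<oplus>\<^bsub>P\<^esub> x"
      using y assms by (simp add: P.S.minus_eq P.S.a_assoc P.S.l_neg)
    then have "y p = (y \<ominus>\<^bsub>P\<^esub> x) p \<oplus>\<^bsub>K\<^esub> x p" by (metis P_add)
    ultimately show ?thesis using assms by simp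
  qed
  moreover have "x \<in> cls x" using assms mem_cls_iff by blast
  ultimately show ?thesis unfolding coeff_def by (metis someI)
qed

lemma coeff_closed [simp]:
  assumes "X \<in> carrier L" "length (path_arrows p) < 2"
  shows "coeff p X \<in> carrier K"
  by (rule quotient_carrierE[OF assms(1)]) (simp add: coeff_cls assms)

lemma coeff_add:
  assumes "X \<in> carrier L" "Y \<in> carrier L" "length (path_arrows p) < 2"
  shows "coeff p (X \<oplus>\<^bsub>L\<^esub> Y) = coeff p X \<oplus>\<^bsub>K\<^esub> coeff p Y"
proof -
  obtain x where "x \<in> carrier P" "X = cls x" by (rule quotient_carrierE[OF assms(1)])
  moreover obtain y where "y \<in> carrier P" "Y = cls y" by (rule quotient_carrierE[OF assms(2)])
  ultimately show ?thesis using assms by (simp add: cls_add coeff_cls) (simp add: P_add)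
qed

lemma coeff_smult:
  assumes "X \<in> carrier L" "c \<in> carrier K" "length (path_arrows p) < 2"
  shows "coeff p (c \<odot>\<^bsub>L\<^esub> X) = c \<otimes>\<^bsub>K\<^esub> coeff p X"
proof -
  obtain x where "x \<in> carrier P" "X = cls x" by (rule quotient_carrierE[OF assms(1)])
  then show ?thesis using assms by (simp add: cls_smult coeff_cls P.V.smult_closed) (simp add: P_smult)
qed

lemma coeff_zero: "length (path_arrows p) < 2 \<Longrightarrow> coeff p \<zero>\<^bsub>L\<^esub> = \<zero>\<^bsub>K\<^esub>"
  unfolding zero_eq_cls by (simp add: coeff_cls) (simp add: P_zero)

lemma coeff_triv_mult:
  assumes "X \<in> carrier L" "Y \<in> carrier L"
  shows "coeff (triv v) (X \<otimes>\<^bsub>L\<^esub> Y) = coeff (triv v) X \<otimes>\<^bsub>K\<^esub> coeff (triv v) Y"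
proof -
  obtain x where "x \<in> carrier P" "X = cls x" by (rule quotient_carrierE[OF assms(1)])
  moreover obtain y where "y \<in> carrier P" "Y = cls y" by (rule quotient_carrierE[OF assms(2)])
  ultimately show ?thesis by (simp add: cls_mult coeff_cls triv_coeff_mult)
qed

text \<open>Acting on an arrow with a tensor of positive total length gives zero or a path of length
  at least 2, and such a path has no coefficient at an arrow.\<close>

lemma env_rad_arrow_coeff:
  assumes A: "A \<subseteq> arcs Q" and n: "n \<in> env_rad" and a: "a \<in> A" and b: "b \<in> arcs Q"
  shows "coeff (arr b) (n \<odot>\<^bsub>ideal_bimodule K L (arrow_ideal K Q I A)\<^esub> pc (arr a)) = \<zero>\<^bsub>K\<^esub>"
proof -
  let ?J = "arrow_ideal K Q I A"
  let ?B = "ideal_bimodule K L ?J"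
  interpret J: ideal ?J L by (rule arrow_ideal_ideal[OF A])
  interpret B: env_left_module K L ?B by (rule L.env_left_module_ideal_bimodule[OF J.is_ideal])
  have aJ: "pc (arr a) \<in> ?J" and a': "a \<in> arcs Q" using A a by (auto simp: arrow_in_arrow_ideal)
  have cl: "k \<odot>\<^bsub>?B\<^esub> pc (arr a) \<in> ?J" if "k \<in> env_rad" for k
    using B.M.smult_closed[of k "pc (arr a)"] env_rad_closed[OF that] aJ by simp
  have kB: "c \<odot>\<^bsub>B.kM\<^esub> X = c \<odot>\<^bsub>L\<^esub> X" if "c \<in> carrier K" "X \<in> ?J" for c X
    using that by (simp add: B.kM_smult L.ideal_bimodule_tens[OF J.is_ideal] L.V.smult_closed L.smult_mult_l)
  show ?thesis using n
  proof (induction rule: env_rad.induct)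
    case zero
    then show ?case using aJ B.M.smult_l_null[of "pc (arr a)"] by (simp add: coeff_zero)
  next
    case (add n n')
    then show ?case using aJ cl J.a_subset
      by (simp add: B.M.smult_l_distr env_rad_closed) (simp add: coeff_add)
  next
    case (smult c n)
    then show ?case using aJ cl
      by (simp add: B.smult_env_act env_rad_closed kB) (simp add: coeff_smult)
  next
    case (path u p v u' q v')
    have "pc (u, p, v) \<otimes>\<^bsub>L\<^esub> pc (arr a) \<otimes>\<^bsub>L\<^esub> pc (u', q, v') =
      (if v = tail Q a \<and> u' = head Q a then pc (u, p @ a # q, v') else \<zero>\<^bsub>L\<^esub>)"
    proof (cases "v = tail Q a")
      case True
      then have pa: "(u, p @ [a], head Q a) \<in> qpaths Q" "pc (u, p, v) \<otimes>\<^bsub>L\<^esub> pc (arr a) = pc (u, p @ [a], head Q a)"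
        using path a' append_path[of u p v "[a]" "head Q a"] pc_append[of u p v "[a]" "head Q a"] by auto
      then show ?thesis
        using True path pc_append[OF pa(1), of q v'] pc_orth[OF pa(1) path(2)] by auto
    next
      case False
      then show ?thesis using path a' by (simp add: pc_orth)
    qed
    moreover have "coeff (arr b) (pc (u, p @ a # q, v')) = \<zero>\<^bsub>K\<^esub>" if "v = tail Q a" "u' = head Q a"
    proof -
      have "(u, p @ [a], head Q a) \<in> qpaths Q"
        using path a' that append_path[of u p v "[a]" "head Q a"] by simp
      then have "(u, p @ a # q, v') \<in> qpaths Q"
        using append_path[of u "p @ [a]" "head Q a" q v'] path that by simp
      moreover have "p @ a # q \<noteq> [b]" using path(3) by (cases p) auto
      ultimately show ?thesis by (simp add: coeff_cls) (simp add: basis_elt_def)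
    qed
    ultimately show ?case using path aJ by (auto simp: L.ideal_bimodule_tens[OF J.is_ideal] coeff_zero)
  qed
qed

end

section \<open>Extension of corner elements along a finite filtration\<close>

locale bound_bimodule = bound_quiver K Q I +
  env_left_module K "quotient_algebra (path_algebra K Q) I" M
  for K :: "('k, 'c) ring_scheme" and Q :: "('v, 'a) pre_digraph" and I
    and M :: "(_, 'm, 'e) module_scheme"
begin

definition soc where "soc i = {w \<in> carrier M. \<forall>u p v u' q v'. (u, p, v) \<in> qpaths Q \<longrightarrow> (u', q, v') \<in> qpaths Q \<longrightarrow>
  i \<le> length p + length q \<longrightarrow> L.tens (pc (u, p, v)) (pc (u', q, v')) \<odot>\<^bsub>M\<^esub> w = \<zero>\<^bsub>M\<^esub>}"

lemma soc_closed: "w \<in> soc i \<Longrightarrow> w \<in> carrier M"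
  by (simp add: soc_def)

lemma soc_zero: "\<zero>\<^bsub>M\<^esub> \<in> soc i"
  by (simp add: soc_def)

lemma soc_add: "w \<in> soc i \<Longrightarrow> w' \<in> soc i \<Longrightarrow> w \<oplus>\<^bsub>M\<^esub> w' \<in> soc i"
  by (simp add: soc_def tens_act_add)

lemma soc_smult: "w \<in> soc i \<Longrightarrow> c \<in> carrier K \<Longrightarrow> c \<odot>\<^bsub>kM\<^esub> w \<in> soc i"
  by (simp add: soc_def tens_smult_act)

lemma soc_sum: "finite X \<Longrightarrow> (\<And>b. b \<in> X \<Longrightarrow> f b \<in> soc i) \<Longrightarrow> (\<Oplus>\<^bsub>M\<^esub>b\<in>X. f b) \<in> soc i"
proof (induction X rule: finite_induct)
  case empty
  then show ?case by (simp add: soc_zero)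
next
  case (insert b X)
  then have "f \<in> X \<rightarrow> carrier M" "f b \<in> carrier M" using soc_closed by blast+
  then show ?case using insert by (simp add: soc_add)
qed

text \<open>Without a lower bound on the lengths the condition covers the tensors of all paths. They
  span the enveloping algebra, so its identity kills w.\<close>

lemma soc_0: "soc 0 = {\<zero>\<^bsub>M\<^esub>}"
proof -
  have "w = \<zero>\<^bsub>M\<^esub>" if w: "w \<in> soc 0" for w
  proof -
    have "x \<odot>\<^bsub>M\<^esub> w = \<zero>\<^bsub>M\<^esub>" if "x \<in> carrier L.E" for x
      using that
    proof (induction rule: env_path_induct)
      case zero
      then show ?case using w by (simp add: M.smult_l_null soc_closed)
    next
      case (add x x')
      then show ?case using w by (simp add: M.smult_l_distr soc_closed)
    next
      case (smult c x)
      then show ?case using w by (simp add: smult_env_act soc_closed)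
    next
      case (path u p v u' q v')
      then show ?case using w by (simp add: soc_def)
    qed
    from this[of "\<one>\<^bsub>L.E\<^esub>"] show ?thesis using w by (simp add: M.smult_one soc_closed)
  qed
  then show ?thesis using soc_zero by blast
qed

lemma soc_exhausts: "\<exists>i. soc i = carrier M"
proof -
  obtain N where N: "\<And>u p v. (u, p, v) \<in> qpaths Q \<Longrightarrow> N \<le> length p \<Longrightarrow> pc (u, p, v) = \<zero>\<^bsub>L\<^esub>"
    using long_paths_vanish by blast
  \<comment> \<open>A total length of at least 2 N forces one of the two paths to have length at
    least N, and that path is zero in the quotient.\<close>
  have "w \<in> soc (2 * N)" if w: "w \<in> carrier M" for w
  proof -
    have "L.tens (pc (u, p, v)) (pc (u', q, v')) \<odot>\<^bsub>M\<^esub> w = \<zero>\<^bsub>M\<^esub>"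
      if pq: "(u, p, v) \<in> qpaths Q" "(u', q, v') \<in> qpaths Q" "2 * N \<le> length p + length q" for u p v u' q v'
    proof (cases "N \<le> length p")
      case True
      then show ?thesis using N[OF pq(1)] pq w by simp
    next
      case False
      then show ?thesis using N[OF pq(2)] pq w by simp
    qed
    then show ?thesis using w by (auto simp: soc_def)
  qed
  then have "soc (2 * N) = carrier M" using soc_closed by blast
  then show ?thesis ..
qed

text \<open>Composition with a tensor of positive total length raises the total length by at least
  one.\<close>

lemma env_rad_soc:
  assumes n: "n \<in> env_rad" and w: "w \<in> soc (Suc i)"
  shows "n \<odot>\<^bsub>M\<^esub> w \<in> soc i"
  using n
proof (induction rule: env_rad.induct)
  case zero
  then show ?case using w by (simp add: M.smult_l_null soc_closed soc_zero)
next
  case (add n n')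
  then show ?case using w by (simp add: M.smult_l_distr soc_closed env_rad_closed soc_add)
next
  case (smult c n)
  then show ?case using w by (simp add: smult_env_act soc_closed env_rad_closed soc_smult)
next
  case (path u p v u' q v')
  have "L.tens (pc (u1, p1, v1)) (pc (u2, q1, v2)) \<odot>\<^bsub>M\<^esub>
      (L.tens (pc (u, p, v)) (pc (u', q, v')) \<odot>\<^bsub>M\<^esub> w) = \<zero>\<^bsub>M\<^esub>"
    if 1: "(u1, p1, v1) \<in> qpaths Q" "(u2, q1, v2) \<in> qpaths Q" "i \<le> length p1 + length q1" for u1 p1 v1 u2 q1 v2
  proof (cases "v1 = u \<and> v' = u2")
    case True
    have pq: "(u1, p1 @ p, v) \<in> qpaths Q" "(u', q @ q1, v2) \<in> qpaths Q"
      using True 1 path append_path by auto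
    have "Suc i \<le> length (p1 @ p) + length (q @ q1)"
      using 1 path(3) by (cases p; cases q) auto
    then have "L.tens (pc (u1, p1 @ p, v)) (pc (u', q @ q1, v2)) \<odot>\<^bsub>M\<^esub> w = \<zero>\<^bsub>M\<^esub>"
      using w pq unfolding soc_def by blast
    then show ?thesis using True 1 path w by (simp add: tens_tens soc_closed pc_append)
  next
    case False
    then consider "v1 \<noteq> u" | "v' \<noteq> u2" by blast
    then show ?thesis using 1 path w by cases (simp_all add: tens_tens soc_closed pc_orth)
  qed
  then show ?case using path w by (simp add: soc_def)
qed

text \<open>The values of the splitting on arrows form a square matrix over the enveloping algebra.
  Cut by the idempotents of the arrows, it is a scalar matrix plus a radical one. The scalars are
  determined inside the arrow ideal, where coefficients at arrows exist, and are then used in M,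
  where no such coefficients are at hand.\<close>

lemma hom_from_projective_arrow_ideal:
  assumes A: "A \<subseteq> arcs Q"
    and proj: "projective_module L.E (ideal_bimodule K L (arrow_ideal K Q I A))"
    and m: "\<And>a. a \<in> A \<Longrightarrow> m a \<in> carrier M"
    and m_corner: "\<And>a. a \<in> A \<Longrightarrow> L.tens (pc (triv (tail Q a))) (pc (triv (head Q a))) \<odot>\<^bsub>M\<^esub> m a = m a"
  shows "\<exists>h \<in> lmod_hom L.E (ideal_bimodule K L (arrow_ideal K Q I A)) M. \<forall>a\<in>A. h (pc (arr a)) = m a"
proof -
  let ?J = "arrow_ideal K Q I A"
  let ?B = "ideal_bimodule K L ?J"
  let ?F = "basis_algebra L.E A {} (\<lambda>_ _. None)"
  let ?e = "\<lambda>a. L.tens (pc (triv (tail Q a))) (pc (triv (head Q a)))"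
  interpret E: assoc_algebra K L.E by (rule L.enveloping_assoc_algebra)
  interpret J: ideal ?J L by (rule arrow_ideal_ideal[OF A])
  interpret B: env_left_module K L ?B by (rule L.env_left_module_ideal_bimodule[OF J.is_ideal])
  have finA: "finite A" using A Q.finite_arcs by (rule finite_subset)
  have Aa: "a \<in> arcs Q" if "a \<in> A" for a using that A by blast
  have arJ: "pc (arr a) \<in> ?J" if "a \<in> A" for a using that by (rule arrow_in_arrow_ideal[OF A])
  have e: "?e a \<in> carrier L.E" if "a \<in> A" for a using Aa[OF that] by simp
  have e_ar: "?e a \<odot>\<^bsub>?B\<^esub> pc (arr a) = pc (arr a)" if "a \<in> A" for a
    using Aa[OF that] arJ[OF that] pc_append[of "tail Q a" "[]" "tail Q a" "[a]" "head Q a"]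
      pc_append[of "tail Q a" "[a]" "head Q a" "[]" "head Q a"]
    by (simp add: L.ideal_bimodule_tens[OF J.is_ideal])
  obtain \<sigma> where \<sigma>: "\<sigma> \<in> lmod_hom L.E ?B ?F"
    and \<sigma>_split: "\<And>X. X \<in> ?J \<Longrightarrow> lin_ext L.E ?B (\<lambda>a. pc (arr a)) (\<sigma> X) = X"
    using arrow_ideal_splitting[OF A proj] by blast
  have \<sigma>F: "\<sigma> X \<in> fin_supp L.E A" if "X \<in> ?J" for X
    using \<sigma> that by (simp add: lmod_hom_def basis_algebra_def)
  define w where "w a b = \<sigma> (pc (arr a)) b" for a b
  have w: "w a b \<in> carrier L.E" if "a \<in> A" for a b
    unfolding w_def using fin_suppD(1)[OF \<sigma>F[OF arJ[OF that]]] .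
  have "\<exists>c n. c \<in> carrier K \<and> n \<in> env_rad \<and> w a b \<otimes>\<^bsub>L.E\<^esub> ?e b = c \<odot>\<^bsub>L.E\<^esub> ?e b \<oplus>\<^bsub>L.E\<^esub> n"
    if "a \<in> A" "b \<in> A" for a b
    using env_local_decomposition[OF w[OF that(1), of b], of "tail Q b" "head Q b"] Aa[OF that(2)]
    by (auto simp: Bex_def)
  then obtain c n where cn: "c a b \<in> carrier K" "n a b \<in> env_rad"
    "w a b \<otimes>\<^bsub>L.E\<^esub> ?e b = c a b \<odot>\<^bsub>L.E\<^esub> ?e b \<oplus>\<^bsub>L.E\<^esub> n a b" if "a \<in> A" "b \<in> A" for a b
    by metis
  have kB: "d \<odot>\<^bsub>B.kM\<^esub> X = d \<odot>\<^bsub>L\<^esub> X" if "d \<in> carrier K" "X \<in> ?J" for d X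
    using that by (simp add: B.kM_smult L.ideal_bimodule_tens[OF J.is_ideal] L.V.smult_closed L.smult_mult_l)
  \<comment> \<open>The arrow b is fixed by \<open>?e b\<close>, so the matrix entry may be
    multiplied by this idempotent before it acts, and then it decomposes.\<close>
  have wB: "w a b \<odot>\<^bsub>?B\<^esub> pc (arr b) = c a b \<odot>\<^bsub>L\<^esub> pc (arr b) \<oplus>\<^bsub>L\<^esub> n a b \<odot>\<^bsub>?B\<^esub> pc (arr b)"
    if ab: "a \<in> A" "b \<in> A" for a b
  proof -
    have "w a b \<odot>\<^bsub>?B\<^esub> pc (arr b) = (w a b \<otimes>\<^bsub>L.E\<^esub> ?e b) \<odot>\<^bsub>?B\<^esub> pc (arr b)"
      using w[OF ab(1)] e[OF ab(2)] arJ[OF ab(2)] e_ar[OF ab(2)] by (simp add: B.M.smult_assoc)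
    also have "\<dots> = c a b \<odot>\<^bsub>B.kM\<^esub> (?e b \<odot>\<^bsub>?B\<^esub> pc (arr b)) \<oplus>\<^bsub>L\<^esub> n a b \<odot>\<^bsub>?B\<^esub> pc (arr b)"
      using cn[OF ab] e[OF ab(2)] arJ[OF ab(2)] B.M.smult_l_distr[of "c a b \<odot>\<^bsub>L.E\<^esub> ?e b" "n a b" "pc (arr b)"]
      by (simp add: env_rad_closed E.V.smult_closed B.smult_env_act)
    finally show ?thesis using ab arJ cn by (simp add: e_ar kB)
  qed
  have nB: "n a b \<odot>\<^bsub>?B\<^esub> pc (arr b) \<in> ?J" if "a \<in> A" "b \<in> A" for a b
    using B.M.smult_closed[of "n a b" "pc (arr b)"] env_rad_closed cn that arJ by simp
  have c: "c a b = (if a = b then \<one>\<^bsub>K\<^esub> else \<zero>\<^bsub>K\<^esub>)" if a: "a \<in> A" and b: "b \<in> A" for a b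
  proof -
    \<comment> \<open>Stated for subsets X of A, so that the sum over A can be treated by induction;
      the summand of b' contributes to the coefficient at b only if b' = b, the radical part
      never.\<close>
    have cf: "coeff (arr b) (\<Oplus>\<^bsub>?B\<^esub>b'\<in>X. w a b' \<odot>\<^bsub>?B\<^esub> pc (arr b')) = (if b \<in> X then c a b else \<zero>\<^bsub>K\<^esub>)"
      if "finite X" "X \<subseteq> A" for X
      using that
    proof (induction X rule: finite_induct)
      case empty
      then show ?case by (simp add: coeff_zero)
    next
      case (insert b' X)
      have wJ: "w a x \<odot>\<^bsub>?B\<^esub> pc (arr x) \<in> ?J" if "x \<in> A" for x
        using B.M.smult_closed[OF w[OF a], of "pc (arr x)" x] arJ[OF that] by simp
      then have X: "(\<lambda>x. w a x \<odot>\<^bsub>?B\<^esub> pc (arr x)) \<in> X \<rightarrow> carrier ?B" "w a b' \<odot>\<^bsub>?B\<^esub> pc (arr b') \<in> ?J"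
        using insert by auto
      have sJ: "(\<Oplus>\<^bsub>?B\<^esub>b'\<in>X. w a b' \<odot>\<^bsub>?B\<^esub> pc (arr b')) \<in> ?J"
        using B.M.M.finsum_closed[OF X(1)] by simp
      have "coeff (arr b) (w a b' \<odot>\<^bsub>?B\<^esub> pc (arr b')) = (if b = b' then c a b else \<zero>\<^bsub>K\<^esub>)"
      proof -
        have "b' \<in> A" using insert by blast
        then have "coeff (arr b) (w a b' \<odot>\<^bsub>?B\<^esub> pc (arr b')) = c a b' \<otimes>\<^bsub>K\<^esub> coeff (arr b) (pc (arr b'))"
          using a b cn[OF a \<open>b' \<in> A\<close>] nB[OF a \<open>b' \<in> A\<close>] Aa
          by (simp add: wB coeff_add coeff_smult L.V.smult_closed env_rad_arrow_coeff[OF A])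
        moreover have "coeff (arr b) (pc (arr b')) = (if b = b' then \<one>\<^bsub>K\<^esub> else \<zero>\<^bsub>K\<^esub>)"
          using Aa[OF \<open>b' \<in> A\<close>] by (simp add: coeff_cls) (auto simp: basis_elt_def)
        ultimately show ?thesis using cn[OF a \<open>b' \<in> A\<close>] by auto
      qed
      moreover have "(\<Oplus>\<^bsub>?B\<^esub>x\<in>insert b' X. w a x \<odot>\<^bsub>?B\<^esub> pc (arr x)) =
        w a b' \<odot>\<^bsub>?B\<^esub> pc (arr b') \<oplus>\<^bsub>L\<^esub> (\<Oplus>\<^bsub>?B\<^esub>x\<in>X. w a x \<odot>\<^bsub>?B\<^esub> pc (arr x))"
        using insert X by simp
      ultimately show ?case
        using insert X(2) sJ cn[OF a b] by (auto simp: coeff_add)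
    qed
    \<comment> \<open>Comparing coefficients at b in the splitting identity gives c a b on one side
      and the Kronecker delta on the other.\<close>
    have "pc (arr a) = lin_ext L.E ?B (\<lambda>a. pc (arr a)) (\<sigma> (pc (arr a)))"
      using \<sigma>_split arJ a by simp
    also have "\<dots> = (\<Oplus>\<^bsub>?B\<^esub>b'\<in>A. w a b' \<odot>\<^bsub>?B\<^esub> pc (arr b'))"
      unfolding w_def using \<sigma>F[OF arJ[OF a]] fin_suppD(3)[OF \<sigma>F[OF arJ[OF a]]] finA
      by (intro B.M.lin_ext_superset[of _ A]) (auto simp: arJ)
    finally have "coeff (arr b) (pc (arr a)) = c a b" using cf[OF finA] b by simp
    then show ?thesis using Aa[OF a] by (simp add: coeff_cls) (auto simp: basis_elt_def)
  qed
  \<comment> \<open>First approximation: the splitting followed by the homomorphism from the free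
    bimodule that sends the basis element of a to \<open>m a\<close>. By the shape of the matrix it
    is off by the radical terms alone.\<close>
  define H where "H m X = lin_ext L.E M m (\<sigma> X)" for m X
  have H_hom: "H m \<in> lmod_hom L.E ?B M" if "\<And>a. a \<in> A \<Longrightarrow> m a \<in> carrier M" for m
  proof -
    have "lin_ext L.E M m \<in> lmod_hom L.E ?F M" using that by (intro M.lin_ext_hom) auto
    then show ?thesis using \<sigma> by (simp add: lmod_hom_def H_def)
  qed
  have H_ar: "H m (pc (arr a)) = m a \<oplus>\<^bsub>M\<^esub> (\<Oplus>\<^bsub>M\<^esub>b\<in>A. n a b \<odot>\<^bsub>M\<^esub> m b)"
    if a: "a \<in> A" and m: "\<And>a. a \<in> A \<Longrightarrow> m a \<in> carrier M" "\<And>a. a \<in> A \<Longrightarrow> ?e a \<odot>\<^bsub>M\<^esub> m a = m a" for m a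
  proof -
    have nm: "n a b \<odot>\<^bsub>M\<^esub> m b \<in> carrier M" if "b \<in> A" for b
      using cn[OF a that] m that by (simp add: M.smult_closed env_rad_closed)
    have wm: "w a b \<odot>\<^bsub>M\<^esub> m b = (if a = b then m b else \<zero>\<^bsub>M\<^esub>) \<oplus>\<^bsub>M\<^esub> n a b \<odot>\<^bsub>M\<^esub> m b" if b: "b \<in> A" for b
    proof -
      have "w a b \<odot>\<^bsub>M\<^esub> m b = (w a b \<otimes>\<^bsub>L.E\<^esub> ?e b) \<odot>\<^bsub>M\<^esub> m b"
        using w[OF a] e[OF b] m b by (simp add: M.smult_assoc)
      also have "\<dots> = c a b \<odot>\<^bsub>kM\<^esub> (?e b \<odot>\<^bsub>M\<^esub> m b) \<oplus>\<^bsub>M\<^esub> n a b \<odot>\<^bsub>M\<^esub> m b"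
        using cn[OF a b] e[OF b] m b
        by (simp add: env_rad_closed E.V.smult_closed M.smult_l_distr smult_env_act del: m(2))
      also have "c a b \<odot>\<^bsub>kM\<^esub> (?e b \<odot>\<^bsub>M\<^esub> m b) = (if a = b then m b else \<zero>\<^bsub>M\<^esub>)"
        using c[OF a b] m b kM.smult_one[of "m b"] kM.smult_l_null[of "m b"] by simp
      finally show ?thesis .
    qed
    have "H m (pc (arr a)) = (\<Oplus>\<^bsub>M\<^esub>b\<in>A. w a b \<odot>\<^bsub>M\<^esub> m b)"
      unfolding H_def w_def using \<sigma>F[OF arJ[OF a]] fin_suppD(3)[OF \<sigma>F[OF arJ[OF a]]] finA m(1)
      by (intro M.lin_ext_superset[of _ A]) auto
    also have "\<dots> = (\<Oplus>\<^bsub>M\<^esub>b\<in>A. (if a = b then m b else \<zero>\<^bsub>M\<^esub>) \<oplus>\<^bsub>M\<^esub> n a b \<odot>\<^bsub>M\<^esub> m b)"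
      using m nm by (intro M.M.add.finprod_cong') (auto simp: wm)
    also have "\<dots> = (\<Oplus>\<^bsub>M\<^esub>b\<in>A. if a = b then m b else \<zero>\<^bsub>M\<^esub>) \<oplus>\<^bsub>M\<^esub> (\<Oplus>\<^bsub>M\<^esub>b\<in>A. n a b \<odot>\<^bsub>M\<^esub> m b)"
      using m nm by (intro M.M.add.finprod_multf) auto
    also have "(\<Oplus>\<^bsub>M\<^esub>b\<in>A. if a = b then m b else \<zero>\<^bsub>M\<^esub>) = m a"
      using m a finA by (intro M.M.add.finprod_singleton) auto
    finally show ?thesis .
  qed
  \<comment> \<open>On arrows \<open>H m\<close> differs from \<open>m\<close> by values one step deeper in the filtration \<open>soc\<close>, so finitely
    many corrections suffice.\<close>
  have "\<exists>h\<in>lmod_hom L.E ?B M. \<forall>a\<in>A. h (pc (arr a)) = m a"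
    if "\<And>a. a \<in> A \<Longrightarrow> m a \<in> soc i" "\<And>a. a \<in> A \<Longrightarrow> ?e a \<odot>\<^bsub>M\<^esub> m a = m a" for m i
    using that
  proof (induction i arbitrary: m)
    case 0
    have "(\<lambda>_. \<zero>\<^bsub>M\<^esub>) \<in> lmod_hom L.E ?B M" by (simp add: lmod_hom_def M.smult_r_null)
    then show ?case using 0 by (intro bexI[of _ "\<lambda>_. \<zero>\<^bsub>M\<^esub>"]) (auto simp: soc_0)
  next
    case (Suc i)
    have mM: "m a \<in> carrier M" if "a \<in> A" for a using Suc.prems(1)[OF that] by (rule soc_closed)
    define d where "d a = (\<Oplus>\<^bsub>M\<^esub>b\<in>A. n a b \<odot>\<^bsub>M\<^esub> m b)" for a
    have d: "d a \<in> soc i" if "a \<in> A" for a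
      unfolding d_def using that cn Suc.prems(1) by (intro soc_sum finA env_rad_soc) auto
    have Hm: "H m (pc (arr a)) = m a \<oplus>\<^bsub>M\<^esub> d a" if "a \<in> A" for a
      using H_ar[OF that mM Suc.prems(2)] by (simp add: d_def)
    \<comment> \<open>That the error lies in the corner of a is read off from \<open>H m\<close>:
      this homomorphism commutes with \<open>?e a\<close>, the arrow is fixed, and the known term
      \<open>m a\<close> cancels.\<close>
    have ed: "?e a \<odot>\<^bsub>M\<^esub> d a = d a" if a: "a \<in> A" for a
    proof -
      have "?e a \<odot>\<^bsub>M\<^esub> (m a \<oplus>\<^bsub>M\<^esub> d a) = H m (?e a \<odot>\<^bsub>?B\<^esub> pc (arr a))"
        using H_hom[OF mM] e[OF a] arJ[OF a] Hm[OF a] by (simp add: lmod_hom_def)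
      then have "?e a \<odot>\<^bsub>M\<^esub> (m a \<oplus>\<^bsub>M\<^esub> d a) = m a \<oplus>\<^bsub>M\<^esub> d a" using Hm e_ar a by simp
      moreover have "?e a \<odot>\<^bsub>M\<^esub> d a \<in> carrier M"
        using e[OF a] soc_closed[OF d[OF a]] by (rule M.smult_closed)
      ultimately show ?thesis
        using e[OF a] mM[OF a] soc_closed[OF d[OF a]] Suc.prems(2)[OF a]
        by (simp add: M.smult_r_distr)
    qed
    have dM: "d a \<in> carrier M" if "a \<in> A" for a using soc_closed[OF d[OF that]] .
    \<comment> \<open>The induction hypothesis is applied to the negated error, written with the
      scalar -1 because \<open>soc\<close> and the corners are known to be stable under
      scalars.\<close>
    let ?d' = "\<lambda>a. (\<ominus>\<^bsub>K\<^esub> \<one>\<^bsub>K\<^esub>) \<odot>\<^bsub>kM\<^esub> d a"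
    have "\<exists>h\<in>lmod_hom L.E ?B M. \<forall>a\<in>A. h (pc (arr a)) = ?d' a"
      using d ed Aa by (intro Suc.IH) (auto simp: soc_smult tens_smult_act dM)
    then obtain h where h: "h \<in> lmod_hom L.E ?B M" "\<forall>a\<in>A. h (pc (arr a)) = ?d' a" by blast
    have "m a \<oplus>\<^bsub>M\<^esub> d a \<oplus>\<^bsub>M\<^esub> ?d' a = m a" if a: "a \<in> A" for a
    proof -
      note dM = dM[OF a]
      have "(\<one>\<^bsub>K\<^esub> \<oplus>\<^bsub>K\<^esub> \<ominus>\<^bsub>K\<^esub> \<one>\<^bsub>K\<^esub>) \<odot>\<^bsub>kM\<^esub> d a = \<one>\<^bsub>K\<^esub> \<odot>\<^bsub>kM\<^esub> d a \<oplus>\<^bsub>M\<^esub> ?d' a"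
        using dM kM.smult_l_distr[of "\<one>\<^bsub>K\<^esub>" "\<ominus>\<^bsub>K\<^esub> \<one>\<^bsub>K\<^esub>" "d a"] by simp
      then have "d a \<oplus>\<^bsub>M\<^esub> ?d' a = \<zero>\<^bsub>M\<^esub>"
        using dM kM.smult_one[of "d a"] kM.smult_l_null[of "d a"] by (simp add: K.r_neg)
      then show ?thesis using dM mM[OF a] by (simp add: M.M.a_assoc)
    qed
    then show ?case
      using M.lmod_hom_pointwise_add[OF H_hom[OF mM] h(1)] h(2) Hm
      by (intro bexI[of _ "\<lambda>x. H m x \<oplus>\<^bsub>M\<^esub> h x"]) auto
  qed
  moreover obtain i where "soc i = carrier M" using soc_exhausts by blast
  ultimately show ?thesis using m m_corner by blast
qed

end

section \<open>Arrow removal from projectivity\<close>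

context bound_quiver
begin

text \<open>For y in the corner, a y b in the arrow ideal can be read as a (y b) and as (a y) b. A
  homomorphism into \<Lambda> with trivial left action sees y b in the first reading and zero in the
  second, so y b = 0. A homomorphism into \<Lambda> with trivial right action then removes b from
  this equation.\<close>

lemma corner_if_projective:
  assumes A: "A \<subseteq> arcs Q"
    and proj: "projective_module L.E (ideal_bimodule K L (arrow_ideal K Q I A))"
    and a: "a \<in> A" and b: "b \<in> A" and x: "x \<in> carrier L"
  shows "pc (triv (head Q a)) \<otimes>\<^bsub>L\<^esub> x \<otimes>\<^bsub>L\<^esub> pc (triv (tail Q b)) = \<zero>\<^bsub>L\<^esub>"
proof -
  let ?J = "arrow_ideal K Q I A"
  let ?B = "ideal_bimodule K L ?J"
  interpret J: ideal ?J L by (rule arrow_ideal_ideal[OF A])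
  let ?h = "\<lambda>a. pc (triv (head Q a))" and ?t = "\<lambda>a. pc (triv (tail Q a))" and ?r = "\<lambda>a. pc (arr a)"
  have Aa: "a \<in> arcs Q" if "a \<in> A" for a using that A by blast
  have cl [simp]: "?h a \<in> carrier L" "?t a \<in> carrier L" "?r a \<in> carrier L" "?r a \<in> ?J" if "a \<in> A" for a
    using Aa[OF that] arrow_in_arrow_ideal[OF A that] by auto
  have idem [simp]: "?h a \<otimes>\<^bsub>L\<^esub> ?h a = ?h a" "?t a \<otimes>\<^bsub>L\<^esub> ?t a = ?t a" if "a \<in> A" for a
    using Aa[OF that] pc_append[of "head Q a" "[]" "head Q a" "[]" "head Q a"]
      pc_append[of "tail Q a" "[]" "tail Q a" "[]" "tail Q a"] by auto
  have eps: "coeff (triv v) (?r a) = \<zero>\<^bsub>K\<^esub>" if "a \<in> A" for v a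
    using Aa[OF that] by (simp add: coeff_cls) (simp add: basis_elt_def)
  have eps_triv: "coeff (triv v) (pc (triv v)) = \<one>\<^bsub>K\<^esub>" "coeff (triv v) \<one>\<^bsub>L\<^esub> = \<one>\<^bsub>K\<^esub>" if "v \<in> verts Q" for v
    using that by (simp_all add: coeff_cls one_eq_cls P_one) (simp add: basis_elt_def)
  define y where "y = ?h a \<otimes>\<^bsub>L\<^esub> x \<otimes>\<^bsub>L\<^esub> ?t b"
  have y: "y \<in> carrier L" "?h a \<otimes>\<^bsub>L\<^esub> y = y" "y \<otimes>\<^bsub>L\<^esub> ?t b = y"
  proof -
    show "y \<in> carrier L" using a b x by (simp add: y_def)
    have "?h a \<otimes>\<^bsub>L\<^esub> y = (?h a \<otimes>\<^bsub>L\<^esub> ?h a) \<otimes>\<^bsub>L\<^esub> x \<otimes>\<^bsub>L\<^esub> ?t b"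
      using cl[OF a] cl[OF b] x by (simp only: y_def L.S.m_assoc L.S.m_closed)
    then show "?h a \<otimes>\<^bsub>L\<^esub> y = y" using a by (simp add: y_def)
    have "y \<otimes>\<^bsub>L\<^esub> ?t b = ?h a \<otimes>\<^bsub>L\<^esub> x \<otimes>\<^bsub>L\<^esub> (?t b \<otimes>\<^bsub>L\<^esub> ?t b)"
      using cl[OF a] cl[OF b] x by (simp only: y_def L.S.m_assoc L.S.m_closed)
    then show "y \<otimes>\<^bsub>L\<^esub> ?t b = y" using b by (simp add: y_def)
  qed

  \<comment> \<open>The bimodule \<open>\<Lambda>\<close> with its left action replaced by the one through the coefficient of \<open>e\<^sub>u\<close>.\<close>
  define u where "u = tail Q a"
  have u: "u \<in> verts Q" using Aa[OF a] by (simp add: u_def)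
  define act1 where "act1 p w = coeff (triv u) (fst p) \<odot>\<^bsub>L\<^esub> (w \<otimes>\<^bsub>L\<^esub> snd p)" for p w
  interpret M1: env_action K L L "carrier L" act1
    by (intro env_action.intro env_action_axioms.intro L.assoc_algebra_axioms L.V.left_module_axioms)
      (auto simp: act1_def coeff_add coeff_smult coeff_triv_mult eps_triv u L.S.l_distr L.S.r_distr
        L.V.smult_l_distr L.V.smult_r_distr L.smult_mult_l L.smult_mult_r L.V.smult_closed L.S.m_assoc
        L.V.smult_assoc[symmetric] K.m_comm L.V.smult_one)
  interpret B1: bound_bimodule K Q I M1.N
    by (intro bound_bimodule.intro bound_quiver_axioms env_left_module.intro L.assoc_algebra_axioms
        M1.left_module_env_module)
  \<comment> \<open>The value \<open>?h a\<close> is in the corner of a precisely because u was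
    taken to be the source of a: the left idempotent acts by its coefficient at
    \<open>triv u\<close>, which is 1.\<close>
  have "\<exists>h \<in> lmod_hom L.E ?B M1.N. \<forall>c\<in>A. h (?r c) = (if c = a then ?h a else \<zero>\<^bsub>L\<^esub>)"
    by (rule B1.hom_from_projective_arrow_ideal[OF A proj])
      (auto simp: M1.env_module_tens act1_def a L.V.smult_r_null eps_triv u[unfolded u_def] L.V.smult_one
        u_def L.V.smult_closed)
  then obtain h where h: "h \<in> lmod_hom L.E ?B M1.N" "\<forall>c\<in>A. h (?r c) = (if c = a then ?h a else \<zero>\<^bsub>L\<^esub>)"
    by blast
  have hw: "h (w \<odot>\<^bsub>?B\<^esub> X) = w \<odot>\<^bsub>M1.N\<^esub> h X" if "w \<in> carrier L.E" "X \<in> ?J" for w X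
    using h(1) that by (simp add: lmod_hom_def)
  have yb: "y \<otimes>\<^bsub>L\<^esub> ?r b = \<zero>\<^bsub>L\<^esub>"
  proof -
    \<comment> \<open>The two readings of a y b: as y b acting on a from the right, and as a y
      acting on b from the left. The latter acts through a coefficient at \<open>triv u\<close>,
      which vanishes since a y has no trivial part.\<close>
    have "L.tens \<one>\<^bsub>L\<^esub> (y \<otimes>\<^bsub>L\<^esub> ?r b) \<odot>\<^bsub>?B\<^esub> ?r a = L.tens (?r a \<otimes>\<^bsub>L\<^esub> y) \<one>\<^bsub>L\<^esub> \<odot>\<^bsub>?B\<^esub> ?r b"
      using y a b by (simp add: L.ideal_bimodule_tens[OF J.is_ideal] L.S.m_assoc)
    then have "L.tens \<one>\<^bsub>L\<^esub> (y \<otimes>\<^bsub>L\<^esub> ?r b) \<odot>\<^bsub>M1.N\<^esub> h (?r a) = L.tens (?r a \<otimes>\<^bsub>L\<^esub> y) \<one>\<^bsub>L\<^esub> \<odot>\<^bsub>M1.N\<^esub> h (?r b)"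
      using hw[of "L.tens \<one>\<^bsub>L\<^esub> (y \<otimes>\<^bsub>L\<^esub> ?r b)" "?r a"] hw[of "L.tens (?r a \<otimes>\<^bsub>L\<^esub> y) \<one>\<^bsub>L\<^esub>" "?r b"] y a b
      by simp
    moreover have hb: "h (?r b) \<in> carrier L" using h b a by auto
    ultimately have "act1 (\<one>\<^bsub>L\<^esub>, y \<otimes>\<^bsub>L\<^esub> ?r b) (?h a) = act1 (?r a \<otimes>\<^bsub>L\<^esub> y, \<one>\<^bsub>L\<^esub>) (h (?r b))"
      using y a b h(2) by (simp add: M1.env_module_tens)
    moreover have "act1 (\<one>\<^bsub>L\<^esub>, y \<otimes>\<^bsub>L\<^esub> ?r b) (?h a) = (?h a \<otimes>\<^bsub>L\<^esub> y) \<otimes>\<^bsub>L\<^esub> ?r b"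
      using y(1) a b u by (simp add: act1_def eps_triv L.V.smult_one L.S.m_assoc)
    moreover have "act1 (?r a \<otimes>\<^bsub>L\<^esub> y, \<one>\<^bsub>L\<^esub>) (h (?r b)) = \<zero>\<^bsub>L\<^esub>"
      using y(1) a hb by (simp add: act1_def coeff_triv_mult eps L.V.smult_l_null)
    ultimately show ?thesis using y by simp
  qed

  define v where "v = head Q b"
  have v: "v \<in> verts Q" using Aa[OF b] by (simp add: v_def)
  \<comment> \<open>The mirror image, with v the target of b: the left action is now the genuine
    multiplication, so that sending b to the idempotent of its source sends y b to y.\<close>
  define act2 where "act2 p w = coeff (triv v) (snd p) \<odot>\<^bsub>L\<^esub> (fst p \<otimes>\<^bsub>L\<^esub> w)" for p w
  interpret M2: env_action K L L "carrier L" act2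
    by (intro env_action.intro env_action_axioms.intro L.assoc_algebra_axioms L.V.left_module_axioms)
      (auto simp: act2_def coeff_add coeff_smult coeff_triv_mult eps_triv v L.S.l_distr L.S.r_distr
        L.V.smult_l_distr L.V.smult_r_distr L.smult_mult_l L.smult_mult_r L.V.smult_closed L.S.m_assoc
        L.V.smult_assoc[symmetric] K.m_comm L.V.smult_one)
  interpret B2: bound_bimodule K Q I M2.N
    by (intro bound_bimodule.intro bound_quiver_axioms env_left_module.intro L.assoc_algebra_axioms
        M2.left_module_env_module)
  have "\<exists>h \<in> lmod_hom L.E ?B M2.N. \<forall>c\<in>A. h (?r c) = (if c = b then ?t b else \<zero>\<^bsub>L\<^esub>)"
    by (rule B2.hom_from_projective_arrow_ideal[OF A proj])
      (auto simp: M2.env_module_tens act2_def b L.V.smult_r_null eps_triv v[unfolded v_def] L.V.smult_one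
        v_def L.V.smult_closed)
  then obtain k where k: "k \<in> lmod_hom L.E ?B M2.N" "\<forall>c\<in>A. k (?r c) = (if c = b then ?t b else \<zero>\<^bsub>L\<^esub>)"
    by blast
  have kw: "k (w \<odot>\<^bsub>?B\<^esub> X) = w \<odot>\<^bsub>M2.N\<^esub> k X" if "w \<in> carrier L.E" "X \<in> ?J" for w X
    using k(1) that by (simp add: lmod_hom_def)
  \<comment> \<open>Zero is written as the action of a tensor with first factor zero, so that
    linearity of \<open>k\<close> over the enveloping algebra applies on both sides.\<close>
  have "L.tens y \<one>\<^bsub>L\<^esub> \<odot>\<^bsub>?B\<^esub> ?r b = L.tens \<zero>\<^bsub>L\<^esub> \<one>\<^bsub>L\<^esub> \<odot>\<^bsub>?B\<^esub> ?r b"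
    using y b yb by (simp add: L.ideal_bimodule_tens[OF J.is_ideal] del: L.tens_zero)
  then have "L.tens y \<one>\<^bsub>L\<^esub> \<odot>\<^bsub>M2.N\<^esub> ?t b = L.tens \<zero>\<^bsub>L\<^esub> \<one>\<^bsub>L\<^esub> \<odot>\<^bsub>M2.N\<^esub> ?t b"
    using kw[of "L.tens y \<one>\<^bsub>L\<^esub>" "?r b"] kw[of "L.tens \<zero>\<^bsub>L\<^esub> \<one>\<^bsub>L\<^esub>" "?r b"] y b k(2)
    by (simp del: L.tens_zero)
  then have "act2 (y, \<one>\<^bsub>L\<^esub>) (?t b) = act2 (\<zero>\<^bsub>L\<^esub>, \<one>\<^bsub>L\<^esub>) (?t b)"
    using y b by (simp add: M2.env_module_tens del: L.tens_zero)
  then show ?thesis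
    using y b v by (simp add: act2_def eps_triv L.V.smult_one y_def[symmetric])
qed

end

section \<open>Paths through A and products of two of them\<close>

context quiver_algebra
begin

lemma part_through_idem [simp]: "part_through K A (part_through K A z) = part_through K A z"
  by (rule ext) (simp add: part_through_def)

lemma part_through_avoiding [simp]: "part_through K A (part_avoiding K A z) = \<zero>\<^bsub>P\<^esub>"
  unfolding P_zero by (rule ext) (simp add: part_through_def part_avoiding_def)

text \<open>The paths meeting A span a two-sided ideal of the path algebra, namely the fixed space
  of the projection \<open>part_through K A\<close>.\<close>

lemma through_mult:
  assumes z: "z \<in> carrier P" "part_through K A z = z" and x: "x \<in> carrier P"
  shows "part_through K A (x \<otimes>\<^bsub>P\<^esub> z) = x \<otimes>\<^bsub>P\<^esub> z" "part_through K A (z \<otimes>\<^bsub>P\<^esub> x) = z \<otimes>\<^bsub>P\<^esub> x"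
  using x
  by (induction rule: P_induct; use z in \<open>simp add: P.S.l_distr P.smult_mult_l P.S.r_distr P.smult_mult_r
    P.V.smult_closed part_add part_smult part_mult_l part_mult_r\<close>)+

text \<open>Used together with \<open>nonavoiding_last\<close>: cutting one path at its last arrow
  of A and the following path at its first leaves between the cuts a segment that avoids A.\<close>

lemma nonavoiding_first:
  assumes "(u, p, v) \<in> qpaths Q" "\<not> path_avoids A (u, p, v)"
  obtains p1 a p2 where "p = p1 @ a # p2" "a \<in> A" "set p1 \<inter> A = {}"
    "(u, p1, tail Q a) \<in> qpaths Q" "a \<in> arcs Q" "(head Q a, p2, v) \<in> qpaths Q"
proof -
  have "\<exists>a\<in>set p. a \<in> A" using assms(2) by (auto simp: path_avoids_def)
  then obtain p1 a p2 where p: "p = p1 @ a # p2" "a \<in> A" "\<forall>b\<in>set p1. b \<notin> A"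
    using split_list_first_prop[of p "\<lambda>a. a \<in> A"] by blast
  obtain w where w: "(u, p1, w) \<in> qpaths Q" "(w, a # p2, v) \<in> qpaths Q"
    using append_pathE assms(1) p(1) by metis
  show ?thesis
    by (rule that[OF p(1,2)]) (use w p(3) in \<open>auto simp: Cons_path_iff\<close>)
qed

lemma nonavoiding_last:
  assumes "(u, p, v) \<in> qpaths Q" "\<not> path_avoids A (u, p, v)"
  obtains p1 a p2 where "p = p1 @ a # p2" "a \<in> A" "set p2 \<inter> A = {}"
    "(u, p1, tail Q a) \<in> qpaths Q" "a \<in> arcs Q" "(head Q a, p2, v) \<in> qpaths Q"
proof -
  have "\<exists>a\<in>set p. a \<in> A" using assms(2) by (auto simp: path_avoids_def)
  then obtain p1 a p2 where p: "p = p1 @ a # p2" "a \<in> A" "\<forall>b\<in>set p2. b \<notin> A"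
    using split_list_last_prop[of p "\<lambda>a. a \<in> A"] by blast
  obtain w where w: "(u, p1, w) \<in> qpaths Q" "(w, a # p2, v) \<in> qpaths Q"
    using append_pathE assms(1) p(1) by metis
  show ?thesis
    by (rule that[OF p(1,2)]) (use w p(3) in \<open>auto simp: Cons_path_iff\<close>)
qed

end

context quiver_ideal
begin

abbreviation avoiding_generators where
  "avoiding_generators A \<equiv> {z \<in> I. part_through K A z = \<zero>\<^bsub>P\<^esub>}"

lemma avoiding_generators_subset: "avoiding_generators A \<subseteq> carrier P"
  by auto

text \<open>Between the last arrow of A in the first path and the first one in the second runs a
  segment avoiding A. By the corner condition it lies in I, so it is itself one of the generators,
  and the product is a multiple of it.\<close>

lemma twice_through_generated:
  assumes A: "A \<subseteq> arcs Q"
    and corner: "\<And>a b x. a \<in> A \<Longrightarrow> b \<in> A \<Longrightarrow> x \<in> carrier L \<Longrightarrow>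
      pc (triv (head Q a)) \<otimes>\<^bsub>L\<^esub> x \<otimes>\<^bsub>L\<^esub> pc (triv (tail Q b)) = \<zero>\<^bsub>L\<^esub>"
    and x: "x \<in> carrier P" and y: "y \<in> carrier P"
  shows "part_through K A x \<otimes>\<^bsub>P\<^esub> part_through K A y \<in> Idl\<^bsub>P\<^esub> (avoiding_generators A)"
proof -
  let ?I = "Idl\<^bsub>P\<^esub> (avoiding_generators A)"
  interpret I': ideal ?I P by (rule P.S.genideal_ideal[OF avoiding_generators_subset])
  note smult = P.ideal_smult_closed[OF I'.is_ideal]
  have 1: "pe (u, p, v) \<otimes>\<^bsub>P\<^esub> pe (v', q, w) \<in> ?I"
    if p: "(u, p, v) \<in> qpaths Q" "\<not> path_avoids A (u, p, v)"
      and q: "(v', q, w) \<in> qpaths Q" "\<not> path_avoids A (v', q, w)" for u p v v' q w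
  proof (cases "v = v'")
    case False
    then show ?thesis using p q by (simp add: pe_orth)
  next
    case True
    obtain p1 a p2 where p': "p = p1 @ a # p2" "a \<in> A" "set p2 \<inter> A = {}"
      "(u, p1, tail Q a) \<in> qpaths Q" "a \<in> arcs Q" "(head Q a, p2, v) \<in> qpaths Q"
      using nonavoiding_last[OF p] .
    obtain q1 b q2 where q': "q = q1 @ b # q2" "b \<in> A" "set q1 \<inter> A = {}"
      "(v', q1, tail Q b) \<in> qpaths Q" "b \<in> arcs Q" "(head Q b, q2, w) \<in> qpaths Q"
      using nonavoiding_first[OF q] .
    let ?r = "(head Q a, p2 @ q1, tail Q b)"
    have r: "?r \<in> qpaths Q" using p' q' True append_path by blast
    have "pc ?r = pc (triv (head Q a)) \<otimes>\<^bsub>L\<^esub> pc ?r \<otimes>\<^bsub>L\<^esub> pc (triv (tail Q b))"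
      using r p' q' pc_append[of "head Q a" "[]" "head Q a" "p2 @ q1" "tail Q b"]
        pc_append[of "head Q a" "p2 @ q1" "tail Q b" "[]" "tail Q b"] by simp
    then have "pc ?r = \<zero>\<^bsub>L\<^esub>" using corner[OF p'(2) q'(2)] r by simp
    then have "pe ?r \<in> I" using r by (simp add: cls_eq_zero_iff)
    moreover have "part_through K A (pe ?r) = \<zero>\<^bsub>P\<^esub>" using p' q' by (simp add: part_basis)
    ultimately have "pe ?r \<in> ?I"
      using P.S.genideal_self[OF avoiding_generators_subset] by blast
    moreover have h: "(u, p1 @ [a], head Q a) \<in> qpaths Q"
      using append_path[OF p'(4), of "[a]" "head Q a"] p' by simp
    moreover have t: "(tail Q b, b # q2, w) \<in> qpaths Q" using q' by (simp add: Cons_path_iff)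
    ultimately have "pe (u, p1 @ [a], head Q a) \<otimes>\<^bsub>P\<^esub> pe ?r \<otimes>\<^bsub>P\<^esub> pe (tail Q b, b # q2, w) \<in> ?I"
      by (simp add: I'.I_l_closed I'.I_r_closed)
    moreover have "(u, p1 @ a # p2 @ q1, tail Q b) \<in> qpaths Q"
      using append_path[OF h r] by simp
    ultimately have "pe (u, p1 @ a # p2 @ q1 @ b # q2, w) \<in> ?I"
      using h t r by (simp add: pe_append)
    then show ?thesis using p q p' q' True by (simp add: pe_append)
  qed
  have 2: "pe (u, p, v) \<otimes>\<^bsub>P\<^esub> part_through K A y \<in> ?I"
    if p: "(u, p, v) \<in> qpaths Q" "\<not> path_avoids A (u, p, v)" for u p v
    using y
    by (induction rule: P_induct; use p 1 in \<open>simp add: part_add part_smult part_basis P.S.r_distr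
      P.smult_mult_r P.V.smult_closed smult\<close>)
  show ?thesis
    using x
    by (induction rule: P_induct; use y 2 in \<open>simp add: part_add part_smult part_basis P.S.l_distr
      P.smult_mult_l P.V.smult_closed smult\<close>)
qed

end

section \<open>Generators avoiding A from pre-removability and projectivity\<close>

context bound_quiver
begin

lemma generated_if_projective:
  assumes A: "A \<subseteq> arcs Q"
    and pre: "pre_removable K I A"
    and proj: "projective_module L.E (ideal_bimodule K L (arrow_ideal K Q I A))"
  shows "I = Idl\<^bsub>P\<^esub> (avoiding_generators A)"
proof -
  let ?I = "Idl\<^bsub>P\<^esub> (avoiding_generators A)"
  let ?J = "arrow_ideal K Q I A"
  let ?B = "ideal_bimodule K L ?J"
  let ?pt = "part_through K A"
  interpret I': quiver_ideal K Q ?I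
    by (intro quiver_ideal.intro quiver_algebra_axioms P.S.genideal_ideal avoiding_generators_subset)
  interpret J: ideal ?J L by (rule arrow_ideal_ideal[OF A])
  have sub: "?I \<subseteq> I" by (rule P.S.genideal_minimal[OF I.is_ideal]) auto
  have gen: "z \<in> ?I" if "z \<in> I" "?pt z = \<zero>\<^bsub>P\<^esub>" for z
    using that P.S.genideal_self[OF avoiding_generators_subset] by blast
  have twice: "?pt x \<otimes>\<^bsub>P\<^esub> ?pt y \<in> ?I" if "x \<in> carrier P" "y \<in> carrier P" for x y
    by (rule twice_through_generated[OF A _ that]) (rule corner_if_projective[OF A proj])
  have preI: "?pt z \<in> I" "part_avoiding K A z \<in> I" if "z \<in> I" for z
    using pre that by (auto simp: pre_removable_def)
  \<comment> \<open>Pre-removability splits x inside I. The part avoiding A is a generator of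
    \<open>?I\<close>; the part through A meets another element through A, and such products are in
    \<open>?I\<close> by \<open>twice\<close>.\<close>
  have IA: "x \<otimes>\<^bsub>P\<^esub> z \<in> ?I" "z \<otimes>\<^bsub>P\<^esub> x \<in> ?I" if x: "x \<in> I" and z: "z \<in> carrier P" "?pt z = z" for x z
  proof -
    have xP: "x \<in> carrier P" using x by simp
    have n: "part_avoiding K A x \<in> ?I" using preI(2)[OF x] by (intro gen) simp_all
    have "?pt x \<otimes>\<^bsub>P\<^esub> z \<in> ?I" "z \<otimes>\<^bsub>P\<^esub> ?pt x \<in> ?I"
      using twice[OF xP z(1)] twice[OF z(1) xP] z(2) by simp_all
    then have "(?pt x \<oplus>\<^bsub>P\<^esub> part_avoiding K A x) \<otimes>\<^bsub>P\<^esub> z \<in> ?I" "z \<otimes>\<^bsub>P\<^esub> (?pt x \<oplus>\<^bsub>P\<^esub> part_avoiding K A x) \<in> ?I"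
      using xP z n by (simp_all add: P.S.l_distr P.S.r_distr I'.I.I_l_closed I'.I.I_r_closed)
    then show "x \<otimes>\<^bsub>P\<^esub> z \<in> ?I" "z \<otimes>\<^bsub>P\<^esub> x \<in> ?I" using xP by (simp_all add: part_sum)
  qed

  \<comment> \<open>The ideal of \<open>kQ/I'\<close> generated by \<open>A\<close> is annihilated by \<open>I\<close> on both sides, hence a
    \<open>\<Lambda>\<close>-bimodule.\<close>
  define C where "C = I'.cls ` {z \<in> carrier P. ?pt z = z}"
  define act where "act p w = I'.cls (SOME x. x \<in> fst p) \<otimes>\<^bsub>I'.L\<^esub> w \<otimes>\<^bsub>I'.L\<^esub> I'.cls (SOME y. y \<in> snd p)"
    for p :: "(('v, 'a) qpath \<Rightarrow> 'k) set \<times> (('v, 'a) qpath \<Rightarrow> 'k) set" and w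
  \<comment> \<open>Independence of the chosen representatives: changing x by an element of I
    changes x z by an element of \<open>?I\<close>, and the same works for y because x z again
    consists of paths through A.\<close>
  have act_cls: "act (cls x, cls y) (I'.cls z) = I'.cls (x \<otimes>\<^bsub>P\<^esub> z \<otimes>\<^bsub>P\<^esub> y)"
    if x: "x \<in> carrier P" and y: "y \<in> carrier P" and z: "z \<in> carrier P" "?pt z = z" for x y z
  proof -
    have rep: "(SOME x'. x' \<in> cls x) \<in> carrier P \<and> (SOME x'. x' \<in> cls x) \<ominus>\<^bsub>P\<^esub> x \<in> I" if "x \<in> carrier P" for x
    proof -
      have "x \<in> cls x" using that mem_cls_iff by blast
      then have "(SOME x'. x' \<in> cls x) \<in> cls x" by (rule someI[of "\<lambda>x'. x' \<in> cls x"])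
      then have s: "(SOME x'. x' \<in> cls x) \<in> carrier P" "cls (SOME x'. x' \<in> cls x) = cls x"
        using mem_cls_iff[OF that, of "SOME x'. x' \<in> cls x"] by simp_all
      show ?thesis using s cls_eq_iff[OF s(1) that] by simp
    qed
    define x' where "x' = (SOME x'. x' \<in> cls x)"
    define y' where "y' = (SOME y'. y' \<in> cls y)"
    have x': "x' \<in> carrier P" "x' \<ominus>\<^bsub>P\<^esub> x \<in> I" and y': "y' \<in> carrier P" "y' \<ominus>\<^bsub>P\<^esub> y \<in> I"
      using rep x y by (simp_all add: x'_def y'_def)
    have "(x' \<ominus>\<^bsub>P\<^esub> x) \<otimes>\<^bsub>P\<^esub> z \<in> ?I" using IA(1)[OF x'(2) z] .
    then have 1: "I'.cls (x' \<otimes>\<^bsub>P\<^esub> z) = I'.cls (x \<otimes>\<^bsub>P\<^esub> z)"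
      using x x' z by (simp add: I'.cls_eq_iff P.S.minus_eq P.S.l_distr P.S.l_minus)
    have xz: "x \<otimes>\<^bsub>P\<^esub> z \<in> carrier P" "?pt (x \<otimes>\<^bsub>P\<^esub> z) = x \<otimes>\<^bsub>P\<^esub> z" using x z by (simp_all add: through_mult)
    have "(x \<otimes>\<^bsub>P\<^esub> z) \<otimes>\<^bsub>P\<^esub> (y' \<ominus>\<^bsub>P\<^esub> y) \<in> ?I" using IA(2)[OF y'(2) xz] .
    then have 2: "I'.cls (x \<otimes>\<^bsub>P\<^esub> z \<otimes>\<^bsub>P\<^esub> y') = I'.cls (x \<otimes>\<^bsub>P\<^esub> z \<otimes>\<^bsub>P\<^esub> y)"
      using xz y y' by (simp add: I'.cls_eq_iff P.S.minus_eq P.S.r_distr P.S.r_minus)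
    have "act (cls x, cls y) (I'.cls z) = I'.cls (x' \<otimes>\<^bsub>P\<^esub> z) \<otimes>\<^bsub>I'.L\<^esub> I'.cls y'"
      using x' y' z by (simp add: act_def I'.cls_mult x'_def[symmetric] y'_def[symmetric])
    also have "\<dots> = I'.cls (x \<otimes>\<^bsub>P\<^esub> z \<otimes>\<^bsub>P\<^esub> y)"
      using x' y' x y z by (simp add: 1 I'.cls_mult 2)
    finally show ?thesis .
  qed
  have CE: "\<exists>z. z \<in> carrier P \<and> ?pt z = z \<and> w = I'.cls z" if "w \<in> C" for w
    using that by (auto simp: C_def)
  have CI: "I'.cls z \<in> C" if "z \<in> carrier P" "?pt z = z" for z
    using that by (auto simp: C_def)
  have LE: "\<exists>x. x \<in> carrier P \<and> X = cls x" if "X \<in> carrier L" for X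
    using that by (metis quotient_carrierE)
  note cl [simp] = P.V.smult_closed through_mult part_add part_smult
  interpret M: env_action K L I'.L C act
  proof (intro env_action.intro env_action_axioms.intro L.assoc_algebra_axioms I'.L.V.left_module_axioms)
    show "C \<subseteq> carrier I'.L" by (auto simp: C_def)
    show "\<zero>\<^bsub>I'.L\<^esub> \<in> C" unfolding I'.zero_eq_cls by (rule CI) simp_all
    fix w assume "w \<in> C"
    then obtain z where z: "z \<in> carrier P" "?pt z = z" "w = I'.cls z" using CE by blast
    show "c \<odot>\<^bsub>I'.L\<^esub> w \<in> C" if "c \<in> carrier K" for c
      using z that by (simp add: I'.cls_smult CI)
    show "act (\<one>\<^bsub>L\<^esub>, \<one>\<^bsub>L\<^esub>) w = w" using z by (simp add: one_eq_cls act_cls)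
    show "w \<oplus>\<^bsub>I'.L\<^esub> w' \<in> C" if "w' \<in> C" for w'
      using z CE[OF that] by (auto simp: I'.cls_add intro!: CI)
    fix X Y assume X: "X \<in> carrier L" and Y: "Y \<in> carrier L"
    then obtain x y where xy: "x \<in> carrier P" "X = cls x" "y \<in> carrier P" "Y = cls y" using LE by blast
    show "act (X, Y) w \<in> C" using xy z by (simp add: act_cls CI)
    show "act (X, Y) (w \<oplus>\<^bsub>I'.L\<^esub> w') = act (X, Y) w \<oplus>\<^bsub>I'.L\<^esub> act (X, Y) w'" if "w' \<in> C" for w'
      using xy z CE[OF that] by (auto simp: I'.cls_add act_cls P.S.l_distr P.S.r_distr)
    show "act (X, Y) (c \<odot>\<^bsub>I'.L\<^esub> w) = c \<odot>\<^bsub>I'.L\<^esub> act (X, Y) w" if "c \<in> carrier K" for c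
      using xy z that by (simp add: I'.cls_smult act_cls P.smult_mult_l P.smult_mult_r)
    show "act (X \<oplus>\<^bsub>L\<^esub> X', Y) w = act (X, Y) w \<oplus>\<^bsub>I'.L\<^esub> act (X', Y) w" if "X' \<in> carrier L" for X'
      using xy z LE[OF that] by (auto simp: I'.cls_add cls_add act_cls P.S.l_distr P.S.r_distr)
    show "act (X, Y \<oplus>\<^bsub>L\<^esub> Y') w = act (X, Y) w \<oplus>\<^bsub>I'.L\<^esub> act (X, Y') w" if "Y' \<in> carrier L" for Y'
      using xy z LE[OF that] by (auto simp: I'.cls_add cls_add act_cls P.S.l_distr P.S.r_distr)
    show "act (c \<odot>\<^bsub>L\<^esub> X, Y) w = c \<odot>\<^bsub>I'.L\<^esub> act (X, Y) w" if "c \<in> carrier K" for c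
      using xy z that by (simp add: I'.cls_smult cls_smult act_cls P.smult_mult_l P.smult_mult_r)
    show "act (X, c \<odot>\<^bsub>L\<^esub> Y) w = c \<odot>\<^bsub>I'.L\<^esub> act (X, Y) w" if "c \<in> carrier K" for c
      using xy z that by (simp add: I'.cls_smult cls_smult act_cls P.smult_mult_l P.smult_mult_r)
    show "act (X \<otimes>\<^bsub>L\<^esub> X', Y' \<otimes>\<^bsub>L\<^esub> Y) w = act (X, Y) (act (X', Y') w)"
      if X': "X' \<in> carrier L" and Y': "Y' \<in> carrier L" for X' Y'
    proof -
      obtain x' y' where "x' \<in> carrier P" "X' = cls x'" "y' \<in> carrier P" "Y' = cls y'"
        using LE X' Y' by blast
      then show ?thesis using xy z by (simp add: cls_mult act_cls P.S.m_assoc)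
    qed
  qed
  interpret B: bound_bimodule K Q I M.N
    by (intro bound_bimodule.intro bound_quiver_axioms env_left_module.intro L.assoc_algebra_axioms
        M.left_module_env_module)
  have Aa: "a \<in> arcs Q" if "a \<in> A" for a using that A by blast
  have ar: "?pt (pe (arr a)) = pe (arr a)" if "a \<in> A" for a
    using that by (simp add: part_basis path_avoids_def)
  have "\<exists>h \<in> lmod_hom L.E ?B M.N. \<forall>a\<in>A. h (pc (arr a)) = I'.pc (arr a)"
  proof (rule B.hom_from_projective_arrow_ideal[OF A proj])
    fix a assume a: "a \<in> A"
    show "I'.pc (arr a) \<in> carrier M.N" using a Aa[OF a] by (simp add: CI ar)
    show "L.tens (pc (triv (tail Q a))) (pc (triv (head Q a))) \<odot>\<^bsub>M.N\<^esub> I'.pc (arr a) = I'.pc (arr a)"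
      using Aa[OF a] ar[OF a] pe_append[of "tail Q a" "[]" "tail Q a" "[a]" "head Q a"]
        pe_append[of "tail Q a" "[a]" "head Q a" "[]" "head Q a"]
      by (simp add: M.env_module_tens CI act_cls)
  qed
  then obtain h where h: "h \<in> lmod_hom L.E ?B M.N" "\<forall>a\<in>A. h (pc (arr a)) = I'.pc (arr a)" by blast
  have hw: "h (w \<odot>\<^bsub>?B\<^esub> X) = w \<odot>\<^bsub>M.N\<^esub> h X" if "w \<in> carrier L.E" "X \<in> ?J" for w X
    using h(1) that by (simp add: lmod_hom_def)
  have ht: "h (x \<otimes>\<^bsub>L\<^esub> X \<otimes>\<^bsub>L\<^esub> y) = act (x, y) (h X)" if "x \<in> carrier L" "y \<in> carrier L" "X \<in> ?J" for x y X
  proof -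
    have "h X \<in> C" using h(1) that by (simp add: lmod_hom_def)
    then show ?thesis
      using hw[of "L.tens x y" X] that by (simp add: L.ideal_bimodule_tens[OF J.is_ideal] M.env_module_tens)
  qed
  have ha: "h (X \<oplus>\<^bsub>L\<^esub> Y) = h X \<oplus>\<^bsub>I'.L\<^esub> h Y" if "X \<in> ?J" "Y \<in> ?J" for X Y
    using h(1) that by (simp add: lmod_hom_def)
  have h_smult: "h (c \<odot>\<^bsub>L\<^esub> X) = c \<odot>\<^bsub>I'.L\<^esub> h X" if c: "c \<in> carrier K" and X: "X \<in> ?J" for c X
  proof -
    have hX: "h X \<in> C" using h(1) X by (simp add: lmod_hom_def)
    have "h ((c \<odot>\<^bsub>L\<^esub> \<one>\<^bsub>L\<^esub>) \<otimes>\<^bsub>L\<^esub> X \<otimes>\<^bsub>L\<^esub> \<one>\<^bsub>L\<^esub>) = act (c \<odot>\<^bsub>L\<^esub> \<one>\<^bsub>L\<^esub>, \<one>\<^bsub>L\<^esub>) (h X)"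
      using c X by (intro ht) (simp_all add: L.V.smult_closed)
    then show ?thesis using c X hX
      by (simp add: L.smult_mult_l L.V.smult_closed M.act_smult_l M.act_one)
  qed
  \<comment> \<open>On elements through A the homomorphism is forced to replace cosets of I by
    cosets of \<open>?I\<close>: a path through A is a product p1 a p2, and the value at a is
    prescribed.\<close>
  have h_cls: "cls (?pt z) \<in> ?J \<and> h (cls (?pt z)) = I'.cls (?pt z)" if "z \<in> carrier P" for z
    using that
  proof (induction rule: P_induct)
    case zero
    have "h (\<zero>\<^bsub>K\<^esub> \<odot>\<^bsub>L\<^esub> \<zero>\<^bsub>L\<^esub>) = \<zero>\<^bsub>K\<^esub> \<odot>\<^bsub>I'.L\<^esub> h \<zero>\<^bsub>L\<^esub>" by (rule h_smult) simp_all
    moreover have "h \<zero>\<^bsub>L\<^esub> \<in> C" using h(1) J.zero_closed by (simp add: lmod_hom_def)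
    then have "h \<zero>\<^bsub>L\<^esub> \<in> carrier I'.L" by (rule M.CM)
    ultimately show ?case
      by (simp add: zero_eq_cls[symmetric] I'.zero_eq_cls[symmetric] L.V.smult_l_null I'.L.V.smult_l_null)
  next
    case (add g c u p v)
    have "cls (?pt (pe (u, p, v))) \<in> ?J \<and> h (cls (?pt (pe (u, p, v)))) = I'.cls (?pt (pe (u, p, v)))"
    proof (cases "path_avoids A (u, p, v)")
      case True
      have "h (\<zero>\<^bsub>K\<^esub> \<odot>\<^bsub>L\<^esub> \<zero>\<^bsub>L\<^esub>) = \<zero>\<^bsub>K\<^esub> \<odot>\<^bsub>I'.L\<^esub> h \<zero>\<^bsub>L\<^esub>" by (rule h_smult) simp_all
      moreover have "h \<zero>\<^bsub>L\<^esub> \<in> C" using h(1) J.zero_closed by (simp add: lmod_hom_def)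
      then have "h \<zero>\<^bsub>L\<^esub> \<in> carrier I'.L" by (rule M.CM)
      ultimately show ?thesis using True
        by (simp add: part_basis zero_eq_cls[symmetric] I'.zero_eq_cls[symmetric] L.V.smult_l_null
            I'.L.V.smult_l_null)
    next
      case False
      obtain p1 a p2 where p: "p = p1 @ a # p2" "a \<in> A"
        "(u, p1, tail Q a) \<in> qpaths Q" "a \<in> arcs Q" "(head Q a, p2, v) \<in> qpaths Q"
        using nonavoiding_first[OF add(3) False] by metis
      have p1a: "(u, p1 @ [a], head Q a) \<in> qpaths Q"
        using append_path[OF p(3), of "[a]" "head Q a"] p(4) by simp
      have pe: "pe (u, p1, tail Q a) \<otimes>\<^bsub>P\<^esub> pe (arr a) \<otimes>\<^bsub>P\<^esub> pe (head Q a, p2, v) = pe (u, p, v)"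
        using pe_append[OF p(3), of "[a]" "head Q a"] pe_append[OF p1a p(5)] p(1,4) by simp
      have pc: "pc (u, p1, tail Q a) \<otimes>\<^bsub>L\<^esub> pc (arr a) \<otimes>\<^bsub>L\<^esub> pc (head Q a, p2, v) = pc (u, p, v)"
        using p by (simp add: cls_mult pe)
      have aJ: "pc (arr a) \<in> ?J" by (rule arrow_in_arrow_ideal[OF A p(2)])
      have "pc (u, p, v) \<in> ?J"
        unfolding pc[symmetric] using aJ p by (simp add: J.I_l_closed J.I_r_closed)
      moreover have "h (pc (u, p, v)) = I'.pc (u, p, v)"
        unfolding pc[symmetric] using aJ p h(2) ar[OF p(2)] by (simp add: ht act_cls pe)
      ultimately show ?thesis using False by (simp add: part_basis)
    qed
    then show ?case
      using add J.is_ideal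
      by (simp add: cls_lincomb I'.cls_lincomb ha h_smult L.ideal_smult_closed[OF J.is_ideal])
  qed
  \<comment> \<open>The conclusion comes from \<open>h\<close> being a function on cosets of I: the
    part of z through A lies in I, so its coset is zero, hence so is its coset modulo
    \<open>?I\<close>.\<close>
  have "z \<in> ?I" if z: "z \<in> I" for z
  proof -
    have zP: "z \<in> carrier P" using z by simp
    have "cls (?pt z) = \<zero>\<^bsub>L\<^esub>" using preI(1)[OF z] by (simp add: cls_eq_zero_iff)
    moreover have "h \<zero>\<^bsub>L\<^esub> = \<zero>\<^bsub>I'.L\<^esub>"
      using h_cls[of "\<zero>\<^bsub>P\<^esub>"] by (simp add: zero_eq_cls[symmetric] I'.zero_eq_cls[symmetric])
    ultimately have "I'.cls (?pt z) = \<zero>\<^bsub>I'.L\<^esub>" using h_cls[OF zP] by simp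
    then have "?pt z \<in> ?I" using zP by (simp add: I'.cls_eq_zero_iff)
    moreover have "part_avoiding K A z \<in> ?I" using preI(2)[OF z] by (intro gen) simp_all
    ultimately have "?pt z \<oplus>\<^bsub>P\<^esub> part_avoiding K A z \<in> ?I" by simp
    then show ?thesis using zP by (simp add: part_sum)
  qed
  then show ?thesis using sub by blast
qed

end

theorem propositionA2:
  fixes K :: "('k, 'c) ring_scheme"
    and Q :: "('v, 'a) pre_digraph"
    and I :: "(('v, 'a) qpath \<Rightarrow> 'k) set"
    and A :: "'a set"
  assumes "field K"
    and "fin_digraph Q"
    and "admissible_ideal K Q I"
    and "A \<subseteq> arcs Q"
  shows "arrow_removal K Q I A \<longleftrightarrow>
    pre_removable K I A \<and>
    projective_module (enveloping_algebra K (bound_quiver_algebra K Q I))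
      (ideal_bimodule K (bound_quiver_algebra K Q I) (arrow_ideal K Q I A))"
proof -
  interpret K: field K by fact
  interpret Q: fin_digraph Q by fact
  interpret quiver_algebra K Q by unfold_locales
  have "ideal I P" using assms(3) by (simp add: admissible_ideal_def)
  then interpret bound_quiver K Q I
    by (intro bound_quiver.intro quiver_ideal.intro quiver_algebra_axioms bound_quiver_axioms.intro assms)
  note removal = arrow_removal_def[of K Q I A, unfolded Let_def bound_quiver_algebra_eq corner_condition_iff]
  show ?thesis
    unfolding bound_quiver_algebra_eq
  proof
    assume "arrow_removal K Q I A"
    then obtain G where G: "G \<subseteq> carrier P" "I = Idl\<^bsub>P\<^esub> G"
      "\<forall>z\<in>G. \<forall>p. z p \<noteq> \<zero>\<^bsub>K\<^esub> \<longrightarrow> path_avoids A p"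
      and corner: "\<forall>a\<in>A. \<forall>b\<in>A. \<forall>x\<in>carrier L.
        pc (triv (head Q a)) \<otimes>\<^bsub>L\<^esub> x \<otimes>\<^bsub>L\<^esub> pc (triv (tail Q b)) = \<zero>\<^bsub>L\<^esub>"
      unfolding removal by blast
    then show "pre_removable K I A \<and> projective_module L.E (ideal_bimodule K L (arrow_ideal K Q I A))"
      using pre_removable_if_generated[OF G(1,3)] projective_if_generated[OF assms(4) G] by blast
  next
    assume pre: "pre_removable K I A \<and> projective_module L.E (ideal_bimodule K L (arrow_ideal K Q I A))"
    have "path_avoids A p" if "z \<in> avoiding_generators A" "z p \<noteq> \<zero>\<^bsub>K\<^esub>" for z p
    proof (rule ccontr)
      assume "\<not> path_avoids A p"
      then have "part_through K A z p = z p" by (simp add: part_through_def)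
      then show False using that by (simp add: P_zero)
    qed
    then have "\<exists>G \<subseteq> carrier P. I = Idl\<^bsub>P\<^esub> G \<and> (\<forall>z\<in>G. \<forall>p. z p \<noteq> \<zero>\<^bsub>K\<^esub> \<longrightarrow> path_avoids A p)"
      using avoiding_generators_subset
        generated_if_projective[OF assms(4) conjunct1[OF pre] conjunct2[OF pre]]
      by (intro exI[of _ "avoiding_generators A"] conjI ballI allI impI)
    moreover have "\<forall>a\<in>A. \<forall>b\<in>A. \<forall>x\<in>carrier L.
        pc (triv (head Q a)) \<otimes>\<^bsub>L\<^esub> x \<otimes>\<^bsub>L\<^esub> pc (triv (tail Q b)) = \<zero>\<^bsub>L\<^esub>"
      using corner_if_projective[OF assms(4) conjunct2[OF pre]] by (intro ballI)
    ultimately show "arrow_removal K Q I A"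
      unfolding removal by (rule conjI)
  qed
qed

end
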